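(* Let $N$ and $M$ be positive integers with $M>N$ and $N$ even. Let $X$ be an $N\times M$ real random matrix whose columns are independent, identically distributed $N$-variate normal random vectors with mean zero and covariance matrix $\Sigma$, and let $Y=\frac{1}{M}XX^T$. Suppose that $N-1$ of the eigenvalues of $\Sigma$ equal $1$ and the remaining eigenvalue equals $1+\tau$, where $\tau>-1$ and $\tau\neq 0$. Then the joint probability density function of the eigenvalues $\lambda_1,\ldots,\lambda_N$ of $Y$ is $$P(\lambda)=\tilde{Z}_{M,N}^{-1}\int_{\Gamma}|\Delta(\lambda)|\,e^{\frac{M\tau}{2(1+\tau)}t}\prod_{j=1}^Ne^{-\frac{M}{2}\lambda_j}\lambda_j^{\frac{M-N-1}{2}}\left(t-\lambda_j\right)^{-\frac{1}{2}}\,dt,$$ where $\Delta(\lambda)=\prod_{j<k}(\lambda_k-\lambda_j)$ is the Vandermonde determinant, $\Gamma$ is a closed contour enclosing all the points $\lambda_1,\ldots,\lambda_N$ oriented counter-clockwise, $\tilde{Z}_{M,N}$ is a normalization constant, and the branch cut of $(t-x)^{-1/2}$ is the half-line $\arg(t-x)=\pi$.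
   Context: $Y$ is a real Wishart matrix in the class $W_{\mathbb{R}}(\Sigma,M)$ (a rank 1 real Wishart spiked model). The density $P(\lambda)$ is the (symmetric) density of the unordered eigenvalues on $(0,\infty)^N$. *)

theory Defs
  imports "HOL-Probability.Probability" "HOL-Complex_Analysis.Complex_Analysis"
begin

text \<open>Eigenvalues (with multiplicity) of a square real matrix all of whose eigenvalues are real:
  a vector of the roots of the characteristic polynomial det(x I - A), listed in some order.
  Only symmetric functions of this vector are ever used.\<close>
definition eigvals :: "real^'n^'n \<Rightarrow> real^'n" where
  "eigvals A = (SOME l. \<forall>x::real. det (x *\<^sub>R mat 1 - A) = (\<Prod>i\<in>UNIV. x - l$i))"

definition mvn_density :: "real^'n^'n \<Rightarrow> real^'n \<Rightarrow> real" where
  "mvn_density S x =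
     exp (- (x \<bullet> (matrix_inv S *v x)) / 2) / sqrt ((2 * pi) ^ CARD('n) * det S)"

definition symmetric_fun :: "(real^'n \<Rightarrow> 'b) \<Rightarrow> bool" where
  "symmetric_fun f \<longleftrightarrow> (\<forall>l p. p permutes (UNIV::'n set) \<longrightarrow> f (\<chi> i. l $ p i) = f l)"

definition abs_vandermonde :: "real^'n::{finite,linorder} \<Rightarrow> real" where
  "abs_vandermonde l = (\<Prod>(j,k)\<in>{(j,k). j < k}. \<bar>l$k - l$j\<bar>)"

text \<open>Integrand of the contour integral; (t - x)^(-1/2) uses the principal branch
  (branch cut on arg(t - x) = pi).\<close>
definition spiked_integrand :: "nat \<Rightarrow> real \<Rightarrow> real^'n \<Rightarrow> complex \<Rightarrow> complex" where
  "spiked_integrand M \<tau> l t =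
     exp (of_real (real M * \<tau> / (2 * (1 + \<tau>))) * t) *
     (\<Prod>j\<in>UNIV. of_real (exp (- real M / 2 * l$j) * l$j powr ((real M - real CARD('n) - 1) / 2))
                 * (t - of_real (l$j)) powr (-1/2))"

end

theory Submission
  imports Defs
begin

text \<open>
  For the standard Gaussian matrix the joint eigenvalue density is found without a matrix change of
  variables. Integrating the divergence of a vector field gives loop equations both for the traces
  \<open>tr (X X\<^sup>T)\<^sup>k\<close> under the Gaussian weight and for the power sums \<open>\<Sum>i. \<lambda>\<^sub>i\<^sup>k\<close> under
  \<open>|\<Delta>(\<lambda>)| \<Prod>i. \<lambda>\<^sub>i\<^sup>\<alpha> exp (- \<lambda>\<^sub>i / 2)\<close>. The two systems coincide, and they determine all mixed
  moments recursively up to the total mass; after an exponential damping and a compactification the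
  moments determine the law.

  The spiked Gaussian density is the standard one times \<open>exp (c v\<^sup>T X X\<^sup>T v)\<close> with \<open>v\<close> the spike
  direction. Rotation invariance replaces this factor by its average over the unit sphere, which is
  the function \<open>sphere_average\<close> of the eigenvalues. Expanding in powers of \<open>c\<close>, this average
  and the contour integral of \<open>exp (c t) \<Prod>i. (t - \<lambda>\<^sub>i)\<^sup>-\<^sup>1\<^sup>/\<^sup>2\<close> have proportional
  series: both coefficients come from the Taylor series of \<open>\<Prod>i. (1 - s \<lambda>\<^sub>i)\<^sup>-\<^sup>1\<^sup>/\<^sup>2\<close>, the former by
  Gaussian moments of quadratic forms, the latter by residues at infinity, where evenness of the
  number of eigenvalues makes the integrand single-valued outside the hull of the eigenvalues.
\<close>

text \<open>The loop equations need only translation invariance of Lebesgue measure and calculus on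
  lines, whereas a change of variables would need the Jacobian of the spectral decomposition and a
  measure on frames. They hold with the constant M on the matrix side and 2 \<alpha> + N + 1 on the
  eigenvalue side; equating the two gives \<alpha> = (M - N - 1) / 2. The supports are unbounded, so
  each power sum is multiplied by \<open>exp (- p 1)\<close>, which makes it bounded. Since p 1 is
  the squared norm of X, n such factors only replace the Gaussian scale 1 by 1 + 2 n, and for this
  reason the moments are compared at every scale s. As \<open>eigvals\<close> is a choice, all
  measurability of eigenvalues passes through power sums of the matrix, which suffice for symmetric
  test functions. The factor 2 pi i and the power of c by which contour integral and average differ
  go into Z; hence Z is complex, and \<tau> \<noteq> 0 keeps it away from zero.\<close>

no_notation fps_nth (infixl "$" 75)

section \<open>Lebesgue and Gaussian integrals\<close>

lemma integrable_lborel_translate: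
  fixes f :: "'a::euclidean_space \<Rightarrow> real"
  assumes "integrable lborel f"
  shows "integrable lborel (\<lambda>x. f (x + c))"
proof -
  have "integrable (distr lborel borel ((+) c)) f"
    using assms by (simp add: lborel_distr_plus)
  then show ?thesis
    by (subst (asm) integrable_distr_eq) (use assms in \<open>auto simp: add.commute\<close>)
qed

lemma integral_lborel_translate:
  fixes f :: "'a::euclidean_space \<Rightarrow> real"
  assumes "f \<in> borel_measurable borel"
  shows "(\<integral>x. f (x + c) \<partial>lborel) = (\<integral>x. f x \<partial>lborel)"
proof -
  have "(\<integral>x. f x \<partial>distr lborel borel ((+) c)) = (\<integral>x. f (c + x) \<partial>lborel)"
    by (rule integral_distr) (use assms in auto)
  then show ?thesis by (simp add: lborel_distr_plus add.commute)
qed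

lemma integral_directional_derivative_eq_0:
  fixes H H' :: "'a::euclidean_space \<Rightarrow> real" and b :: 'a
  assumes H: "integrable lborel H" and H': "integrable lborel H'"
    and cont: "\<And>x. continuous_on UNIV (\<lambda>t. H (x + t *\<^sub>R b))"
    and der: "\<And>x. \<exists>S. finite S \<and>
       (\<forall>t. t \<notin> S \<longrightarrow> ((\<lambda>t. H (x + t *\<^sub>R b)) has_real_derivative H' (x + t *\<^sub>R b)) (at t))"
  shows "(\<integral>x. H' x \<partial>lborel) = 0"
proof -
  have [measurable]: "H \<in> borel_measurable borel" "H' \<in> borel_measurable borel"
    using H H' by auto
  define f where "f = (\<lambda>t x. indicator {0..1::real} t * H' (x + t *\<^sub>R b))"
  have intf: "integrable (lborel \<Otimes>\<^sub>M lborel) (\<lambda>(t, x). f t x)"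
  proof (rule lborel_pair.Fubini_integrable)
    show "(\<lambda>(t, x). f t x) \<in> borel_measurable (lborel \<Otimes>\<^sub>M lborel)"
      unfolding f_def by measurable
    have "(\<lambda>t. \<integral>x. norm (case (t, x) of (t, x) \<Rightarrow> f t x) \<partial>lborel) =
          (\<lambda>t. indicator {0..1} t * (\<integral>x. \<bar>H' x\<bar> \<partial>lborel))"
    proof
      fix t :: real
      have "(\<integral>x. norm (case (t, x) of (t, x) \<Rightarrow> f t x) \<partial>lborel) =
            indicator {0..1} t * (\<integral>x. \<bar>H' (x + t *\<^sub>R b)\<bar> \<partial>lborel)"
        by (simp add: f_def abs_mult)
      then show "(\<integral>x. norm (case (t, x) of (t, x) \<Rightarrow> f t x) \<partial>lborel) =
            indicator {0..1} t * (\<integral>x. \<bar>H' x\<bar> \<partial>lborel)"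
        by (simp add: integral_lborel_translate[of "\<lambda>x. \<bar>H' x\<bar>"])
    qed
    then show "integrable lborel (\<lambda>t. \<integral>x. norm (case (t, x) of (t, x) \<Rightarrow> f t x) \<partial>lborel)"
      by simp
    show "AE t in lborel. integrable lborel (\<lambda>x. case (t, x) of (t, x) \<Rightarrow> f t x)"
      by (simp add: f_def integrable_lborel_translate[OF H'])
  qed
  have "(\<integral>x. (\<integral>t. f t x \<partial>lborel) \<partial>lborel) = (\<integral>t. (\<integral>x. f t x \<partial>lborel) \<partial>lborel)"
    by (rule lborel_pair.Fubini_integral[OF intf])
  also have "\<dots> = (\<integral>t. indicator {0..1::real} t * (\<integral>x. H' x \<partial>lborel) \<partial>lborel)"
    by (simp add: f_def integral_lborel_translate)
  also have "\<dots> = (\<integral>x. H' x \<partial>lborel)"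
    by (simp add: content_real)
  finally have 1: "(\<integral>x. (\<integral>t. f t x \<partial>lborel) \<partial>lborel) = (\<integral>x. H' x \<partial>lborel)" .
  have "integrable (lborel \<Otimes>\<^sub>M lborel) (\<lambda>(x, t). f t x)"
    using lborel_pair.integrable_product_swap[OF intf] by (simp add: split_beta')
  from lborel_pair.AE_integrable_fst'[OF this] have "AE x in lborel. integrable lborel (\<lambda>t. f t x)"
    by simp
  then have "AE x in lborel. (\<integral>t. f t x \<partial>lborel) = H (x + b) - H x"
  proof (rule AE_mp, intro AE_I2 impI)
    fix x assume "integrable lborel (\<lambda>t. f t x)"
    then have int: "set_integrable lborel {0..1} (\<lambda>t. H' (x + t *\<^sub>R b))"
      by (simp add: set_integrable_def f_def)
    obtain S where S: "finite S"
      "\<And>t. t \<notin> S \<Longrightarrow> ((\<lambda>t. H (x + t *\<^sub>R b)) has_real_derivative H' (x + t *\<^sub>R b)) (at t)"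
      using der by blast
    have "((\<lambda>t. H' (x + t *\<^sub>R b)) has_integral (H (x + 1 *\<^sub>R b) - H (x + 0 *\<^sub>R b))) {0..1}"
      by (rule fundamental_theorem_of_calculus_strong[OF S(1)])
         (use S(2) continuous_on_subset[OF cont] in
           \<open>auto simp: has_real_derivative_iff_has_vector_derivative\<close>)
    then have "integral {0..1} (\<lambda>t. H' (x + t *\<^sub>R b)) = H (x + b) - H x"
      by (simp add: integral_unique)
    then show "(\<integral>t. f t x \<partial>lborel) = H (x + b) - H x"
      using set_borel_integral_eq_integral(2)[OF int] by (simp add: f_def set_lebesgue_integral_def)
  qed
  moreover have "(\<lambda>x. \<integral>t. f t x \<partial>lborel) \<in> borel_measurable lborel"
    unfolding f_def by measurable
  moreover have "(\<lambda>x. H (x + b) - H x) \<in> borel_measurable lborel"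
    by measurable
  ultimately have "(\<integral>x. (\<integral>t. f t x \<partial>lborel) \<partial>lborel) = (\<integral>x. H (x + b) - H x \<partial>lborel)"
    by (intro integral_cong_AE)
  also have "\<dots> = 0"
    using H by (simp add: integrable_lborel_translate integral_lborel_translate)
  finally show ?thesis using 1 by simp
qed

text \<open>The image measure is again translation invariant, because f is linear and onto, and it
  gives centred balls the same mass. Fubini shows that two such measures are proportional, and the
  unit ball fixes the factor; no determinant enters.\<close>

lemma lborel_distr_isometry:
  fixes f :: "'a::euclidean_space \<Rightarrow> 'a"
  assumes lin: "linear f" and nrm: "\<And>x. norm (f x) = norm x"
  shows "distr lborel borel f = lborel"
proof -
  have cf: "continuous_on UNIV f"
    using lin linear_continuous_on linear_conv_bounded_linear by blast
  then have [measurable]: "f \<in> borel_measurable borel"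
    by (rule borel_measurable_continuous_onI)
  have "inj f" using lin nrm by (metis linear_injective_0 norm_eq_zero)
  then have surj: "surj f" using lin linear_injective_imp_surjective by blast
  define \<mu> where "\<mu> = distr lborel borel f"
  have [measurable_cong]: "sets \<mu> = sets borel" by (simp add: \<mu>_def)
  have shift: "(\<integral>\<^sup>+y. g (y + c) \<partial>\<mu>) = (\<integral>\<^sup>+y. g y \<partial>\<mu>)" if [measurable]: "g \<in> borel_measurable borel" for g c
  proof -
    obtain d where d: "f d = c" using surj by (metis surj_def)
    have "(\<integral>\<^sup>+y. g (y + c) \<partial>\<mu>) = (\<integral>\<^sup>+x. g (f (d + x)) \<partial>lborel)"
      by (simp add: \<mu>_def nn_integral_distr linear_add[OF lin] d add.commute)
    also have "\<dots> = (\<integral>\<^sup>+x. g (f x) \<partial>distr lborel borel ((+) d))"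
      by (subst nn_integral_distr) auto
    also have "\<dots> = (\<integral>\<^sup>+y. g y \<partial>\<mu>)"
      by (simp add: \<mu>_def nn_integral_distr lborel_distr_plus)
    finally show ?thesis .
  qed
  have shiftL: "(\<integral>\<^sup>+y. g (y + c) \<partial>lborel) = (\<integral>\<^sup>+y. g y \<partial>lborel)"
    if [measurable]: "g \<in> borel_measurable borel" for g and c :: 'a
  proof -
    have "(\<integral>\<^sup>+y. g y \<partial>distr lborel borel ((+) c)) = (\<integral>\<^sup>+y. g (c + y) \<partial>lborel)"
      by (subst nn_integral_distr) auto
    then show ?thesis by (simp add: lborel_distr_plus add.commute)
  qed
  have vim: "f -` ball 0 r = ball 0 r" for r
    by (auto simp: nrm)
  have ballm: "emeasure \<mu> (ball 0 r) = emeasure lborel (ball (0::'a) r)" for r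
    by (simp add: \<mu>_def emeasure_distr vim)
  have sf: "sigma_finite_measure \<mu>"
  proof
    show "\<exists>A. countable A \<and> A \<subseteq> sets \<mu> \<and> \<Union>A = space \<mu> \<and> (\<forall>a\<in>A. emeasure \<mu> a \<noteq> \<infinity>)"
    proof (intro exI[of _ "range (\<lambda>n. ball 0 (real n))"] conjI ballI)
      show "\<Union> (range (\<lambda>n. ball 0 (real n))) = space \<mu>"
        by (auto simp: \<mu>_def reals_Archimedean2)
    next
      fix a assume "a \<in> range (\<lambda>n. ball (0::'a) (real n))"
      then show "emeasure \<mu> a \<noteq> \<infinity>"
        using emeasure_bounded_finite[of a] by (auto simp: ballm)
    qed auto
  qed
  interpret S: sigma_finite_measure \<mu> by fact
  interpret P: pair_sigma_finite lborel \<mu>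
    unfolding pair_sigma_finite_def using sf sigma_finite_lborel by blast
  let ?E = "ball (0::'a) 1"
  have Epos: "emeasure lborel ?E \<noteq> 0"
    using content_ball_pos[of 1 "0::'a"] by (auto simp: measure_def)
  have Efin: "emeasure lborel ?E \<noteq> \<infinity>" using emeasure_bounded_finite[of ?E] by auto
  have Em[measurable]: "?E \<in> sets borel" by simp
  have meas: "g \<in> borel_measurable (lborel \<Otimes>\<^sub>M \<mu>)"
    if "g \<in> borel_measurable (borel \<Otimes>\<^sub>M borel)" for g :: "'a \<times> 'a \<Rightarrow> ennreal"
    using that by (subst measurable_cong_sets[of _ "borel \<Otimes>\<^sub>M borel" _ borel])
                  (auto intro!: sets_pair_measure_cong simp: \<mu>_def)
  \<comment> \<open>Both sides measure, in the product of the two measures, the pairs with x in the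
    ball and x + y in B. Shifting x by y lets B be integrated against Lebesgue measure and leaves
    for \<open>\<mu>\<close> a translate of the reflected ball, which is a ball again.\<close>
  have key: "emeasure lborel ?E * emeasure \<mu> B = emeasure lborel B * emeasure lborel ?E"
    if [measurable]: "B \<in> sets borel" for B
  proof -
    have "emeasure lborel ?E * emeasure \<mu> B = (\<integral>\<^sup>+x. indicator ?E x * (\<integral>\<^sup>+y. indicator B y \<partial>\<mu>) \<partial>lborel)"
      by (subst nn_integral_multc) (auto intro!: borel_measurable_indicator)
    also have "\<dots> = (\<integral>\<^sup>+x. indicator ?E x * (\<integral>\<^sup>+y. indicator B (y + x) \<partial>\<mu>) \<partial>lborel)"
      by (intro nn_integral_cong, subst shift[of "indicator B"]) auto
    also have "\<dots> = (\<integral>\<^sup>+x. (\<integral>\<^sup>+y. indicator ?E x * indicator B (y + x) \<partial>\<mu>) \<partial>lborel)"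
      by (intro nn_integral_cong, subst nn_integral_cmult) auto
    also have "\<dots> = (\<integral>\<^sup>+y. (\<integral>\<^sup>+x. indicator ?E x * indicator B (y + x) \<partial>lborel) \<partial>\<mu>)"
      by (rule P.Fubini'[symmetric], rule meas) (use Em in measurable)
    also have "\<dots> = (\<integral>\<^sup>+y. (\<integral>\<^sup>+x. indicator ?E (x - y) * indicator B x \<partial>lborel) \<partial>\<mu>)"
    proof (rule nn_integral_cong)
      fix y
      show "(\<integral>\<^sup>+x. indicator ?E x * indicator B (y + x) \<partial>lborel) =
            (\<integral>\<^sup>+x. (indicator ?E (x - y) * indicator B x ::ennreal) \<partial>lborel)"
        using shiftL[of "\<lambda>x. indicator ?E (x - y) * indicator B x" y]
        by (simp add: add.commute)
    qed
    also have "\<dots> = (\<integral>\<^sup>+x. (\<integral>\<^sup>+y. indicator ?E (x - y) * indicator B x \<partial>\<mu>) \<partial>lborel)"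
      by (rule P.Fubini', rule meas) (use Em in measurable)
    also have "\<dots> = (\<integral>\<^sup>+x. indicator B x * emeasure \<mu> ?E \<partial>lborel)"
    proof (rule nn_integral_cong)
      fix x :: 'a
      have "(\<integral>\<^sup>+y. indicator ?E (x - y) * indicator B x \<partial>\<mu>) = indicator B x * (\<integral>\<^sup>+y. indicator ?E (y + (- x)) \<partial>\<mu>)"
        by (subst nn_integral_cmult[symmetric])
           (auto intro!: nn_integral_cong simp: indicator_def dist_norm norm_minus_commute)
      also have "\<dots> = indicator B x * emeasure \<mu> ?E"
        by (subst shift[of "indicator ?E"]) auto
      finally show "(\<integral>\<^sup>+y. indicator ?E (x - y) * indicator B x \<partial>\<mu>) = indicator B x * emeasure \<mu> ?E" .
    qed
    also have "\<dots> = emeasure lborel B * emeasure lborel ?E"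
      by (subst nn_integral_multc) (auto simp: ballm intro!: borel_measurable_indicator)
    finally show ?thesis .
  qed
  have "lborel = \<mu>"
  proof (rule measure_eqI)
    fix A assume "A \<in> sets (lborel::'a measure)"
    then have "emeasure lborel ?E * emeasure \<mu> A = emeasure lborel ?E * emeasure lborel A"
      using key[of A] by (simp add: mult.commute)
    then show "emeasure lborel A = emeasure \<mu> A"
      using Epos Efin by (simp add: ennreal_mult_cancel_left)
  qed (simp add: \<mu>_def)
  then show ?thesis by (simp add: \<mu>_def)
qed

lemma power_le_fact_mult_exp:
  fixes y :: real
  assumes "0 \<le> y"
  shows "y ^ d \<le> fact d * exp y"
proof -
  have "(\<Sum>n\<in>{d}. y ^ n /\<^sub>R fact n) \<le> (\<Sum>n. y ^ n /\<^sub>R fact n)"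
    by (rule sum_le_suminf) (use assms summable_exp_generic[of y] in auto)
  then show ?thesis by (simp add: exp_def field_simps)
qed

lemma nn_integral_lborel_scaleR:
  fixes f :: "'a::euclidean_space \<Rightarrow> ennreal"
  assumes [measurable]: "f \<in> borel_measurable borel" and "c > 0"
  shows "(\<integral>\<^sup>+x. f x \<partial>lborel) = ennreal (c ^ DIM('a)) * (\<integral>\<^sup>+x. f (c *\<^sub>R x) \<partial>lborel)"
  by (subst lborel_affine[of c 0])
     (use \<open>c > 0\<close> in \<open>simp_all add: nn_integral_density nn_integral_distr nn_integral_cmult\<close>)

lemma nn_integral_lborel_scale_coordinates:
  fixes f :: "real^'n \<Rightarrow> ennreal"
  assumes [measurable]: "f \<in> borel_measurable borel" and c: "\<And>i. c i > 0"
  shows "(\<integral>\<^sup>+x. f x \<partial>lborel) = ennreal (\<Prod>i\<in>UNIV. c i) * (\<integral>\<^sup>+x. f (\<chi> i. c i * x $ i) \<partial>lborel)"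
proof -
  \<comment> \<open>The affine change of variables takes one factor per basis vector, so the index
    is read back off \<open>axis i 1\<close>.\<close>
  define e where "e = (\<lambda>b::real^'n. c (THE i. b = axis i 1))"
  have the: "(THE i. axis j (1::real) = axis i 1) = j" for j :: 'n
    by (rule the_equality) (auto simp: axis_eq_axis)
  have e: "e (axis i 1) = c i" for i by (simp add: e_def the)
  have B: "(Basis :: (real^'n) set) = range (\<lambda>i. axis i 1)"
    by (auto simp: Basis_vec_def)
  have inj: "inj (\<lambda>i::'n. axis i (1::real))" by (auto simp: inj_def axis_eq_axis)
  have T: "(\<Sum>j\<in>Basis. (e j * (x \<bullet> j)) *\<^sub>R j) = (\<chi> i. c i * x $ i)" for x :: "real^'n"
    unfolding B sum.reindex[OF inj]
    by (simp add: e inner_axis vec_eq_iff) (simp add: axis_def if_distrib cong: if_cong)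
  have P: "(\<Prod>j\<in>(Basis::(real^'n) set). \<bar>e j\<bar>) = (\<Prod>i\<in>UNIV. c i)"
    using c by (simp add: B prod.reindex[OF inj] e less_imp_le)
  have m: "(\<lambda>x::real^'n. \<chi> i. c i * x $ i) \<in> borel_measurable borel"
    by (intro borel_measurable_continuous_onI continuous_on_vec_lambda continuous_intros)
  note [measurable] = m
  have c': "\<And>i. c i \<noteq> 0" using c by (metis less_irrefl)
  have "j \<in> Basis \<Longrightarrow> e j \<noteq> 0" for j using c' by (auto simp: B e)
  from lborel_affine_euclidean[of e 0, OF this]
  have "lborel = density (distr lborel borel (\<lambda>x::real^'n. \<chi> i. c i * x $ i)) (\<lambda>_. ennreal (\<Prod>i\<in>UNIV. c i))"
    by (simp add: T P)
  then have "(\<integral>\<^sup>+x. f x \<partial>lborel) = (\<integral>\<^sup>+x. f x \<partial>density (distr lborel borel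
      (\<lambda>x::real^'n. \<chi> i. c i * x $ i)) (\<lambda>_. ennreal (\<Prod>i\<in>UNIV. c i)))"
    by (rule arg_cong)
  also have "\<dots> = ennreal (\<Prod>i\<in>UNIV. c i) * (\<integral>\<^sup>+x. f (\<chi> i. c i * x $ i) \<partial>lborel)"
    by (simp add: nn_integral_density nn_integral_distr nn_integral_cmult)
  finally show ?thesis .
qed

lemma nn_integral_gaussian_finite:
  assumes "s > 0"
  shows "(\<integral>\<^sup>+x. ennreal (exp (- s * (norm x)\<^sup>2)) \<partial>(lborel::'a::euclidean_space measure)) < \<infinity>"
proof -
  have 1: "(\<integral>\<^sup>+x. ennreal (exp (- s * x\<^sup>2)) \<partial>lborel) < \<infinity>"
  proof -
    define \<sigma> where "\<sigma> = sqrt (1 / (2 * s))"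
    have s2: "\<sigma>\<^sup>2 = 1 / (2 * s)" using assms by (simp add: \<sigma>_def)
    have "integrable lborel (\<lambda>x. sqrt (2 * pi * \<sigma>\<^sup>2) * normal_density 0 \<sigma> x)"
      by (intro integrable_mult_right) (use assms in \<open>auto simp: \<sigma>_def\<close>)
    also have "(\<lambda>x. sqrt (2 * pi * \<sigma>\<^sup>2) * normal_density 0 \<sigma> x) = (\<lambda>x. exp (- s * x\<^sup>2))"
      using assms by (auto simp: normal_density_def s2 fun_eq_iff field_simps)
    finally show ?thesis by (simp add: integrable_iff_bounded)
  qed
  have "(\<integral>\<^sup>+x. ennreal (exp (- s * (norm x)\<^sup>2)) \<partial>(lborel::'a measure)) =
        (\<integral>\<^sup>+x. (\<Prod>b\<in>Basis. ennreal (exp (- s * (x \<bullet> b)\<^sup>2))) \<partial>(lborel::'a measure))"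
  proof (rule nn_integral_cong)
    fix x :: 'a
    have "(norm x)\<^sup>2 = (\<Sum>b\<in>Basis. (x \<bullet> b)\<^sup>2)"
      unfolding power2_norm_eq_inner by (subst euclidean_inner) (simp add: power2_eq_square)
    then show "ennreal (exp (- s * (norm x)\<^sup>2)) = (\<Prod>b\<in>Basis. ennreal (exp (- s * (x \<bullet> b)\<^sup>2)))"
      by (simp add: prod_ennreal exp_sum[symmetric] sum_distrib_left sum_negf)
  qed
  also have "\<dots> = (\<Prod>b\<in>(Basis::'a set). \<integral>\<^sup>+x. ennreal (exp (- s * x\<^sup>2)) \<partial>lborel)"
    by (rule nn_integral_lborel_prod) auto
  also have "\<dots> < \<infinity>" using 1 by (simp add: power_less_top_ennreal)
  finally show ?thesis .
qed

text \<open>Half of the exponent absorbs the polynomial: (1 + r)^d is at most d! exp (1 + r), and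
  completing the square bounds r by s r^2 / 4 + 1 / s, so a Gaussian with exponent s r^2 / 4
  remains.\<close>

lemma integrable_polynomial_growth_times_gaussian:
  fixes f :: "'a::euclidean_space \<Rightarrow> real"
  assumes [measurable]: "f \<in> borel_measurable borel" and b: "\<And>x. \<bar>f x\<bar> \<le> C * (1 + norm x) ^ d" and "s > 0"
  shows "integrable lborel (\<lambda>x. f x * exp (- s * (norm x)\<^sup>2 / 2))"
proof -
  have "C \<ge> 0" using b[of 0] by (auto intro: order_trans[OF abs_ge_zero])
  define K where "K = C * (fact d * exp (1 + 1 / s))"
  have K0: "K \<ge> 0" using \<open>C \<ge> 0\<close> by (simp add: K_def)
  have K: "\<bar>f x\<bar> * exp (- s * (norm x)\<^sup>2 / 2) \<le> K * exp (- (s / 4) * (norm x)\<^sup>2)" for x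
  proof -
    have "s\<^sup>2 * (norm x)\<^sup>2 / 4 - s * norm x + 1 = (s * norm x / 2 - 1)\<^sup>2"
      by (simp add: power2_eq_square field_simps)
    then have "s\<^sup>2 * (norm x)\<^sup>2 / 4 - s * norm x + 1 \<ge> 0"
      by simp
    then have "s * norm x \<le> s * (s * (norm x)\<^sup>2 / 4 + 1 / s)"
      using \<open>s > 0\<close> by (simp add: distrib_left power2_eq_square)
    then have le: "norm x \<le> s * (norm x)\<^sup>2 / 4 + 1 / s"
      using \<open>s > 0\<close> by (simp only: mult_le_cancel_left_pos)
    have "\<bar>f x\<bar> \<le> C * (fact d * exp (1 + norm x))"
      using b[of x] mult_left_mono[OF power_le_fact_mult_exp[of "1 + norm x" d] \<open>C \<ge> 0\<close>] by simp
    also have "\<dots> \<le> C * (fact d * exp (1 + 1 / s + s * (norm x)\<^sup>2 / 4))"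
      using le \<open>C \<ge> 0\<close> by (intro mult_left_mono) auto
    also have "\<dots> = K * exp (s * (norm x)\<^sup>2 / 4)"
      by (simp add: K_def exp_add)
    finally have "\<bar>f x\<bar> * exp (- s * (norm x)\<^sup>2 / 2) \<le> K * exp (s * (norm x)\<^sup>2 / 4) * exp (- s * (norm x)\<^sup>2 / 2)"
      by (rule mult_right_mono) simp
    also have "\<dots> = K * exp (- (s / 4) * (norm x)\<^sup>2)"
      by (simp add: mult_exp_exp mult.assoc)
    finally show ?thesis .
  qed
  have "integrable lborel (\<lambda>x::'a. K * exp (- (s / 4) * (norm x)\<^sup>2))"
    using nn_integral_gaussian_finite[of "s / 4", where 'a='a] \<open>s > 0\<close>
    by (intro integrable_mult_right) (auto simp: integrable_iff_bounded)
  then show ?thesis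
    by (rule Bochner_Integration.integrable_bound) (use K K0 in \<open>auto simp: abs_mult\<close>)
qed

lemma nn_integral_lborel_prod_vec:
  assumes [measurable]: "\<And>i. f i \<in> borel_measurable borel"
  shows "(\<integral>\<^sup>+x. (\<Prod>i\<in>UNIV. f i (x $ i)) \<partial>(lborel::(real^'n) measure)) = (\<Prod>i\<in>UNIV. \<integral>\<^sup>+x. f i x \<partial>lborel)"
proof -
  define g where "g = (\<lambda>b::real^'n. f (THE i. b = axis i 1))"
  have the: "(THE i. axis j (1::real) = axis i 1) = j" for j :: 'n
    by (rule the_equality) (auto simp: axis_eq_axis)
  have g: "g (axis i 1) = f i" for i by (simp add: g_def the)
  have B: "(Basis :: (real^'n) set) = range (\<lambda>i. axis i 1)"
    by (auto simp: Basis_vec_def)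
  have inj: "inj (\<lambda>i::'n. axis i (1::real))" by (auto simp: inj_def axis_eq_axis)
  have "(\<integral>\<^sup>+x. (\<Prod>b\<in>Basis. g b (x \<bullet> b)) \<partial>(lborel::(real^'n) measure)) = (\<Prod>b\<in>Basis. \<integral>\<^sup>+x. g b x \<partial>lborel)"
    by (rule nn_integral_lborel_prod) (auto simp: g_def)
  then show ?thesis by (simp add: B prod.reindex[OF inj] g inner_axis)
qed

lemma integrable_exp_orthant:
  assumes "s > 0"
  shows "integrable lborel (\<lambda>l::real^'n. indicator {l. \<forall>i. 0 < l $ i} l * exp (- s * (\<Sum>i\<in>UNIV. l $ i)))"
proof -
  have "(\<integral>\<^sup>+x. ennreal (exponential_density s x) \<partial>lborel) = 1"
    using prob_space.emeasure_space_1[OF prob_space_exponential_density[OF assms]]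
    by (simp add: emeasure_density)
  then have 1: "(\<integral>\<^sup>+x. ennreal (exponential_density s x) * ennreal (1 / s) \<partial>lborel) < \<infinity>"
    by (simp add: nn_integral_multc)
  have "(\<integral>\<^sup>+x. ennreal (indicator {0<..} x * exp (- s * x)) \<partial>lborel) < \<infinity>"
  proof (rule le_less_trans[OF nn_integral_mono 1])
    fix x :: real
    show "ennreal (indicator {0<..} x * exp (- s * x)) \<le> ennreal (exponential_density s x) * ennreal (1 / s)"
      using assms by (auto simp: exponential_density_def indicator_def mult.commute ennreal_mult'[symmetric])
  qed
  then have fin: "(\<Prod>i\<in>(UNIV::'n set). \<integral>\<^sup>+x. ennreal (indicator {0<..} x * exp (- s * x)) \<partial>lborel) < \<infinity>"
    by (simp add: power_less_top_ennreal)
  have "(\<integral>\<^sup>+l. ennreal (norm (indicator {l::real^'n. \<forall>i. 0 < l $ i} l * exp (- s * (\<Sum>i\<in>UNIV. l $ i)))) \<partial>lborel)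
    = (\<integral>\<^sup>+l. (\<Prod>i\<in>UNIV. ennreal (indicator {0<..} (l $ i) * exp (- s * l $ i))) \<partial>(lborel::(real^'n) measure))"
  proof (rule nn_integral_cong)
    fix l :: "real^'n"
    have "(\<Prod>i\<in>UNIV. (indicator {0<..} (l $ i) * exp (- s * l $ i))) =
       indicator {l::real^'n. \<forall>i. 0 < l $ i} l * exp (- s * (\<Sum>i\<in>UNIV. l $ i))"
      by (auto simp: prod.distrib sum_distrib_left exp_sum indicator_def sum_negf[symmetric] simp del: sum_negf)
    then show "ennreal (norm (indicator {l::real^'n. \<forall>i. 0 < l $ i} l * exp (- s * (\<Sum>i\<in>UNIV. l $ i))))
       = (\<Prod>i\<in>UNIV. ennreal (indicator {0<..} (l $ i) * exp (- s * l $ i)))"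
      by (subst prod_ennreal) auto
  qed
  also have "\<dots> < \<infinity>"
    by (subst nn_integral_lborel_prod_vec) (use fin in auto)
  finally show ?thesis
    by (auto simp: integrable_iff_bounded)
qed

section \<open>Lebesgue measure on matrices as a product over columns\<close>

definition of_columns :: "('m \<Rightarrow> real^'n) \<Rightarrow> real^'m^'n" where
  "of_columns c = (\<chi> i j. c j $ i)"

lemma column_of_columns [simp]: "column j (of_columns c) = c j"
  by (simp add: of_columns_def column_def vec_eq_iff)

lemma of_columns_column: "of_columns (\<lambda>j. column j X) = X"
  by (simp add: of_columns_def column_def vec_eq_iff)

lemma of_columns_measurable [measurable]:
  "of_columns \<in> borel_measurable (\<Pi>\<^sub>M j\<in>(UNIV::'m::finite set). (borel :: (real^'n) measure))"
proof (rule borel_measurable_euclidean_space[THEN iffD2], intro ballI)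
  fix b :: "real^'m^'n" assume "b \<in> Basis"
  then obtain i j where b: "b = axis i (axis j 1)"
    by (auto simp: Basis_vec_def)
  have eq: "(\<lambda>c. of_columns c \<bullet> b) = (\<lambda>c. (c j) \<bullet> axis i 1)"
    by (simp add: b inner_axis of_columns_def fun_eq_iff)
  show "(\<lambda>c. of_columns c \<bullet> b) \<in> borel_measurable (\<Pi>\<^sub>M j\<in>(UNIV::'m set). (borel :: (real^'n) measure))"
    unfolding eq by measurable
qed

lemma prod_Basis_matrix:
  "prod g (Basis :: (real^'m^'n) set) = (\<Prod>j\<in>UNIV. \<Prod>i\<in>UNIV. g (axis i (axis j 1)))"
proof -
  have B: "(Basis :: (real^'m^'n) set) = (\<lambda>(j,i). axis i (axis j 1)) ` (UNIV \<times> UNIV)"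
    by (auto simp: Basis_vec_def)
  have inj: "inj_on (\<lambda>(j::'m,i::'n). axis i (axis j (1::real))) (UNIV \<times> UNIV)"
    by (auto simp: inj_on_def axis_eq_axis)
  show ?thesis
    unfolding B prod.reindex[OF inj] by (simp add: prod.cartesian_product o_def split_beta)
qed

text \<open>It suffices to compare boxes, and membership of a matrix in a box is a separate
  condition on each column.\<close>

lemma lborel_eq_distr_of_columns:
  "(lborel :: (real^'m^'n) measure) = distr (\<Pi>\<^sub>M j\<in>UNIV. lborel) borel of_columns"
proof (rule lborel_eqI)
  fix l u :: "real^'m^'n" assume le: "\<And>b. b \<in> Basis \<Longrightarrow> l \<bullet> b \<le> u \<bullet> b"
  interpret product_sigma_finite "\<lambda>_::'m. lborel :: (real^'n) measure"
    by unfold_locales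
  have le': "l $ i $ j \<le> u $ i $ j" for i j
    using le[of "axis i (axis j 1)"] by (simp add: inner_axis)
  have box: "of_columns c \<in> box l u \<longleftrightarrow> (\<forall>j. c j \<in> box (column j l) (column j u))" for c :: "'m \<Rightarrow> real^'n"
    by (auto simp: mem_box Basis_vec_def inner_axis of_columns_def column_def)
  have "emeasure (distr (\<Pi>\<^sub>M j\<in>UNIV. lborel) borel of_columns) (box l u) =
        emeasure (\<Pi>\<^sub>M j\<in>(UNIV::'m set). (lborel::(real^'n) measure)) (\<Pi>\<^sub>E j\<in>UNIV. box (column j l) (column j u))"
    by (subst emeasure_distr) (auto simp: box space_PiM PiE_iff intro!: arg_cong2[where f=emeasure])
  also have "\<dots> = (\<Prod>j\<in>UNIV. emeasure lborel (box (column j l) (column j u)))"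
    by (rule emeasure_PiM) auto
  also have "\<dots> = (\<Prod>j\<in>UNIV. ennreal (\<Prod>i\<in>UNIV. u $ i $ j - l $ i $ j))"
  proof (rule prod.cong[OF refl])
    fix j :: 'm
    have inj: "inj (\<lambda>i::'n. axis i (1::real))" by (auto simp: inj_def axis_eq_axis)
    have B: "(Basis :: (real^'n) set) = range (\<lambda>i. axis i 1)"
      by (auto simp: Basis_vec_def)
    have "emeasure lborel (box (column j l) (column j u)) = ennreal (\<Prod>b\<in>Basis. (column j u - column j l) \<bullet> b)"
      by (rule emeasure_lborel_box) (use le' in \<open>auto simp: B inner_axis column_def\<close>)
    also have "(\<Prod>b\<in>Basis. (column j u - column j l) \<bullet> b) = (\<Prod>i\<in>UNIV. u $ i $ j - l $ i $ j)"
      unfolding B prod.reindex[OF inj] by (simp add: inner_axis column_def)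
    finally show "emeasure lborel (box (column j l) (column j u)) = ennreal (\<Prod>i\<in>UNIV. u $ i $ j - l $ i $ j)" .
  qed
  also have "\<dots> = ennreal (\<Prod>b\<in>Basis. (u - l) \<bullet> b)"
    unfolding prod_Basis_matrix by (subst prod_ennreal) (auto simp: inner_axis le' intro!: prod_nonneg)
  finally show "emeasure (distr (\<Pi>\<^sub>M j\<in>UNIV. lborel) borel of_columns) (box l u) = ennreal (\<Prod>b\<in>Basis. (u - l) \<bullet> b)" .
qed simp

text \<open>The passage from the probability space to Lebesgue measure on matrices: independence
  makes the joint law of the columns a product, and each factor has density g.\<close>

lemma nn_integral_independent_columns:
  fixes \<Omega> :: "'w measure" and X :: "'w \<Rightarrow> real^'m^'n" and g :: "real^'n \<Rightarrow> ennreal"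
  assumes "prob_space \<Omega>" and X: "X \<in> borel_measurable \<Omega>"
    and indep: "prob_space.indep_vars \<Omega> (\<lambda>_. borel) (\<lambda>j \<omega>. column j (X \<omega>)) UNIV"
    and dis: "\<And>j. distributed \<Omega> lborel (\<lambda>\<omega>. column j (X \<omega>)) g"
    and g[measurable]: "g \<in> borel_measurable borel"
    and F[measurable]: "F \<in> borel_measurable borel"
  shows "(\<integral>\<^sup>+\<omega>. F (X \<omega>) \<partial>\<Omega>) = (\<integral>\<^sup>+x. (\<Prod>j\<in>UNIV. g (column j x)) * F x \<partial>lborel)"
proof -
  interpret prob_space \<Omega> by fact
  note X[measurable]
  have rv: "random_variable borel (\<lambda>\<omega>. column j (X \<omega>))" for j
    using distributed_measurable[OF dis[of j]] by simp
  have d: "distr \<Omega> borel (\<lambda>\<omega>. column j (X \<omega>)) = density lborel g" for j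
    using distributed_distr_eq_density[OF dis[of j]] by (simp cong: distr_cong)
  have pg: "prob_space (density lborel g)"
    using prob_space_distr[OF rv] d by metis
  interpret L: product_sigma_finite "\<lambda>_::'m. lborel :: (real^'n) measure"
    by unfold_locales
  interpret G: product_sigma_finite "\<lambda>_::'m. density lborel g"
    using pg by (simp add: product_sigma_finite_def prob_space_imp_sigma_finite)
  let ?P = "\<Pi>\<^sub>M j\<in>(UNIV::'m set). (lborel :: (real^'n) measure)"
  have [measurable_cong]: "sets ?P = sets (\<Pi>\<^sub>M j\<in>(UNIV::'m set). (borel :: (real^'n) measure))"
    by (intro sets_PiM_cong) auto
  have dens: "density ?P (\<lambda>c. \<Prod>j\<in>UNIV. g (c j)) = (\<Pi>\<^sub>M j\<in>(UNIV::'m set). density lborel g)"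
  proof (rule G.PiM_eqI)
    show "sets (density ?P (\<lambda>c. \<Prod>j\<in>UNIV. g (c j))) = sets (\<Pi>\<^sub>M j\<in>(UNIV::'m set). density lborel g)"
      by (simp cong: sets_PiM_cong)
  next
    fix A :: "'m \<Rightarrow> (real^'n) set" assume "\<And>i. i \<in> UNIV \<Longrightarrow> A i \<in> sets (density lborel g)"
    then have A[measurable]: "\<And>i. A i \<in> sets borel" by simp
    have PA: "Pi\<^sub>E UNIV A \<in> sets ?P" by (rule sets_PiM_I_finite) auto
    have "emeasure (density ?P (\<lambda>c. \<Prod>j\<in>UNIV. g (c j))) (Pi\<^sub>E UNIV A) =
       (\<integral>\<^sup>+c. (\<Prod>j\<in>UNIV. g (c j)) * indicator (Pi\<^sub>E UNIV A) c \<partial>?P)"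
      by (rule emeasure_density) (use PA in measurable)
    also have "\<dots> = (\<integral>\<^sup>+c. (\<Prod>j\<in>UNIV. g (c j) * indicator (A j) (c j)) \<partial>?P)"
      by (intro nn_integral_cong) (auto simp: prod.distrib indicator_def PiE_def Pi_def)
    also have "\<dots> = (\<Prod>j\<in>UNIV. \<integral>\<^sup>+x. g x * indicator (A j) x \<partial>lborel)"
      by (rule L.product_nn_integral_prod) auto
    also have "\<dots> = (\<Prod>j\<in>UNIV. emeasure (density lborel g) (A j))"
      by (simp add: emeasure_density)
    finally show "emeasure (density ?P (\<lambda>c. \<Prod>j\<in>UNIV. g (c j))) (Pi\<^sub>E UNIV A) =
       (\<Prod>j\<in>UNIV. emeasure (density lborel g) (A j))" .
  qed simp
  have "(\<integral>\<^sup>+\<omega>. F (X \<omega>) \<partial>\<Omega>) = (\<integral>\<^sup>+\<omega>. F (of_columns (\<lambda>j\<in>UNIV. column j (X \<omega>))) \<partial>\<Omega>)"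
    by (simp add: of_columns_column restrict_def)
  also have "\<dots> = (\<integral>\<^sup>+c. F (of_columns c) \<partial>distr \<Omega> (\<Pi>\<^sub>M j\<in>UNIV. borel) (\<lambda>\<omega>. \<lambda>j\<in>UNIV. column j (X \<omega>)))"
    by (subst nn_integral_distr) (use rv in \<open>auto intro!: measurable_restrict\<close>)
  also have "distr \<Omega> (\<Pi>\<^sub>M j\<in>UNIV. borel) (\<lambda>\<omega>. \<lambda>j\<in>UNIV. column j (X \<omega>)) = density ?P (\<lambda>c. \<Prod>j\<in>UNIV. g (c j))"
    using indep_vars_iff_distr_eq_PiM[where I = "UNIV::'m set" and M' = "\<lambda>_. borel" and X = "\<lambda>j \<omega>. column j (X \<omega>)"] rv indep
    by (simp add: dens d)
  also have "(\<integral>\<^sup>+c. F (of_columns c) \<partial>density ?P (\<lambda>c. \<Prod>j\<in>UNIV. g (c j))) =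
      (\<integral>\<^sup>+c. (\<Prod>j\<in>UNIV. g (c j)) * F (of_columns c) \<partial>?P)"
    by (rule nn_integral_density) measurable
  also have "\<dots> = (\<integral>\<^sup>+x. (\<Prod>j\<in>UNIV. g (column j x)) * F x \<partial>lborel)"
  proof -
    have colm: "(\<lambda>x::real^'m^'n. column j x) \<in> borel_measurable borel" for j
      unfolding column_def
      by (intro borel_measurable_continuous_onI continuous_on_vec_lambda continuous_intros)
    note [measurable] = colm
    show ?thesis
      by (subst lborel_eq_distr_of_columns, subst nn_integral_distr) (simp_all, measurable)
  qed
  finally show ?thesis .
qed

section \<open>Symmetric matrices and their eigenvalues\<close>

text \<open>Source of the product rule, of linearity in each factor and of distributivity over sums
  for matrix products.\<close>

lemma bounded_bilinear_matrix_mult: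
  "bounded_bilinear (\<lambda>(A::real^'m^'n) (B::real^'k^'m). A ** B)"
proof -
  have "bilinear (\<lambda>(A::real^'m^'n) (B::real^'k^'m). A ** B)"
    by (simp add: bilinear_def linear_iff matrix_matrix_mult_def vec_eq_iff sum.distrib
          distrib_left distrib_right sum_distrib_left mult_ac)
  then show ?thesis by (simp add: bilinear_conv_bounded_bilinear)
qed

definition diag_mat :: "real^'n \<Rightarrow> real^'n^'n" where
  "diag_mat l = (\<chi> i j. if i = j then l $ i else 0)"

lemma inner_matrix_vector_symmetric:
  fixes A :: "real^'n^'n"
  assumes "transpose A = A"
  shows "x \<bullet> (A *v y) = (A *v x) \<bullet> y"
  using dot_lmul_matrix[of x A y] assms by (metis transpose_matrix_vector)

text \<open>The vector is a maximiser of the Rayleigh quotient on the unit sphere of the subspace.\<close>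
lemma symmetric_eigenvector_in_subspace:
  fixes A :: "real^'n^'n"
  assumes sym: "transpose A = A" and S: "subspace S" "S \<noteq> {0}" and inv: "\<And>x. x \<in> S \<Longrightarrow> A *v x \<in> S"
  obtains v a where "v \<in> S" "norm v = 1" "A *v v = a *\<^sub>R v"
proof -
  let ?K = "S \<inter> sphere 0 1"
  have "compact ?K" using closed_subspace[OF S(1)] by (simp add: closed_Int_compact)
  moreover obtain x where "x \<in> S" "x \<noteq> 0" using S subspace_0 by blast
  then have "x /\<^sub>R norm x \<in> ?K" using S(1) by (simp add: subspace_scale)
  then have "?K \<noteq> {}" by blast
  moreover have "continuous_on ?K (\<lambda>x. x \<bullet> (A *v x))"
    by (intro continuous_intros matrix_vector_mult_linear_continuous_on)
  ultimately obtain v where v: "v \<in> ?K" and max: "\<And>y. y \<in> ?K \<Longrightarrow> y \<bullet> (A *v y) \<le> v \<bullet> (A *v v)"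
    using continuous_attains_sup[of ?K "\<lambda>x. x \<bullet> (A *v x)"] by blast
  define a where "a = v \<bullet> (A *v v)"
  have vS: "v \<in> S" and nv: "v \<bullet> v = 1" using v by (auto simp: norm_eq_1)
  have le: "y \<bullet> (A *v y) \<le> a * (y \<bullet> y)" if "y \<in> S" for y
  proof (cases "y = 0")
    case False
    then have "y /\<^sub>R norm y \<in> ?K" using S(1) that by (simp add: subspace_scale)
    from max[OF this] have "(y \<bullet> (A *v y)) / (norm y)\<^sup>2 \<le> a"
      by (simp add: a_def matrix_vector_mult_scaleR power2_eq_square field_simps)
    then show ?thesis using False by (simp add: power2_norm_eq_inner field_simps)
  qed simp
  \<comment> \<open>\<open>w\<close> is the defect of the eigenvector equation and is orthogonal to
    v. Comparing v with v + t w yields 2 t (w . w) \<le> t^2 c for every t, which fails for small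
    positive t unless w = 0.\<close>
  define w where "w = A *v v - a *\<^sub>R v"
  have wS: "w \<in> S" unfolding w_def using S(1) vS inv by (simp add: subspace_diff subspace_scale)
  have wv: "w \<bullet> v = 0" "v \<bullet> w = 0" by (simp_all add: w_def a_def inner_diff_left inner_diff_right nv inner_commute)
  have wAv: "w \<bullet> (A *v v) = w \<bullet> w" using wv by (simp add: w_def inner_diff_left inner_diff_right)
  have vAw: "v \<bullet> (A *v w) = w \<bullet> w" using wAv inner_matrix_vector_symmetric[OF sym, of v w] by (simp add: inner_commute)
  define c where "c = a * (w \<bullet> w) - w \<bullet> (A *v w)"
  have q: "2 * t * (w \<bullet> w) \<le> t\<^sup>2 * c" for t
  proof -
    have "v + t *\<^sub>R w \<in> S" using S(1) vS wS by (simp add: subspace_add subspace_scale)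
    from le[OF this] show ?thesis
      by (simp add: matrix_vector_right_distrib matrix_vector_mult_scaleR inner_add_left inner_add_right
            wAv vAw wv nv c_def a_def[symmetric] power2_eq_square algebra_simps)
  qed
  have "w \<bullet> w = 0"
  proof (rule ccontr)
    assume "w \<bullet> w \<noteq> 0"
    then have p: "w \<bullet> w > 0" using inner_ge_zero[of w] by linarith
    \<comment> \<open>Chosen so that t (|c| + 1) = w . w; hence t c is at most w . w, short of the
      required 2 (w . w).\<close>
    define t where "t = (w \<bullet> w) / (\<bar>c\<bar> + 1)"
    have t: "t > 0" using p by (simp add: t_def)
    have "2 * (w \<bullet> w) * t \<le> t * c * t" using q[of t] by (simp add: power2_eq_square mult_ac)
    then have "2 * (w \<bullet> w) \<le> t * c" using t by (simp add: mult.commute)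
    also have "\<dots> \<le> t * (\<bar>c\<bar> + 1)" using t by (intro mult_left_mono) auto
    also have "\<dots> = w \<bullet> w" by (simp add: t_def)
    finally show False using p by simp
  qed
  then have "A *v v = a *\<^sub>R v" by (simp add: w_def)
  with that[of v a] vS nv show thesis by (simp add: norm_eq_1)
qed

text \<open>A largest orthonormal set B of eigenvectors spans: by symmetry its orthogonal complement
  is invariant under A, so a nonzero complement would contain one more unit eigenvector. The
  elements of B become the columns of Q.\<close>

lemma symmetric_matrix_diagonalizable:
  fixes A :: "real^'n^'n"
  assumes sym: "transpose A = A"
  obtains Q l where "orthogonal_matrix Q" "A = Q ** diag_mat l ** transpose Q"
proof -
  define ok where "ok = (\<lambda>B. pairwise orthogonal B \<and> (\<forall>v\<in>B. norm v = 1 \<and> (\<exists>a. A *v v = a *\<^sub>R v)))"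
  have ind: "independent B" if "ok B" for B
    using that unfolding ok_def by (intro pairwise_orthogonal_independent) auto
  have bound: "card B \<le> CARD('n)" if "ok B" for B
    using independent_bound[OF ind[OF that]] by simp
  have ok0: "ok {}" by (simp add: ok_def)
  define B where "B = (ARG_MAX card B. ok B)"
  have B: "ok B" and Bmax: "\<And>C. ok C \<Longrightarrow> card C \<le> card B"
    using arg_max_nat_lemma[of ok "{}" card "CARD('n) + 1"] ok0 bound unfolding B_def
    by (auto simp: less_Suc_eq_le)
  have finB: "finite B" using independent_bound[OF ind[OF B]] by simp
  let ?S = "{x. \<forall>v\<in>B. orthogonal v x}"
  have "?S = {0}"
  proof (rule ccontr)
    assume "?S \<noteq> {0}"
    moreover have "subspace ?S" by (rule subspace_orthogonal_to_vectors)
    moreover have "A *v x \<in> ?S" if "x \<in> ?S" for x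
    proof -
      have "v \<bullet> (A *v x) = 0" if "v \<in> B" for v
      proof -
        obtain a where "A *v v = a *\<^sub>R v" using B \<open>v \<in> B\<close> unfolding ok_def by blast
        then show ?thesis using \<open>x \<in> ?S\<close> \<open>v \<in> B\<close> inner_matrix_vector_symmetric[OF sym, of v x]
          by (simp add: orthogonal_def)
      qed
      then show ?thesis by (simp add: orthogonal_def)
    qed
    ultimately obtain v a where v: "v \<in> ?S" "norm v = 1" "A *v v = a *\<^sub>R v"
      using symmetric_eigenvector_in_subspace[OF sym, of ?S] by blast
    have "v \<notin> B" using v by (auto simp: orthogonal_def norm_eq_1)
    have "ok (insert v B)"
      using B v unfolding ok_def by (auto simp: pairwise_insert orthogonal_commute)
    from Bmax[OF this] \<open>v \<notin> B\<close> finB show False by simp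
  qed
  have "x \<in> span B" for x
  proof -
    obtain y z where yz: "y \<in> span B" "\<And>w. w \<in> span B \<Longrightarrow> orthogonal z w" "x = y + z"
      using orthogonal_subspace_decomp_exists[of B x] by blast
    then have "z \<in> ?S" using span_base orthogonal_commute by blast
    then show ?thesis using \<open>?S = {0}\<close> yz by simp
  qed
  then have "span B = UNIV" by blast
  then have "card B = CARD('n)"
    by (metis dim_UNIV dim_span dim_eq_card_independent[OF ind[OF B]] DIM_cart DIM_real mult.right_neutral)
  then obtain h where h: "bij_betw h (UNIV::'n set) B"
    using finite_same_card_bij[of "UNIV::'n set" B] finB by auto
  define Q where "Q = (\<chi> i j. h j $ i)"
  have col: "column j Q = h j" for j by (simp add: column_def Q_def vec_eq_iff)
  have hB: "h j \<in> B" for j using h by (auto simp: bij_betw_def)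
  have "orthogonal_matrix Q"
    unfolding orthogonal_matrix_orthonormal_columns col
  proof (intro conjI allI impI)
    fix i j :: 'n assume "i \<noteq> j"
    then have "h i \<noteq> h j" using h by (auto simp: bij_betw_def inj_def)
    then show "orthogonal (h i) (h j)" using B hB unfolding ok_def pairwise_def by blast
  qed (use B hB in \<open>auto simp: ok_def\<close>)
  moreover
  have "\<forall>j. \<exists>a. A *v h j = a *\<^sub>R h j" using B hB unfolding ok_def by blast
  then obtain a where a: "\<And>j. A *v h j = a j *\<^sub>R h j" by metis
  define l where "l = (\<chi> j. a j)"
  have "A ** Q = Q ** diag_mat l"
  proof -
    have "(A ** Q) $ i $ j = (Q ** diag_mat l) $ i $ j" for i j
    proof -
      have "(A ** Q) $ i $ j = (A *v h j) $ i"
        by (simp add: matrix_matrix_mult_def matrix_vector_mult_def Q_def)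
      also have "\<dots> = (Q ** diag_mat l) $ i $ j"
        by (simp add: a matrix_matrix_mult_def Q_def diag_mat_def l_def if_distrib cong: if_cong)
      finally show ?thesis .
    qed
    then show ?thesis by (simp add: vec_eq_iff)
  qed
  then have "A ** (Q ** transpose Q) = Q ** diag_mat l ** transpose Q"
    by (simp add: matrix_mul_assoc)
  then have "A = Q ** diag_mat l ** transpose Q"
    using \<open>orthogonal_matrix Q\<close> by (simp add: orthogonal_matrix_def)
  ultimately show thesis using that by blast
qed

section \<open>Recovering a vector up to a permutation of its coordinates\<close>

lemma permutation_of_count_eq:
  fixes l m :: "real^'n"
  assumes "\<And>a. card {i. l $ i = a} = card {i. m $ i = a}"
  obtains p where "p permutes (UNIV::'n set)" "m = (\<chi> i. l $ p i)"
proof -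
  have "image_mset (($) m) (mset_set UNIV) = image_mset (($) l) (mset_set UNIV)"
    by (rule multiset_eqI) (simp add: count_image_mset_eq_card_vimage assms)
  from image_mset_eq_implies_permutes[OF _ this] obtain p
    where "p permutes (UNIV::'n set)" "\<forall>x\<in>UNIV. m $ x = l $ p x" by auto
  then show thesis using that by (simp add: vec_eq_iff)
qed

text \<open>Polynomials that agree at all reals are equal and have the same multiset of roots. This
  limits the freedom of the choice in \<open>eigvals\<close> to a permutation.\<close>

lemma permutation_of_linear_factors_eq:
  fixes l m :: "real^'n"
  assumes "\<And>x. (\<Prod>i\<in>UNIV. x - l $ i) = (\<Prod>i\<in>UNIV. x - m $ i)"
  obtains p where "p permutes (UNIV::'n set)" "m = (\<chi> i. l $ p i)"
proof -
  let ?p = "\<lambda>l::real^'n. \<Prod>i\<in>UNIV. [:- (l $ i), 1:]"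
  have "poly (?p l) x = poly (?p m) x" for x
    using assms[of x] by (simp add: poly_prod)
  then have "?p l = ?p m" by (simp add: poly_eq_poly_eq_iff[symmetric] fun_eq_iff)
  moreover have "proots (?p l) = image_mset (($) l) (mset_set UNIV)" for l :: "real^'n"
    by (subst proots_prod) (simp_all add: sum_unfold_sum_mset)
  ultimately have "image_mset (($) m) (mset_set UNIV) = image_mset (($) l) (mset_set UNIV)"
    by metis
  from image_mset_eq_implies_permutes[OF _ this] obtain p
    where "p permutes (UNIV::'n set)" "\<forall>x\<in>UNIV. m $ x = l $ p x" by auto
  then show thesis using that by (simp add: vec_eq_iff)
qed

text \<open>Lagrange interpolation on the at most twice \<open>CARD('n)\<close> values shows that these power sums
  determine how often each value occurs.\<close>
lemma permutation_of_power_sums_eq: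
  fixes l m :: "real^'n"
  assumes ps: "\<And>k. k < 2 * CARD('n) \<Longrightarrow> (\<Sum>i\<in>UNIV. l $ i ^ k) = (\<Sum>i\<in>UNIV. m $ i ^ k)"
  obtains p where "p permutes (UNIV::'n set)" "m = (\<chi> i. l $ p i)"
proof (rule permutation_of_count_eq)
  fix a :: real
  define V where "V = range (($) l) \<union> range (($) m)"
  have finV: "finite V" by (simp add: V_def)
  show "card {i. l $ i = a} = card {i. m $ i = a}"
  proof (cases "a \<in> V")
    case False
    then have "{i. l $ i = a} = {}" "{i. m $ i = a} = {}" by (auto simp: V_def)
    then show ?thesis by simp
  next
    case True
    have cV: "card V \<le> 2 * CARD('n)"
      unfolding V_def using card_Un_le[of "range (($) l)" "range (($) m)"]
        card_image_le[of UNIV "($) l"] card_image_le[of UNIV "($) m"] by simp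
    \<comment> \<open>The interpolation polynomial that is 1 at a and 0 at the other values; summed
      over the coordinates of a vector it counts those equal to a.\<close>
    define q where "q = (\<Prod>b\<in>V - {a}. [:- b / (a - b), 1 / (a - b):])"
    have "degree q \<le> (\<Sum>b\<in>V - {a}. degree [:- b / (a - b), 1 / (a - b):])"
      unfolding q_def using degree_prod_sum_le[of "V - {a}" "\<lambda>b. [:- b / (a - b), 1 / (a - b):]"] finV by (simp add: o_def)
    also have "\<dots> \<le> card (V - {a})" using sum_bounded_above[of "V - {a}" "\<lambda>b. degree [:- b / (a - b), 1 / (a - b):]" 1]
      by simp
    also have "\<dots> < 2 * CARD('n)" using True finV cV card_Diff1_less[of V a] by linarith
    finally have deg: "degree q < 2 * CARD('n)" .
    have qa: "poly q b = (if b = a then 1 else 0)" if "b \<in> V" for b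
    proof (cases "b = a")
      case True
      have "poly q a = (\<Prod>b\<in>V - {a}. 1)"
        unfolding q_def poly_prod by (rule prod.cong) (auto simp: field_simps diff_divide_distrib[symmetric])
      then show ?thesis using True by simp
    next
      case False
      then show ?thesis using that finV unfolding q_def poly_prod
        by (auto intro!: bexI[of _ b] simp: field_simps)
    qed
    have cnt: "real (card {i. v $ i = a}) = (\<Sum>k\<le>degree q. coeff q k * (\<Sum>i\<in>UNIV. v $ i ^ k))"
      if "range (($) v) \<subseteq> V" for v :: "real^'n"
    proof -
      have "real (card {i. v $ i = a}) = (\<Sum>i\<in>UNIV. if v $ i = a then 1 else 0)"
        by (simp add: sum.If_cases)
      also have "\<dots> = (\<Sum>i\<in>UNIV. poly q (v $ i))"
        using that by (intro sum.cong) (auto simp: qa image_subset_iff)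
      also have "\<dots> = (\<Sum>i\<in>UNIV. \<Sum>k\<le>degree q. coeff q k * v $ i ^ k)"
        by (simp add: poly_altdef)
      also have "\<dots> = (\<Sum>k\<le>degree q. coeff q k * (\<Sum>i\<in>UNIV. v $ i ^ k))"
        by (subst sum.swap) (simp add: sum_distrib_left)
      finally show ?thesis .
    qed
    have "real (card {i. l $ i = a}) = real (card {i. m $ i = a})"
      using deg by (subst (1 2) cnt) (auto simp: V_def ps)
    then show ?thesis by simp
  qed
qed (use that in blast)

lemma det_char_diag:
  fixes Q :: "real^'n^'n"
  assumes Q: "orthogonal_matrix Q"
  shows "det (x *\<^sub>R mat 1 - Q ** diag_mat l ** transpose Q) = (\<Prod>i\<in>UNIV. x - l $ i)"
proof -
  have QQ: "Q ** transpose Q = mat 1" using Q by (simp add: orthogonal_matrix_def)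
  have "x *\<^sub>R mat 1 - Q ** diag_mat l ** transpose Q = Q ** (x *\<^sub>R mat 1) ** transpose Q - Q ** diag_mat l ** transpose Q"
    by (simp add: bounded_bilinear.scaleR_left[OF bounded_bilinear_matrix_mult]
          bounded_bilinear.scaleR_right[OF bounded_bilinear_matrix_mult] QQ)
  also have "\<dots> = Q ** (x *\<^sub>R mat 1 - diag_mat l) ** transpose Q"
    by (simp add: bounded_bilinear.diff_left[OF bounded_bilinear_matrix_mult]
          bounded_bilinear.diff_right[OF bounded_bilinear_matrix_mult])
  also have "det \<dots> = det (Q ** transpose Q) * det (x *\<^sub>R mat 1 - diag_mat l)"
    by (simp add: det_mul)
  also have "\<dots> = det (x *\<^sub>R mat 1 - diag_mat l)"
    by (simp add: QQ)
  also have "\<dots> = (\<Prod>i\<in>UNIV. (x *\<^sub>R mat 1 - diag_mat l) $ i $ i)"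
    by (rule det_diagonal) (simp add: mat_def diag_mat_def)
  finally show ?thesis by (simp add: mat_def diag_mat_def)
qed

text \<open>\<open>l\<close> itself meets the condition in the choice that defines
  \<open>eigvals\<close>, so the chosen vector meets it too; the two have the same linear factors
  and differ by a permutation, which f does not see.\<close>

lemma symmetric_fun_eigvals:
  assumes f: "symmetric_fun f" and Q: "orthogonal_matrix Q"
  shows "f (eigvals (Q ** diag_mat l ** transpose Q)) = f l"
proof -
  let ?A = "Q ** diag_mat l ** transpose Q"
  have "\<forall>x. det (x *\<^sub>R mat 1 - ?A) = (\<Prod>i\<in>UNIV. x - eigvals ?A $ i)"
    unfolding eigvals_def by (rule someI[of _ l]) (simp add: det_char_diag[OF Q])
  then have "(\<Prod>i\<in>UNIV. x - l $ i) = (\<Prod>i\<in>UNIV. x - eigvals ?A $ i)" for x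
    by (simp add: det_char_diag[OF Q])
  from permutation_of_linear_factors_eq[OF this] obtain p where
    "p permutes UNIV" "eigvals ?A = (\<chi> i. l $ p i)" by blast
  then show ?thesis using f by (simp add: symmetric_fun_def)
qed

section \<open>Loop equations for Gaussian matrices\<close>

primrec mpow :: "real^'n^'n \<Rightarrow> nat \<Rightarrow> real^'n^'n" where
  "mpow A 0 = mat 1"
| "mpow A (Suc k) = mpow A k ** A"

lemma mpow_add: "mpow A (j + k) = mpow A j ** mpow A k"
  by (induction k) (simp_all add: matrix_mul_assoc)

lemma mpow_Suc': "mpow A (Suc k) = A ** mpow A k"
  using mpow_add[of A 1 k] by simp

lemma transpose_mpow: "transpose A = A \<Longrightarrow> transpose (mpow A k) = mpow A k"
proof (induction k)
  case (Suc k)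
  then show ?case using mpow_Suc'[of A k] by (simp add: matrix_transpose_mul)
qed (simp add: transpose_mat)

definition gram :: "real^'m^'n \<Rightarrow> real^'n^'n" where
  "gram X = X ** transpose X"

lemma transpose_gram [simp]: "transpose (gram X) = gram X"
  by (simp add: gram_def matrix_transpose_mul)

text \<open>The power sums of the eigenvalues of \<open>gram X\<close>, written as polynomials in
  the entries of X, so that they can be differentiated and integrated without mention of
  eigenvalues.\<close>

definition ptr :: "real^'m^'n \<Rightarrow> nat \<Rightarrow> real" where
  "ptr X k = trace (mpow (gram X) k)"

text \<open>\<open>euler_term p k ks\<close> is the image of the monomial \<open>prod_list (map p ks)\<close> in the power sums
  under the derivation \<open>\<Sum>j. \<lambda>\<^sub>j\<^sup>k\<^sup>+\<^sup>1 \<partial>\<^sub>j\<close>.\<close>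
primrec euler_term :: "(nat \<Rightarrow> real) \<Rightarrow> nat \<Rightarrow> nat list \<Rightarrow> real" where
  "euler_term p k [] = 0"
| "euler_term p k (j # js) = real j * p (k + j) * prod_list (map p js) + p j * euler_term p k js"

text \<open>Divergence of the weighted field of order k times a monomial, apart from the
  contribution of the exponential. Only the constant c distinguishes the matrix side (c = M) from
  the eigenvalue side (c = 2 \<alpha> + N + 1, where the expression is twice the
  divergence).\<close>

definition loop_term :: "real \<Rightarrow> (nat \<Rightarrow> real) \<Rightarrow> nat \<Rightarrow> nat list \<Rightarrow> real" where
  "loop_term c p k ks = (real k + c) * (p k * prod_list (map p ks))
     + (\<Sum>r=1..k. p r * (p (k - r) * prod_list (map p ks))) + 2 * euler_term p k ks"

section \<open>Polynomial functions of matrices\<close>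

lemma real_polynomial_function_growth:
  fixes f :: "'a::real_normed_vector \<Rightarrow> real"
  assumes "real_polynomial_function f"
  obtains C d where "\<And>x. \<bar>f x\<bar> \<le> C * (1 + norm x) ^ d"
proof -
  have "\<exists>C d. C \<ge> 0 \<and> (\<forall>x. \<bar>f x\<bar> \<le> C * (1 + norm x) ^ d)"
    using assms
  proof induction
    case (linear f)
    then obtain K where K: "K > 0" "\<And>x. norm (f x) \<le> norm x * K" using bounded_linear.pos_bounded by blast
    have "\<bar>f x\<bar> \<le> K * (1 + norm x) ^ 1" for x using K(2)[of x] K(1) by (simp add: algebra_simps)
    then show ?case using K(1) less_imp_le by blast
  next
    case (const c)
    have "\<bar>c\<bar> \<le> \<bar>c\<bar> * (1 + norm x) ^ 0" for x :: 'a by simp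
    then show ?case using abs_ge_zero by blast
  next
    case (add f g)
    then obtain C d C' d' where *: "C \<ge> 0" "C' \<ge> 0" "\<And>x. \<bar>f x\<bar> \<le> C * (1 + norm x) ^ d" "\<And>x. \<bar>g x\<bar> \<le> C' * (1 + norm x) ^ d'"
      by blast
    have "\<bar>f x + g x\<bar> \<le> (C + C') * (1 + norm x) ^ (d + d')" for x
    proof -
      have "C * (1 + norm x) ^ d \<le> C * (1 + norm x) ^ (d + d')" "C' * (1 + norm x) ^ d' \<le> C' * (1 + norm x) ^ (d + d')"
        using * by (auto intro!: mult_left_mono power_increasing)
      then show ?thesis using *(3,4)[of x] by (simp add: distrib_right)
    qed
    then show ?case using * by (metis add_nonneg_nonneg)
  next
    case (mult f g)
    then obtain C d C' d' where *: "C \<ge> 0" "C' \<ge> 0" "\<And>x. \<bar>f x\<bar> \<le> C * (1 + norm x) ^ d" "\<And>x. \<bar>g x\<bar> \<le> C' * (1 + norm x) ^ d'"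
      by blast
    have "\<bar>f x * g x\<bar> \<le> (C * C') * (1 + norm x) ^ (d + d')" for x
      using mult_mono[OF *(3)[of x] *(4)[of x]] * by (simp add: abs_mult power_add mult_ac)
    then show ?case using * by (metis mult_nonneg_nonneg)
  qed
  then show thesis using that by blast
qed

lemma real_polynomial_function_prod_list:
  assumes "\<And>k. real_polynomial_function (\<lambda>x. p x k)"
  shows "real_polynomial_function (\<lambda>x. prod_list (map (p x) ks))"
  by (induction ks) (auto intro!: assms)

lemma real_polynomial_function_euler_term:
  assumes "\<And>k. real_polynomial_function (\<lambda>x. p x k)"
  shows "real_polynomial_function (\<lambda>x. euler_term (p x) k ks)"
  by (induction ks) (auto intro!: assms real_polynomial_function_prod_list real_polynomial_function.intros(2-4))

lemma real_polynomial_function_loop_term: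
  assumes "\<And>k. real_polynomial_function (\<lambda>x. p x k)"
  shows "real_polynomial_function (\<lambda>x. loop_term c (p x) k ks)"
  unfolding loop_term_def
  by (rule real_polynomial_function.intros(3), rule real_polynomial_function.intros(3))
     (auto intro!: real_polynomial_function.intros(2,4) assms real_polynomial_function_sum
        real_polynomial_function_prod_list real_polynomial_function_euler_term)

lemma real_polynomial_function_matrix_entry:
  "real_polynomial_function (\<lambda>X::real^'m^'n. X $ i $ j)"
proof (rule real_polynomial_function.intros(1))
  show "bounded_linear (\<lambda>X::real^'m^'n. X $ i $ j)"
    using bounded_linear_compose[OF bounded_linear_vec_nth bounded_linear_vec_nth] .
qed

lemma real_polynomial_function_matrix_mult:
  assumes "\<And>i j. real_polynomial_function (\<lambda>x. F x $ i $ j)" "\<And>i j. real_polynomial_function (\<lambda>x. G x $ i $ j)"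
  shows "real_polynomial_function (\<lambda>x. (F x ** G x) $ i $ j)"
  using assms by (auto simp: matrix_matrix_mult_def intro!: real_polynomial_function_sum real_polynomial_function.intros(4))

lemma real_polynomial_function_mpow_gram:
  "real_polynomial_function (\<lambda>X::real^'m^'n. mpow (gram X) k $ i $ j)"
proof (induction k arbitrary: i j)
  case (Suc k)
  have "real_polynomial_function (\<lambda>X::real^'m^'n. gram X $ i $ j)" for i j
    unfolding gram_def by (intro real_polynomial_function_matrix_mult)
      (auto simp: transpose_def real_polynomial_function_matrix_entry)
  with Suc show ?case by (auto intro!: real_polynomial_function_matrix_mult)
qed (simp add: mat_def real_polynomial_function.intros(2))

lemma real_polynomial_function_ptr: "real_polynomial_function (\<lambda>X::real^'m^'n. ptr X k)"
  unfolding ptr_def trace_def by (intro real_polynomial_function_sum real_polynomial_function_mpow_gram) auto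

section \<open>Derivatives and divergences of powers of the Gram matrix\<close>

lemma transpose_has_vector_derivative:
  fixes f :: "real \<Rightarrow> real^'m^'n"
  assumes "(f has_vector_derivative f') F"
  shows "((\<lambda>t. transpose (f t)) has_vector_derivative transpose f') F"
proof -
  have "bounded_linear (transpose :: real^'m^'n \<Rightarrow> real^'n^'m)"
    by (simp add: linear_conv_bounded_linear[symmetric] linear_iff transpose_def vec_eq_iff)
  from bounded_linear.has_vector_derivative[OF this assms] show ?thesis .
qed

text \<open>The derivative of \<open>gram\<close> at X in the direction E; \<open>dpow\<close> is
  the product rule for a power of noncommuting factors, with r factors before the differentiated
  one.\<close>

definition dgram :: "real^'m^'n \<Rightarrow> real^'m^'n \<Rightarrow> real^'n^'n" where
  "dgram E X = E ** transpose X + X ** transpose E"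

definition dpow :: "real^'m^'n \<Rightarrow> real^'m^'n \<Rightarrow> nat \<Rightarrow> real^'n^'n" where
  "dpow E X k = (\<Sum>r<k. mpow (gram X) r ** dgram E X ** mpow (gram X) (k - 1 - r))"

lemma matrix_mult_sum_left: "(\<Sum>r\<in>I. F r) ** (B::real^'k^'m) = (\<Sum>r\<in>I. F r ** B)"
  using bounded_bilinear.sum_left[OF bounded_bilinear_matrix_mult] .

lemma line_has_vector_derivative:
  "((\<lambda>t. X + t *\<^sub>R E) has_vector_derivative E) (at t)"
  by (auto intro!: derivative_eq_intros)

lemma gram_has_vector_derivative:
  "((\<lambda>t. gram (X + t *\<^sub>R E)) has_vector_derivative dgram E (X + t *\<^sub>R E)) (at t)"
  unfolding gram_def
  using bounded_bilinear.has_vector_derivative[OF bounded_bilinear_matrix_mult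
      line_has_vector_derivative transpose_has_vector_derivative[OF line_has_vector_derivative]]
  by (simp add: dgram_def add.commute)

lemma mpow_gram_has_vector_derivative:
  "((\<lambda>t. mpow (gram (X + t *\<^sub>R E)) k) has_vector_derivative dpow E (X + t *\<^sub>R E) k) (at t)"
proof (induction k)
  case (Suc k)
  let ?X = "X + t *\<^sub>R E"
  have "dpow E ?X (Suc k) = (\<Sum>r<k. mpow (gram ?X) r ** dgram E ?X ** mpow (gram ?X) (k - r)) + mpow (gram ?X) k ** dgram E ?X"
    by (simp add: dpow_def)
  also have "(\<Sum>r<k. mpow (gram ?X) r ** dgram E ?X ** mpow (gram ?X) (k - r)) = dpow E ?X k ** gram ?X"
    unfolding dpow_def matrix_mult_sum_left
  proof (rule sum.cong[OF refl])
    fix r assume "r \<in> {..<k}"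
    then have "k - r = Suc (k - 1 - r)" by auto
    then show "mpow (gram ?X) r ** dgram E ?X ** mpow (gram ?X) (k - r) =
          mpow (gram ?X) r ** dgram E ?X ** mpow (gram ?X) (k - 1 - r) ** gram ?X"
      by (metis matrix_mul_assoc mpow.simps(2))
  qed
  finally have "dpow E ?X (Suc k) = mpow (gram ?X) k ** dgram E ?X + dpow E ?X k ** gram ?X" by simp
  then show ?case
    using bounded_bilinear.has_vector_derivative[OF bounded_bilinear_matrix_mult Suc.IH gram_has_vector_derivative]
    by simp
qed (simp add: dpow_def)

text \<open>The elementary matrix with its 1 in row i and column a. Adding up entry (i, a) of the
  derivative in direction \<open>munit i a\<close> over all i and a gives the divergence of a
  matrix-valued field.\<close>

definition munit :: "'n \<Rightarrow> 'm \<Rightarrow> real^'m^'n" where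
  "munit i a = axis i (axis a 1)"

lemma munit_nth: "munit i a $ x $ y = (if x = i \<and> y = a then 1 else 0)"
  by (auto simp: munit_def axis_def)

lemma transpose_munit: "transpose (munit i a) = munit a i"
  by (auto simp: transpose_def munit_nth vec_eq_iff)

lemma mult_munit_mult_nth: "(P ** munit i a ** R) $ x $ y = P $ x $ i * R $ a $ y"
proof -
  have "(P ** munit i a) $ x $ z = (if z = a then P $ x $ i else 0)" for z
    by (auto simp: matrix_matrix_mult_def munit_nth if_distrib cong: if_cong)
  then show ?thesis
    by (subst matrix_matrix_mult_def) (simp add: if_distrib[of "\<lambda>u. u * _"] cong: if_cong)
qed

lemma inner_munit: "X \<bullet> munit i a = X $ i $ a"
  by (simp add: munit_def inner_axis)

lemma trace_mult_transpose: "trace (P ** transpose R) = (\<Sum>i\<in>UNIV. \<Sum>a\<in>UNIV. P $ i $ a * R $ i $ a)"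
  by (simp add: trace_def matrix_matrix_mult_def transpose_def)

text \<open>A unit in straight order breaks the product into two separate traces; in
  \<open>sum_munit_crossed\<close> the transposed unit joins the pieces into a single trace. The
  first pattern creates the products of power sums in the loop equation, the second the multiple k
  of a single power sum.\<close>

lemma sum_munit_straight:
  "(\<Sum>i\<in>UNIV. \<Sum>a\<in>UNIV. (P ** munit i a ** R) $ i $ a) = trace P * trace R"
  by (simp add: mult_munit_mult_nth trace_def sum_product)

lemma sum_munit_crossed:
  "(\<Sum>i\<in>UNIV. \<Sum>a\<in>UNIV. (P ** munit a i ** R) $ i $ a) = trace (P ** transpose R)"
  by (simp add: mult_munit_mult_nth trace_mult_transpose)

lemma gram_mult_transpose:
  "trace (mpow (gram X) r ** X ** transpose (mpow (gram X) s ** X)) = ptr X (Suc (r + s))"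
proof -
  have "mpow (gram X) r ** X ** transpose (mpow (gram X) s ** X) = mpow (gram X) r ** (X ** transpose X) ** mpow (gram X) s"
    by (simp add: matrix_transpose_mul transpose_mpow matrix_mul_assoc)
  also have "\<dots> = mpow (gram X) (Suc r + s)"
    unfolding mpow_add by (simp add: gram_def)
  finally show ?thesis by (simp add: ptr_def)
qed

lemma trace_transpose_gram_mult: "trace (transpose X ** mpow (gram X) s ** X) = ptr X (Suc s)"
proof -
  have "trace (transpose X ** mpow (gram X) s ** X) = trace (X ** (transpose X ** mpow (gram X) s))"
    by (rule trace_mul_sym)
  also have "X ** (transpose X ** mpow (gram X) s) = mpow (gram X) (Suc s)"
    by (simp add: mpow_Suc' gram_def matrix_mul_assoc del: mpow.simps)
  finally show ?thesis by (simp add: ptr_def)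
qed

lemma matrix_mult_distrib:
  fixes A B :: "real^'m^'n" and C D :: "real^'k^'m"
  shows "(A + B) ** C = A ** C + B ** C" "A ** (C + D) = A ** C + A ** D"
  by (simp_all add: bounded_bilinear.add_left[OF bounded_bilinear_matrix_mult]
        bounded_bilinear.add_right[OF bounded_bilinear_matrix_mult])

lemma dgram_munit: "dgram (munit i a) X = munit i a ** transpose X + X ** munit a i"
  by (simp add: dgram_def transpose_munit)

text \<open>The field is (X X^T)^k X. Differentiating its last factor X gives M times p k. Each of
  the k Gram factors gives a straight term p r p (k - r), with r the number of factors before it,
  and a crossed term p k.\<close>

lemma divergence_mpow_gram_mult:
  fixes X :: "real^'m^'n"
  shows "(\<Sum>i\<in>UNIV. \<Sum>a\<in>UNIV. (dpow (munit i a) X k ** X + mpow (gram X) k ** munit i a) $ i $ a) =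
    (real k + real CARD('m)) * ptr X k + (\<Sum>r=1..k. ptr X r * ptr X (k - r))"
proof -
  let ?A = "gram X"
  have 1: "(\<Sum>i\<in>UNIV. \<Sum>a\<in>(UNIV::'m set). (mpow ?A k ** munit i a) $ i $ a) = real CARD('m) * ptr X k"
  proof -
    have "(mpow ?A k ** munit i a) $ i $ a = mpow ?A k $ i $ i" for i and a :: 'm
      using mult_munit_mult_nth[of "mpow ?A k" i a "mat 1" i a] unfolding matrix_mul_rid
      by (simp add: mat_def)
    then show ?thesis by (simp add: ptr_def trace_def sum_distrib_left)
  qed
  have t: "(\<Sum>i\<in>UNIV. \<Sum>a\<in>UNIV. (mpow ?A r ** dgram (munit i a) X ** mpow ?A (k - 1 - r) ** X) $ i $ a)
        = ptr X r * ptr X (k - r) + ptr X k" if "r < k" for r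
  proof -
    let ?s = "k - 1 - r"
    have s: "Suc ?s = k - r" "Suc (r + ?s) = k" using that by auto
    have "mpow ?A r ** dgram (munit i a) X ** mpow ?A ?s ** X =
       mpow ?A r ** munit i a ** (transpose X ** mpow ?A ?s ** X) + (mpow ?A r ** X) ** munit a i ** (mpow ?A ?s ** X)" for i a
      by (simp add: dgram_munit matrix_mult_distrib matrix_mul_assoc)
    then have "(\<Sum>i\<in>UNIV. \<Sum>a\<in>UNIV. (mpow ?A r ** dgram (munit i a) X ** mpow ?A ?s ** X) $ i $ a)
        = (\<Sum>i\<in>UNIV. \<Sum>a\<in>UNIV. (mpow ?A r ** munit i a ** (transpose X ** mpow ?A ?s ** X)) $ i $ a)
         + (\<Sum>i\<in>UNIV. \<Sum>a\<in>UNIV. ((mpow ?A r ** X) ** munit a i ** (mpow ?A ?s ** X)) $ i $ a)"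
      by (simp add: sum.distrib)
    also have "\<dots> = ptr X r * ptr X (k - r) + ptr X k"
      unfolding sum_munit_straight sum_munit_crossed gram_mult_transpose trace_transpose_gram_mult s
      by (simp add: ptr_def)
    finally show ?thesis .
  qed
  have "(\<Sum>i\<in>UNIV. \<Sum>a\<in>UNIV. (dpow (munit i a) X k ** X) $ i $ a) =
        (\<Sum>r<k. \<Sum>i\<in>UNIV. \<Sum>a\<in>UNIV. (mpow ?A r ** dgram (munit i a) X ** mpow ?A (k - 1 - r) ** X) $ i $ a)"
    unfolding dpow_def matrix_mult_sum_left sum_component
    by (subst sum.swap, rule sum.cong[OF refl], subst sum.swap) simp
  also have "\<dots> = (\<Sum>r<k. ptr X r * ptr X (k - r) + ptr X k)"
    by (intro sum.cong[OF refl] t) simp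
  also have "\<dots> = (\<Sum>r<k. ptr X r * ptr X (k - r)) + real k * ptr X k"
    by (simp add: sum.distrib)
  \<comment> \<open>The substitution of k - r for r moves the range from 0..k-1 to 1..k, the form
    used in \<open>loop_term\<close>, without changing the symmetric summand.\<close>
  also have "(\<Sum>r<k. ptr X r * ptr X (k - r)) = (\<Sum>i<k. ptr X (k - Suc i) * ptr X (k - (k - Suc i)))"
    by (rule sum.nat_diff_reindex[symmetric])
  also have "\<dots> = (\<Sum>i<k. ptr X (Suc i) * ptr X (k - Suc i))"
    by (intro sum.cong) (auto simp: mult.commute)
  also have "\<dots> = (\<Sum>r=1..k. ptr X r * ptr X (k - r))"
    using sum.atLeast1_atMost_eq[of "\<lambda>r. ptr X r * ptr X (k - r)" k] by simp
  finally show ?thesis using 1 by (simp add: sum.distrib algebra_simps)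
qed

text \<open>Cyclicity of the trace gathers the undifferentiated factors into the power j - 1, so all
  j summands agree; the two halves of \<open>dgram\<close> contribute equally because
  \<open>gram X\<close> is symmetric, hence the 2. At j = 0 the factor \<open>real j\<close>
  silences the truncated exponent.\<close>

lemma trace_dpow_munit:
  "trace (dpow (munit i a) X j) = 2 * real j * (mpow (gram X) (j - 1) ** X) $ i $ a"
proof -
  let ?A = "gram X"
  have "trace (mpow ?A r ** dgram (munit i a) X ** mpow ?A (j - 1 - r)) = 2 * (mpow ?A (j - 1) ** X) $ i $ a"
    if "r < j" for r
  proof -
    let ?P = "mpow ?A (j - 1)"
    have "trace (mpow ?A r ** dgram (munit i a) X ** mpow ?A (j - 1 - r)) =
          trace (mpow ?A (j - 1 - r) ** (mpow ?A r ** dgram (munit i a) X))"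
      by (rule trace_mul_sym)
    also have "mpow ?A (j - 1 - r) ** (mpow ?A r ** dgram (munit i a) X) = ?P ** dgram (munit i a) X"
      using that by (simp add: matrix_mul_assoc mpow_add[symmetric])
    also have "\<dots> = ?P ** munit i a ** transpose X + ?P ** X ** munit a i ** mat 1"
      by (simp add: dgram_munit matrix_mult_distrib matrix_mul_assoc)
    also have "trace \<dots> = (\<Sum>x\<in>UNIV. ?P $ x $ i * X $ x $ a) + (\<Sum>x\<in>UNIV. (?P ** X) $ x $ a * (if i = x then 1 else 0))"
      by (simp add: trace_def mult_munit_mult_nth transpose_def mat_def sum.distrib)
    also have "(\<Sum>x\<in>UNIV. ?P $ x $ i * X $ x $ a) = (?P ** X) $ i $ a"
    proof -
      have "?P $ x $ i = ?P $ i $ x" for x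
        using arg_cong[OF transpose_mpow[OF transpose_gram], of "\<lambda>M. M $ i $ x"] by (simp add: transpose_def)
      then show ?thesis by (simp add: matrix_matrix_mult_def)
    qed
    also have "(\<Sum>x\<in>UNIV. (?P ** X) $ x $ a * (if i = x then 1 else 0)) = (?P ** X) $ i $ a"
      by (simp add: if_distrib cong: if_cong)
    finally show ?thesis by simp
  qed
  moreover have "trace (\<Sum>r<j. F r) = (\<Sum>r<j. trace (F r))" for F :: "nat \<Rightarrow> real^'a^'a"
    unfolding trace_def sum_component by (rule sum.swap)
  ultimately show ?thesis by (simp add: dpow_def)
qed

text \<open>Leibniz rule on a monomial, given the values \<open>p\<close> and the derivatives
  \<open>dp\<close> of the power sums; it serves matrices and eigenvalues alike.\<close>

primrec dmon :: "(nat \<Rightarrow> real) \<Rightarrow> (nat \<Rightarrow> real) \<Rightarrow> nat list \<Rightarrow> real" where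
  "dmon p dp [] = 0"
| "dmon p dp (j # js) = dp j * prod_list (map p js) + p j * dmon p dp js"

text \<open>By \<open>trace_dpow_munit\<close> the gradient of p j is 2 j times the field of order j
  - 1. Its pairing with the field of order k is therefore 2 j p (k + j), the derivation of
  \<open>euler_term\<close> up to the factor 2.\<close>

lemma sum_mpow_gram_dmon:
  fixes X :: "real^'m^'n"
  shows "(\<Sum>i\<in>UNIV. \<Sum>a\<in>UNIV. (mpow (gram X) k ** X) $ i $ a * dmon (ptr X) (\<lambda>j. trace (dpow (munit i a) X j)) ks)
    = 2 * euler_term (ptr X) k ks"
proof (induction ks)
  case (Cons j js)
  have 1: "(\<Sum>i\<in>UNIV. \<Sum>a\<in>UNIV. (mpow (gram X) k ** X) $ i $ a * trace (dpow (munit i a) X j)) = 2 * real j * ptr X (k + j)"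
  proof (cases j)
    case 0
    then show ?thesis by (simp add: trace_dpow_munit)
  next
    case (Suc n)
    have "(\<Sum>i\<in>UNIV. \<Sum>a\<in>UNIV. (mpow (gram X) k ** X) $ i $ a * trace (dpow (munit i a) X j)) =
       2 * real j * trace (mpow (gram X) k ** X ** transpose (mpow (gram X) n ** X))"
      unfolding trace_mult_transpose trace_dpow_munit by (simp add: sum_distrib_left Suc mult_ac)
    then show ?thesis by (simp add: gram_mult_transpose Suc)
  qed
  have "(\<Sum>i\<in>UNIV. \<Sum>a\<in>UNIV. (mpow (gram X) k ** X) $ i $ a * dmon (ptr X) (\<lambda>j. trace (dpow (munit i a) X j)) (j # js))
    = (\<Sum>i\<in>UNIV. \<Sum>a\<in>UNIV. (mpow (gram X) k ** X) $ i $ a * trace (dpow (munit i a) X j)) * prod_list (map (ptr X) js)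
      + ptr X j * (\<Sum>i\<in>UNIV. \<Sum>a\<in>UNIV. (mpow (gram X) k ** X) $ i $ a * dmon (ptr X) (\<lambda>j. trace (dpow (munit i a) X j)) js)"
    by (simp add: sum_distrib_left sum_distrib_right sum.distrib algebra_simps)
  then show ?case unfolding 1 Cons.IH by (simp add: algebra_simps)
qed simp

lemma has_real_derivative_matrix_entry:
  fixes f :: "real \<Rightarrow> real^'m^'n"
  assumes "(f has_vector_derivative f') (at t)"
  shows "((\<lambda>t. f t $ i $ a) has_real_derivative f' $ i $ a) (at t)"
proof -
  have "bounded_linear (\<lambda>X::real^'m^'n. X $ i $ a)"
    using bounded_linear_compose[OF bounded_linear_vec_nth bounded_linear_vec_nth] .
  from bounded_linear.has_vector_derivative[OF this assms] show ?thesis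
    by (simp add: has_real_derivative_iff_has_vector_derivative)
qed

lemma ptr_has_real_derivative:
  "((\<lambda>t. ptr (X + t *\<^sub>R E) k) has_real_derivative trace (dpow E (X + t *\<^sub>R E) k)) (at t)"
  unfolding ptr_def trace_def
  by (intro DERIV_sum has_real_derivative_matrix_entry mpow_gram_has_vector_derivative)

lemma monomial_ptr_has_real_derivative:
  "((\<lambda>t. prod_list (map (ptr (X + t *\<^sub>R E)) ks)) has_real_derivative
     dmon (ptr (X + t *\<^sub>R E)) (\<lambda>j. trace (dpow E (X + t *\<^sub>R E) j)) ks) (at t)"
proof (induction ks)
  case (Cons j js)
  show ?case
    using DERIV_mult[OF ptr_has_real_derivative[of X E j t] Cons.IH] by (simp add: add.commute mult.commute)
qed simp

lemma real_polynomial_function_dpow: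
  "real_polynomial_function (\<lambda>X::real^'m^'n. dpow E X k $ i $ j)"
proof -
  have "real_polynomial_function (\<lambda>X::real^'m^'n. dgram E X $ i $ j)" for i j
    unfolding dgram_def vector_add_component
    by (intro real_polynomial_function.intros(3) real_polynomial_function_matrix_mult)
       (auto simp: transpose_def real_polynomial_function_matrix_entry real_polynomial_function.intros(2))
  then show ?thesis
    unfolding dpow_def sum_component
    by (intro real_polynomial_function_sum real_polynomial_function_matrix_mult real_polynomial_function_mpow_gram) auto
qed

lemma real_polynomial_function_dmon:
  "real_polynomial_function (\<lambda>X::real^'m^'n. dmon (ptr X) (\<lambda>j. trace (dpow E X j)) ks)"
proof -
  have tr: "real_polynomial_function (\<lambda>X::real^'m^'n. trace (dpow E X j))" for j
    unfolding trace_def by (intro real_polynomial_function_sum real_polynomial_function_dpow) auto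
  have mon: "real_polynomial_function (\<lambda>X::real^'m^'n. prod_list (map (ptr X) js))" for js
    using real_polynomial_function_prod_list[OF real_polynomial_function_ptr] .
  show ?thesis
  proof (induction ks)
    case (Cons j js)
    have "real_polynomial_function (\<lambda>X::real^'m^'n. trace (dpow E X j) * prod_list (map (ptr X) js)
        + ptr X j * dmon (ptr X) (\<lambda>j. trace (dpow E X j)) js)"
      using tr mon Cons real_polynomial_function_ptr by (intro real_polynomial_function.intros(3,4))
    then show ?case by simp
  qed (simp add: real_polynomial_function.intros(2))
qed

lemma integrable_polynomial_times_gaussian:
  fixes f :: "'a::euclidean_space \<Rightarrow> real"
  assumes f: "real_polynomial_function f" and s: "s > 0"
  shows "integrable lborel (\<lambda>x. f x * exp (- s * (norm x)\<^sup>2 / 2))"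
proof -
  obtain C d where "\<And>x. \<bar>f x\<bar> \<le> C * (1 + norm x) ^ d"
    using real_polynomial_function_growth[OF f] by blast
  moreover have "f \<in> borel_measurable borel"
    using continuous_on_polymonial_function[of f UNIV] f
    by (intro borel_measurable_continuous_onI) (auto simp: real_polynomial_function_eq)
  ultimately show ?thesis
    using integrable_polynomial_growth_times_gaussian s by blast
qed

text \<open>Each entry of the field (X X^T)^k X, times the monomial and the Gaussian, is
  differentiated in its own direction, and that derivative integrates to 0. The Gaussian contributes
  -s times the pairing of the field with X, which is -s p (k + 1).\<close>

theorem loop_equation_gaussian_matrix:
  assumes s: "s > 0"
  shows "s * (\<integral>X. ptr X (Suc k) * prod_list (map (ptr X) ks) * exp (- s * (norm X)\<^sup>2 / 2) \<partial>(lborel::(real^'m^'n) measure))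
    = (\<integral>X. loop_term (real CARD('m)) (ptr X) k ks * exp (- s * (norm X)\<^sup>2 / 2) \<partial>(lborel::(real^'m^'n) measure))"
proof -
  define F where "F = (\<lambda>X::real^'m^'n. prod_list (map (ptr X) ks))"
  define w where "w = (\<lambda>X::real^'m^'n. exp (- s * (norm X)\<^sup>2 / 2))"
  define V where "V = (\<lambda>(X::real^'m^'n) i a. (mpow (gram X) k ** X) $ i $ a)"
  define DV where "DV = (\<lambda>(X::real^'m^'n) i a. (dpow (munit i a) X k ** X + mpow (gram X) k ** munit i a) $ i $ a)"
  define DF where "DF = (\<lambda>(X::real^'m^'n) i a. dmon (ptr X) (\<lambda>j. trace (dpow (munit i a) X j)) ks)"
  define G where "G = (\<lambda>(X::real^'m^'n) i a. DV X i a * F X + V X i a * DF X i a - s * X $ i $ a * (V X i a * F X))"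
  have pF: "real_polynomial_function F"
    unfolding F_def using real_polynomial_function_prod_list[OF real_polynomial_function_ptr] .
  have pV: "real_polynomial_function (\<lambda>X. V X i a)" for i a
    unfolding V_def by (intro real_polynomial_function_matrix_mult real_polynomial_function_mpow_gram
        real_polynomial_function_matrix_entry)
  have pDV: "real_polynomial_function (\<lambda>X. DV X i a)" for i a
    unfolding DV_def vector_add_component
    by (intro real_polynomial_function.intros(3) real_polynomial_function_matrix_mult real_polynomial_function_mpow_gram
        real_polynomial_function_matrix_entry real_polynomial_function_dpow real_polynomial_function.intros(2))
  have pDF: "real_polynomial_function (\<lambda>X. DF X i a)" for i a
    unfolding DF_def by (rule real_polynomial_function_dmon)
  have pG: "real_polynomial_function (\<lambda>X. G X i a)" for i a
    unfolding G_def
    by (intro real_polynomial_function_diff real_polynomial_function.intros(3,4) pF pV pDV pDF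
          real_polynomial_function_matrix_entry real_polynomial_function.intros(2))
  have zero: "(\<integral>X. G X i a * w X \<partial>lborel) = 0" for i a
  proof (rule integral_directional_derivative_eq_0[where H = "\<lambda>X. V X i a * F X * w X" and b = "munit i a"])
    show "integrable lborel (\<lambda>X. V X i a * F X * w X)"
      unfolding w_def by (rule integrable_polynomial_times_gaussian[OF real_polynomial_function.intros(4)[OF pV pF] s])
    show "integrable lborel (\<lambda>X. G X i a * w X)"
      unfolding w_def by (rule integrable_polynomial_times_gaussian[OF pG s])
    have der: "((\<lambda>t. V (X + t *\<^sub>R munit i a) i a * F (X + t *\<^sub>R munit i a) * w (X + t *\<^sub>R munit i a))
          has_real_derivative G (X + t *\<^sub>R munit i a) i a * w (X + t *\<^sub>R munit i a)) (at t)" for X t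
    proof -
      let ?E = "munit i a" let ?Y = "X + t *\<^sub>R munit i a"
      have dV: "((\<lambda>t. V (X + t *\<^sub>R ?E) i a) has_real_derivative DV ?Y i a) (at t)"
        unfolding V_def DV_def
        using has_real_derivative_matrix_entry[OF bounded_bilinear.has_vector_derivative[OF bounded_bilinear_matrix_mult
            mpow_gram_has_vector_derivative[of X ?E k t] line_has_vector_derivative]] by (simp add: add.commute)
      have dF: "((\<lambda>t. F (X + t *\<^sub>R ?E)) has_real_derivative DF ?Y i a) (at t)"
        unfolding F_def DF_def by (rule monomial_ptr_has_real_derivative)
      have dw: "((\<lambda>t. w (X + t *\<^sub>R ?E)) has_real_derivative (- s * (?Y $ i $ a)) * w ?Y) (at t)"
      proof -
        have sq: "(norm (X + u *\<^sub>R ?E))\<^sup>2 = (norm X)\<^sup>2 + 2 * u * (X $ i $ a) + u\<^sup>2" for u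
          unfolding power2_norm_eq_inner
          by (simp add: inner_add_left inner_add_right inner_munit inner_commute[of "munit i a"]
             munit_nth power2_eq_square distrib_left)
        show ?thesis unfolding w_def sq
          by (auto intro!: derivative_eq_intros simp: munit_nth power2_eq_square field_simps)
      qed
      show ?thesis
        by (rule DERIV_cong[OF DERIV_mult[OF DERIV_mult[OF dV dF] dw]]) (simp add: G_def algebra_simps)
    qed
    then show "\<exists>S. finite S \<and> (\<forall>t. t \<notin> S \<longrightarrow>
       ((\<lambda>t. V (X + t *\<^sub>R munit i a) i a * F (X + t *\<^sub>R munit i a) * w (X + t *\<^sub>R munit i a))
          has_real_derivative G (X + t *\<^sub>R munit i a) i a * w (X + t *\<^sub>R munit i a)) (at t))" for X
      by blast
    show "continuous_on UNIV (\<lambda>t. V (X + t *\<^sub>R munit i a) i a * F (X + t *\<^sub>R munit i a) * w (X + t *\<^sub>R munit i a))" for X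
      using der DERIV_isCont by (intro continuous_at_imp_continuous_on ballI) blast
  qed
  have int: "integrable lborel (\<lambda>X. G X i a * w X)" for i a
    unfolding w_def by (rule integrable_polynomial_times_gaussian[OF pG s])
  have "0 = (\<Sum>i\<in>UNIV. \<Sum>a\<in>UNIV. \<integral>X. G X i a * w X \<partial>lborel)" by (simp add: zero)
  also have "\<dots> = (\<integral>X. (\<Sum>i\<in>UNIV. \<Sum>a\<in>UNIV. G X i a * w X) \<partial>lborel)"
    by (simp add: int)
  also have "\<dots> = (\<integral>X. loop_term (real CARD('m)) (ptr X) k ks * w X - s * (ptr X (Suc k) * F X * w X) \<partial>lborel)"
  proof (intro arg_cong[where f = "integral\<^sup>L lborel"] ext)
    fix X :: "real^'m^'n"
    have 1: "(\<Sum>i\<in>UNIV. \<Sum>a\<in>UNIV. X $ i $ a * V X i a) = ptr X (Suc k)"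
      using gram_mult_transpose[of X k 0] trace_mult_transpose[of "mpow (gram X) k ** X" X]
      by (simp add: V_def mult.commute)
    have 2: "(\<Sum>i\<in>UNIV. \<Sum>a\<in>UNIV. DV X i a) = (real k + real CARD('m)) * ptr X k + (\<Sum>r=1..k. ptr X r * ptr X (k - r))"
      unfolding DV_def by (rule divergence_mpow_gram_mult)
    have 3: "(\<Sum>i\<in>UNIV. \<Sum>a\<in>UNIV. V X i a * DF X i a) = 2 * euler_term (ptr X) k ks"
      unfolding V_def DF_def by (rule sum_mpow_gram_dmon)
    have "(\<Sum>i\<in>UNIV. \<Sum>a\<in>UNIV. G X i a * w X) =
        ((\<Sum>i\<in>UNIV. \<Sum>a\<in>UNIV. DV X i a) * F X + (\<Sum>i\<in>UNIV. \<Sum>a\<in>UNIV. V X i a * DF X i a)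
         - s * (\<Sum>i\<in>UNIV. \<Sum>a\<in>UNIV. X $ i $ a * V X i a) * F X) * w X"
      by (simp add: G_def sum_distrib_left sum_distrib_right sum.distrib sum_subtractf algebra_simps)
    also have "\<dots> = loop_term (real CARD('m)) (ptr X) k ks * w X - s * (ptr X (Suc k) * F X * w X)"
      unfolding 1 2 3 loop_term_def F_def by (simp add: algebra_simps sum_distrib_left sum_distrib_right)
    finally show "(\<Sum>i\<in>UNIV. \<Sum>a\<in>UNIV. G X i a * w X) =
        loop_term (real CARD('m)) (ptr X) k ks * w X - s * (ptr X (Suc k) * F X * w X)" .
  qed
  also have "\<dots> = (\<integral>X. loop_term (real CARD('m)) (ptr X) k ks * w X \<partial>lborel) - s * (\<integral>X. ptr X (Suc k) * F X * w X \<partial>lborel)"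
  proof -
    have "integrable lborel (\<lambda>X. loop_term (real CARD('m)) (ptr X) k ks * w X)"
      unfolding w_def by (intro integrable_polynomial_times_gaussian[OF _ s] real_polynomial_function_loop_term
          real_polynomial_function_ptr)
    moreover have "integrable lborel (\<lambda>X. s * (ptr X (Suc k) * F X * w X))"
      unfolding w_def by (intro integrable_mult_right integrable_polynomial_times_gaussian[OF _ s]
          real_polynomial_function.intros(4) real_polynomial_function_ptr pF)
    ultimately show ?thesis by simp
  qed
  finally show ?thesis by (simp add: F_def w_def)
qed

section \<open>Loop equations for the Wishart weight\<close>

definition psum :: "real^'n \<Rightarrow> nat \<Rightarrow> real" where
  "psum l k = (\<Sum>i\<in>UNIV. l $ i ^ k)"

text \<open>The unnormalised joint eigenvalue density of a Gaussian matrix. The scale s is free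
  because damping and the factor 1 / M both act by changing it.\<close>

definition wishart_weight :: "real \<Rightarrow> real \<Rightarrow> real^'n::{finite,linorder} \<Rightarrow> real" where
  "wishart_weight \<alpha> s l = indicator {l. \<forall>i. 0 < l $ i} l * abs_vandermonde l
     * (\<Prod>i\<in>UNIV. l $ i powr \<alpha>) * exp (- s * (\<Sum>i\<in>UNIV. l $ i) / 2)"

lemma real_polynomial_function_vec_nth: "real_polynomial_function (\<lambda>l::real^'n. l $ i)"
  by (rule real_polynomial_function.intros(1)) (rule bounded_linear_vec_nth)

lemma real_polynomial_function_psum: "real_polynomial_function (\<lambda>l::real^'n. psum l k)"
  unfolding psum_def
  by (intro real_polynomial_function_sum real_polynomial_function_power real_polynomial_function_vec_nth) auto

lemma norm_le_sum_orthant: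
  fixes l :: "real^'n"
  assumes "\<And>i. 0 < l $ i"
  shows "norm l \<le> (\<Sum>i\<in>UNIV. l $ i)"
  using norm_le_l1_cart[of l] assms by (simp add: less_imp_le abs_of_pos)

lemma measurable_vec_nth [measurable]: "(\<lambda>l::real^'n. l $ i) \<in> borel_measurable borel"
  by (intro borel_measurable_continuous_onI continuous_intros)

lemma orthant_measurable [measurable]: "{l::real^'n. \<forall>i. 0 < l $ i} \<in> sets borel"
proof -
  have "{l::real^'n. \<forall>i. 0 < l $ i} = (\<Inter>i. {l. 0 < l $ i})" by auto
  moreover have "open {l::real^'n. 0 < l $ i}" for i
    by (intro open_Collect_less continuous_intros)
  ultimately show ?thesis by (simp add: borel_open open_INT)
qed

text \<open>The condition \<alpha> \<ge> 0 keeps the powers bounded near the walls of the orthant;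
  far out they are dominated by an integer power of one plus the sum of the coordinates, and half of
  the exponential rate absorbs the resulting polynomial.\<close>

lemma integrable_orthant_weight:
  fixes f :: "real^'n \<Rightarrow> real"
  assumes [measurable]: "f \<in> borel_measurable borel"
    and b: "\<And>l. (\<And>i. 0 < l $ i) \<Longrightarrow> \<bar>f l\<bar> \<le> C * (1 + norm l) ^ d" and "s > 0" and "\<alpha> \<ge> 0"
  shows "integrable lborel (\<lambda>l. indicator {l. \<forall>i. 0 < l $ i} l * f l * (\<Prod>i\<in>UNIV. l $ i powr \<alpha>)
     * exp (- s * (\<Sum>i\<in>UNIV. l $ i) / 2))"
proof -
  define m where "m = nat \<lceil>\<alpha>\<rceil>"
  have m: "\<alpha> \<le> real m" by (simp add: m_def real_nat_ceiling_ge)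
  \<comment> \<open>A point of the open orthant, where the bound on f is assumed; it serves to show
    that C is nonnegative.\<close>
  define v :: "real^'n" where "v = (\<chi> i. 1)"
  have "0 \<le> \<bar>f v\<bar>" by simp
  also have "\<dots> \<le> C * (1 + norm v) ^ d" by (rule b) (simp add: v_def)
  finally have "0 \<le> C * (1 + norm v) ^ d" .
  moreover have "0 < (1 + norm v) ^ d" by (intro zero_less_power) (simp add: add_pos_nonneg)
  ultimately have "C \<ge> 0" by (meson mult_neg_pos not_le)
  define D where "D = d + m * CARD('n)"
  define K where "K = C * ((4 / s) ^ D * fact D * exp (s / 4))"
  have K0: "K \<ge> 0" using \<open>C \<ge> 0\<close> \<open>s > 0\<close> by (simp add: K_def)
  have bound: "\<bar>f l * (\<Prod>i\<in>UNIV. l $ i powr \<alpha>) * exp (- s * (\<Sum>i\<in>UNIV. l $ i) / 2)\<bar>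
      \<le> K * exp (- (s / 4) * (\<Sum>i\<in>UNIV. l $ i))" if l: "\<And>i. 0 < l $ i" for l
  proof -
    let ?P = "\<Sum>i\<in>UNIV. l $ i"
    have P: "?P \<ge> 0" using l by (intro sum_nonneg) (simp add: less_imp_le)
    have f: "\<bar>f l\<bar> \<le> C * (1 + ?P) ^ d"
      using b[OF l] norm_le_sum_orthant[OF l] \<open>C \<ge> 0\<close>
      by (meson add_left_mono mult_left_mono norm_ge_zero order_trans power_mono add_nonneg_nonneg zero_le_one)
    have pw: "l $ i powr \<alpha> \<le> (1 + ?P) ^ m" for i
    proof -
      have "l $ i \<le> ?P" using l by (intro member_le_sum) (auto simp: less_imp_le)
      then have "l $ i powr \<alpha> \<le> (1 + ?P) powr \<alpha>" using l[of i] \<open>\<alpha> \<ge> 0\<close> by (intro powr_mono2) auto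
      also have "\<dots> \<le> (1 + ?P) powr real m" using m P by (intro powr_mono) auto
      also have "\<dots> = (1 + ?P) ^ m" using P by (intro powr_realpow) auto
      finally show ?thesis .
    qed
    have "(\<Prod>i\<in>UNIV. l $ i powr \<alpha>) \<le> (\<Prod>i\<in>(UNIV::'n set). (1 + ?P) ^ m)"
      using pw by (intro prod_mono) auto
    also have "\<dots> = (1 + ?P) ^ (m * CARD('n))" by (simp add: power_mult)
    finally have "\<bar>f l\<bar> * (\<Prod>i\<in>UNIV. l $ i powr \<alpha>) \<le> C * (1 + ?P) ^ d * (1 + ?P) ^ (m * CARD('n))"
      using f by (intro mult_mono) (auto intro!: prod_nonneg)
    also have "\<dots> = C * (1 + ?P) ^ D"
      by (simp add: D_def power_add)
    also have "(1 + ?P) ^ D = (4 / s) ^ D * (s / 4 * (1 + ?P)) ^ D"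
    proof -
      have "4 / s * (s / 4) = 1" using \<open>s > 0\<close> by simp
      then show ?thesis
        unfolding power_mult_distrib[symmetric] mult.assoc[symmetric] by simp
    qed
    also have "C * ((4 / s) ^ D * (s / 4 * (1 + ?P)) ^ D) \<le> C * ((4 / s) ^ D * (fact D * exp (s / 4 * (1 + ?P))))"
      using \<open>C \<ge> 0\<close> \<open>s > 0\<close> P by (intro mult_left_mono power_le_fact_mult_exp) auto
    also have "\<dots> = K * exp (s / 4 * ?P)" by (simp add: K_def distrib_left exp_add)
    finally have "\<bar>f l\<bar> * (\<Prod>i\<in>UNIV. l $ i powr \<alpha>) * exp (- s * ?P / 2) \<le> K * exp (s / 4 * ?P) * exp (- s * ?P / 2)"
      by (rule mult_right_mono) simp
    also have "\<dots> = K * exp (- (s / 4) * ?P)" by (simp add: mult_exp_exp mult.assoc)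
    finally show ?thesis by (simp add: abs_mult prod_nonneg)
  qed
  have "integrable lborel (\<lambda>l::real^'n. K * (indicator {l. \<forall>i. 0 < l $ i} l * exp (- (s / 4) * (\<Sum>i\<in>UNIV. l $ i))))"
    using integrable_exp_orthant[of "s / 4", where 'n='n] \<open>s > 0\<close> by (intro integrable_mult_right) auto
  then show ?thesis
  proof (rule Bochner_Integration.integrable_bound)
    show "AE l in lborel. norm (indicator {l. \<forall>i. 0 < l $ i} l * f l * (\<Prod>i\<in>UNIV. l $ i powr \<alpha>)
       * exp (- s * (\<Sum>i\<in>UNIV. l $ i) / 2)) \<le> norm (K * (indicator {l. \<forall>i. 0 < l $ i} l * exp (- (s / 4) * (\<Sum>i\<in>UNIV. l $ i))))"
      using bound K0 by (auto simp: indicator_def)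
  qed measurable
qed

lemma borel_measurable_abs_vandermonde [measurable]:
  "(abs_vandermonde :: real^'n::{finite,linorder} \<Rightarrow> real) \<in> borel_measurable borel"
  unfolding abs_vandermonde_def split_beta by measurable

lemma borel_measurable_wishart_weight [measurable]: "wishart_weight \<alpha> s \<in> borel_measurable borel"
  unfolding wishart_weight_def by measurable

lemma abs_vandermonde_nonneg: "abs_vandermonde l \<ge> 0"
  unfolding abs_vandermonde_def split_beta by (intro prod_nonneg) auto

lemma wishart_weight_nonneg: "wishart_weight \<alpha> s l \<ge> 0"
  unfolding wishart_weight_def by (intro mult_nonneg_nonneg prod_nonneg abs_vandermonde_nonneg) auto

lemma abs_coordinate_diff_le: "\<bar>l $ a - l $ b\<bar> \<le> 2 * (1 + norm (l::real^'n))"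
  using component_le_norm_cart[of l a] component_le_norm_cart[of l b]
    abs_triangle_ineq4[of "l $ a" "l $ b"] unfolding distrib_left by linarith

lemma prod_pairs_le:
  fixes l :: "real^'n::{finite,linorder}"
  assumes "S \<subseteq> {(a, b). a < b}"
  shows "(\<Prod>(a, b)\<in>S. \<bar>l $ b - l $ a\<bar>) \<le> (2 * (1 + norm l)) ^ card {(a::'n, b). a < b}"
proof -
  have "(\<Prod>(a, b)\<in>S. \<bar>l $ b - l $ a\<bar>) \<le> (\<Prod>x\<in>S. 2 * (1 + norm l))"
    unfolding split_beta by (intro prod_mono conjI abs_ge_zero abs_coordinate_diff_le)
  also have "\<dots> = (2 * (1 + norm l)) ^ card S" by simp
  also have "\<dots> \<le> (2 * (1 + norm l)) ^ card {(a::'n, b). a < b}"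
  proof (intro power_increasing card_mono assms)
    show "1 \<le> 2 * (1 + norm l)" using norm_ge_zero[of l] unfolding distrib_left by linarith
  qed simp
  finally show ?thesis .
qed

lemma abs_vandermonde_growth:
  fixes l :: "real^'n::{finite,linorder}"
  shows "abs_vandermonde l \<le> (2 * (1 + norm l)) ^ card {(a::'n, b). a < b}"
  unfolding abs_vandermonde_def by (rule prod_pairs_le) auto

text \<open>The division cancels one factor of the product, so the singular logarithmic derivative
  becomes harmless after multiplication by the Vandermonde factor. For coinciding coordinates the
  quotient is 0 by the convention for division by zero.\<close>

lemma abs_vandermonde_divide_growth:
  fixes l :: "real^'n::{finite,linorder}"
  assumes "a < b"
  shows "\<bar>abs_vandermonde l / (l $ b - l $ a)\<bar> \<le> (2 * (1 + norm l)) ^ card {(a::'n, b). a < b}"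
proof (cases "l $ b = l $ a")
  case False
  have "abs_vandermonde l = \<bar>l $ b - l $ a\<bar> * (\<Prod>(a, b)\<in>{(a, b). a < b} - {(a, b)}. \<bar>l $ b - l $ a\<bar>)"
    unfolding abs_vandermonde_def using assms by (subst prod.remove[of _ "(a, b)"]) auto
  then have "\<bar>abs_vandermonde l / (l $ b - l $ a)\<bar> = (\<Prod>(a, b)\<in>{(a, b). a < b} - {(a, b)}. \<bar>l $ b - l $ a\<bar>)"
    using False by (simp add: abs_mult abs_prod split_beta)
  also have "\<dots> \<le> (2 * (1 + norm l)) ^ card {(a::'n, b). a < b}"
    by (rule prod_pairs_le) auto
  finally show ?thesis .
qed simp

text \<open>The partial derivative of the logarithm of \<open>abs_vandermonde\<close> in the jth
  coordinate, summed over all pairs so that the index set does not depend on j. Where coordinates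
  coincide its value is a convention, and there the weight vanishes.\<close>

definition vandermonde_log_derivative :: "'n::{finite,linorder} \<Rightarrow> real^('n::{finite,linorder}) \<Rightarrow> real" where
  "vandermonde_log_derivative j l = (\<Sum>(a, b)\<in>{(a, b). a < b}.
     (if b = j then 1 / (l $ b - l $ a) else if a = j then 1 / (l $ a - l $ b) else 0))"

lemma integrable_polynomial_wishart_weight:
  fixes f :: "real^'n::{finite,linorder} \<Rightarrow> real"
  assumes f: "real_polynomial_function f" and s: "s > 0" and "\<alpha> \<ge> 0"
  shows "integrable lborel (\<lambda>l. f l * wishart_weight \<alpha> s l)"
    and "integrable lborel (\<lambda>l. f l * vandermonde_log_derivative j l * wishart_weight \<alpha> s l)"
proof -
  obtain C d where C: "\<And>x. \<bar>f x\<bar> \<le> C * (1 + norm x) ^ d"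
    using real_polynomial_function_growth[OF f] by blast
  have fm[measurable]: "f \<in> borel_measurable borel"
    using continuous_on_polymonial_function[of f UNIV] f
    by (intro borel_measurable_continuous_onI) (auto simp: real_polynomial_function_eq)
  let ?D = "card {(a::'n, b). a < b}"
  \<comment> \<open>Only the product of g with the Vandermonde factor needs polynomial growth; this
    covers g = 1 and each singular summand of the logarithmic derivative.\<close>
  have gen: "integrable lborel (\<lambda>l. f l * g l * wishart_weight \<alpha> s l)"
    if [measurable]: "g \<in> borel_measurable borel" and g: "\<And>l. \<bar>g l * abs_vandermonde l\<bar> \<le> (2 * (1 + norm l)) ^ ?D"
    for g :: "(real,'n) vec \<Rightarrow> real"
  proof -
    have "\<bar>f l * (g l * abs_vandermonde l)\<bar> \<le> (C * 2 ^ ?D) * (1 + norm l) ^ (d + ?D)" for l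
    proof -
      have "\<bar>f l * (g l * abs_vandermonde l)\<bar> \<le> (C * (1 + norm l) ^ d) * (2 * (1 + norm l)) ^ ?D"
        unfolding abs_mult[of "f l"] by (intro mult_mono C g order_trans[OF abs_ge_zero C]) auto
      also have "\<dots> = (C * 2 ^ ?D) * (1 + norm l) ^ (d + ?D)" by (simp only: power_mult_distrib power_add mult_ac)
      finally show ?thesis .
    qed
    then have "integrable lborel (\<lambda>l. indicator {l. \<forall>i. 0 < l $ i} l * (f l * (g l * abs_vandermonde l)) * (\<Prod>i\<in>UNIV. l $ i powr \<alpha>)
     * exp (- s * (\<Sum>i\<in>UNIV. l $ i) / 2))"
      by (intro integrable_orthant_weight[OF _ _ s \<open>\<alpha> \<ge> 0\<close>]) auto
    then show ?thesis by (simp add: wishart_weight_def mult_ac)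
  qed
  show "integrable lborel (\<lambda>l. f l * wishart_weight \<alpha> s l)"
  proof -
    have "\<bar>1 * abs_vandermonde l\<bar> \<le> (2 * (1 + norm l)) ^ ?D" for l :: "(real,'n) vec"
      using abs_vandermonde_growth[of l] by (simp add: abs_vandermonde_nonneg)
    from gen[of "\<lambda>_. 1", OF _ this] show ?thesis by simp
  qed
  have t: "integrable lborel (\<lambda>l. f l * (if b = j then 1 / (l $ b - l $ a) else if a = j then 1 / (l $ a - l $ b) else 0) * wishart_weight \<alpha> s l)"
    if "a < b" for a b :: 'n
  proof (rule gen)
    fix l :: "(real,'n) vec"
    have "\<bar>abs_vandermonde l / (l $ a - l $ b)\<bar> = \<bar>abs_vandermonde l / (l $ b - l $ a)\<bar>"
      by (simp add: abs_minus_commute)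
    then show "\<bar>(if b = j then 1 / (l $ b - l $ a) else if a = j then 1 / (l $ a - l $ b) else 0) * abs_vandermonde l\<bar>
      \<le> (2 * (1 + norm l)) ^ ?D"
      using abs_vandermonde_divide_growth[OF that, of l] by auto
  qed measurable
  have "integrable lborel (\<lambda>l. \<Sum>x\<in>{(a, b). a < b}. f l * (if snd x = j then 1 / (l $ snd x - l $ fst x)
      else if fst x = j then 1 / (l $ fst x - l $ snd x) else 0) * wishart_weight \<alpha> s l)"
    by (intro Bochner_Integration.integrable_sum) (auto intro!: t)
  then show "integrable lborel (\<lambda>l. f l * vandermonde_log_derivative j l * wishart_weight \<alpha> s l)"
    by (simp add: vandermonde_log_derivative_def split_beta sum_distrib_left sum_distrib_right)
qed

section \<open>Differentiation of the weight along coordinate lines\<close>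

text \<open>Derivatives written as f times a logarithmic derivative add up under products, and no
  division by a possibly vanishing f occurs.\<close>

lemma DERIV_mult_log:
  fixes f g :: "real \<Rightarrow> real"
  assumes "(f has_real_derivative f t * a) (at t)" "(g has_real_derivative g t * b) (at t)"
  shows "((\<lambda>t. f t * g t) has_real_derivative f t * g t * (a + b)) (at t)"
  by (rule DERIV_cong[OF DERIV_mult[OF assms]]) (simp add: algebra_simps)

lemma DERIV_prod_log:
  fixes f :: "'i \<Rightarrow> real \<Rightarrow> real"
  assumes "finite I" "\<And>i. i \<in> I \<Longrightarrow> (f i has_real_derivative f i t * a i) (at t)"
  shows "((\<lambda>t. \<Prod>i\<in>I. f i t) has_real_derivative (\<Prod>i\<in>I. f i t) * (\<Sum>i\<in>I. a i)) (at t)"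
  using assms
proof (induction I rule: finite_induct)
  case (insert i I)
  then show ?case using DERIV_mult_log[of "f i" t "a i" "\<lambda>t. \<Prod>i\<in>I. f i t"] by simp
qed simp

lemma psum_line_has_real_derivative:
  "((\<lambda>t. psum (x + t *\<^sub>R axis j 1) k) has_real_derivative real k * (x + t *\<^sub>R axis j 1) $ j ^ (k - 1)) (at t)"
proof -
  have "((\<lambda>t. psum (x + t *\<^sub>R axis j 1) k) has_real_derivative
     (\<Sum>i\<in>UNIV. real k * (x $ i + t * axis j 1 $ i) ^ (k - 1) * axis j 1 $ i)) (at t)"
    unfolding psum_def by (auto intro!: derivative_eq_intros simp: mult_ac)
  also have "(\<Sum>i\<in>UNIV. real k * (x $ i + t * axis j 1 $ i) ^ (k - 1) * axis j 1 $ i) = real k * (x + t *\<^sub>R axis j 1) $ j ^ (k - 1)"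
    by (simp add: axis_def if_distrib cong: if_cong)
  finally show ?thesis .
qed

lemma monomial_psum_has_real_derivative:
  "((\<lambda>t. prod_list (map (psum (x + t *\<^sub>R axis j 1)) ks)) has_real_derivative
     dmon (psum (x + t *\<^sub>R axis j 1)) (\<lambda>m. real m * (x + t *\<^sub>R axis j 1) $ j ^ (m - 1)) ks) (at t)"
proof (induction ks)
  case (Cons m ms)
  show ?case
    using DERIV_mult[OF psum_line_has_real_derivative[of x j m t] Cons.IH] by (simp add: add.commute mult.commute)
qed simp

lemma real_polynomial_function_dmon_psum:
  "real_polynomial_function (\<lambda>l::real^'n. dmon (psum l) (\<lambda>m. real m * l $ j ^ (m - 1)) ks)"
proof (induction ks)
  case (Cons m ms)
  have "real_polynomial_function (\<lambda>l::real^'n. real m * l $ j ^ (m - 1) * prod_list (map (psum l) ms)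
      + psum l m * dmon (psum l) (\<lambda>m. real m * l $ j ^ (m - 1)) ms)"
    by (intro real_polynomial_function.intros(3,4) real_polynomial_function.intros(2) Cons real_polynomial_function_power
       real_polynomial_function_vec_nth real_polynomial_function_psum real_polynomial_function_prod_list)
  then show ?case by simp
qed (simp add: real_polynomial_function.intros(2))

lemma sum_power_dmon_psum:
  "(\<Sum>j\<in>UNIV. l $ j ^ Suc k * dmon (psum l) (\<lambda>m. real m * l $ j ^ (m - 1)) ks) = euler_term (psum l) k ks"
proof (induction ks)
  case (Cons m ms)
  have 1: "(\<Sum>j\<in>UNIV. l $ j ^ Suc k * (real m * l $ j ^ (m - 1))) = real m * psum l (k + m)"
  proof (cases m)
    case (Suc n)
    then show ?thesis by (simp add: psum_def sum_distrib_left power_add mult_ac)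
  qed simp
  have "(\<Sum>j\<in>UNIV. l $ j ^ Suc k * dmon (psum l) (\<lambda>m. real m * l $ j ^ (m - 1)) (m # ms)) =
    (\<Sum>j\<in>UNIV. l $ j ^ Suc k * (real m * l $ j ^ (m - 1))) * prod_list (map (psum l) ms) +
    psum l m * (\<Sum>j\<in>UNIV. l $ j ^ Suc k * dmon (psum l) (\<lambda>m. real m * l $ j ^ (m - 1)) ms)"
    by (simp add: sum_distrib_left sum_distrib_right sum.distrib algebra_simps)
  then show ?case unfolding 1 Cons.IH by simp
qed simp

text \<open>The double sum over pairs of indices splits into the diagonal, where the k + 1 terms all
  equal the kth power, and two equal off-diagonal halves. It links the pair sums coming from the
  Vandermonde factor to products of power sums.\<close>

lemma power_sum_product:
  fixes l :: "real^'n::{finite,linorder}"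
  shows "(\<Sum>r\<le>k. psum l r * psum l (k - r)) = (real k + 1) * psum l k
    + 2 * (\<Sum>(a, b)\<in>{(a, b). a < b}. \<Sum>r\<le>k. l $ b ^ r * l $ a ^ (k - r))"
proof -
  define g where "g = (\<lambda>a b. \<Sum>r\<le>k. l $ a ^ r * l $ b ^ (k - r))"
  have sym: "g a b = g b a" for a b
    unfolding g_def using sum.nat_diff_reindex[of "\<lambda>r. l $ a ^ r * l $ b ^ (k - r)" "Suc k"]
    by (simp add: lessThan_Suc_atMost mult.commute cong: sum.cong_simp)
  have diag: "g a a = (real k + 1) * l $ a ^ k" for a
    by (simp add: g_def power_add[symmetric])
  have "(\<Sum>r\<le>k. psum l r * psum l (k - r)) = (\<Sum>r\<le>k. \<Sum>(a, b)\<in>UNIV. l $ a ^ r * l $ b ^ (k - r))"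
    by (simp add: psum_def sum_product sum.cartesian_product)
  also have "\<dots> = (\<Sum>(a, b)\<in>UNIV. g a b)"
    unfolding g_def split_beta by (rule sum.swap)
  also have "(UNIV :: ('n \<times> 'n) set) = {(a, b). a = b} \<union> ({(a, b). a < b} \<union> {(a, b). b < a})"
    by auto
  also have "(\<Sum>(a, b)\<in>\<dots>. g a b) = (\<Sum>(a, b)\<in>{(a, b). a = b}. g a b) +
      ((\<Sum>(a, b)\<in>{(a, b). a < b}. g a b) + (\<Sum>(a, b)\<in>{(a, b). b < a}. g a b))"
    by (subst sum.union_disjoint; (subst sum.union_disjoint)?) auto
  also have "(\<Sum>(a, b)\<in>{(a, b). b < a}. g a b) = (\<Sum>(a, b)\<in>{(a, b). a < b}. g a b)"
    by (rule sum.reindex_bij_witness[of _ prod.swap prod.swap]) (auto simp: sym)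
  also have "(\<Sum>(a, b)\<in>{(a, b). a = b}. g a b) = (\<Sum>a\<in>UNIV. g a a)"
    by (rule sum.reindex_bij_witness[of _ "\<lambda>a. (a, a)" fst]) auto
  finally have *: "(\<Sum>r\<le>k. psum l r * psum l (k - r)) = (\<Sum>a\<in>UNIV. g a a) + 2 * (\<Sum>(a, b)\<in>{(a, b). a < b}. g a b)"
    by simp
  have "(\<Sum>r\<le>k. l $ b ^ r * l $ a ^ (k - r)) = g a b" for a b
    unfolding sym[of a b] by (simp add: g_def)
  moreover have "(\<Sum>a\<in>UNIV. g a a) = (real k + 1) * psum l k"
    by (simp add: diag psum_def sum_distrib_left)
  ultimately show ?thesis using * by simp
qed

text \<open>The two contributions of a pair a < b combine to the difference quotient of the power k
  + 1, a geometric sum without singularity.\<close>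

lemma sum_power_vandermonde_log_derivative:
  fixes l :: "real^'n::{finite,linorder}"
  assumes "\<And>a b. a \<noteq> b \<Longrightarrow> l $ a \<noteq> l $ b"
  shows "(\<Sum>j\<in>UNIV. l $ j ^ Suc k * vandermonde_log_derivative j l) =
    (\<Sum>(a, b)\<in>{(a, b). a < b}. \<Sum>r\<le>k. l $ b ^ r * l $ a ^ (k - r))"
proof -
  have "(\<Sum>j\<in>UNIV. l $ j ^ Suc k * vandermonde_log_derivative j l) =
     (\<Sum>(a, b)\<in>{(a, b). a < b}. \<Sum>j\<in>UNIV. l $ j ^ Suc k *
        (if b = j then 1 / (l $ b - l $ a) else if a = j then 1 / (l $ a - l $ b) else 0))"
    unfolding vandermonde_log_derivative_def split_beta sum_distrib_left by (rule sum.swap)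
  also have "\<dots> = (\<Sum>(a, b)\<in>{(a, b). a < b}. \<Sum>r\<le>k. l $ b ^ r * l $ a ^ (k - r))"
  proof (rule sum.cong[OF refl], clarify)
    fix a b :: 'n assume "a < b"
    then have ne: "a \<noteq> b" "l $ a \<noteq> l $ b" using assms by auto
    have "(\<Sum>j\<in>UNIV. l $ j ^ Suc k * (if b = j then 1 / (l $ b - l $ a) else if a = j then 1 / (l $ a - l $ b) else 0))
      = (\<Sum>j\<in>UNIV. (if b = j then l $ j ^ Suc k / (l $ b - l $ a) else 0) + (if a = j then l $ j ^ Suc k / (l $ a - l $ b) else 0))"
      using ne by (intro sum.cong) auto
    also have "\<dots> = l $ b ^ Suc k / (l $ b - l $ a) + l $ a ^ Suc k / (l $ a - l $ b)"
      by (simp add: sum.distrib)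
    also have "\<dots> = (l $ b ^ Suc k - l $ a ^ Suc k) / (l $ b - l $ a)"
      using ne by (simp add: divide_simps) (simp add: algebra_simps)
    also have "l $ b ^ Suc k - l $ a ^ Suc k = (l $ b - l $ a) * (\<Sum>r\<le>k. l $ b ^ r * l $ a ^ (k - r))"
      using power_diff_sumr2[of "l $ b" "Suc k" "l $ a"] 
      by (simp add: lessThan_Suc_atMost sum.nat_diff_reindex[of "\<lambda>r. l $ b ^ r * l $ a ^ (k - r)" "Suc k", symmetric] mult.commute
          del: power_Suc)
    finally show "(\<Sum>j\<in>UNIV. l $ j ^ Suc k * (if b = j then 1 / (l $ b - l $ a) else if a = j then 1 / (l $ a - l $ b) else 0))
      = (\<Sum>r\<le>k. l $ b ^ r * l $ a ^ (k - r))" using ne by simp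
  qed
  finally show ?thesis .
qed

lemma abs_vandermonde_eq_0:
  fixes l :: "real^'n::{finite,linorder}"
  assumes "a \<noteq> b" "l $ a = l $ b"
  shows "abs_vandermonde l = 0"
proof -
  consider "a < b" | "b < a" using assms(1) by force
  then show ?thesis
  proof cases
    case 1
    then show ?thesis unfolding abs_vandermonde_def
      using assms(2) by (intro prod_zero bexI[of _ "(a, b)"]) auto
  next
    case 2
    then show ?thesis unfolding abs_vandermonde_def
      using assms(2) by (intro prod_zero bexI[of _ "(b, a)"]) auto
  qed
qed

text \<open>The field moves the \<open>j\<close>th coordinate only; the weight is continuous along its lines because the
  exponent \<open>\<alpha> + k + 1\<close> at the boundary of the orthant is positive.\<close>
lemma weighted_power_line:
  fixes x :: "real^'n::{finite,linorder}" and F DF :: "(real,'n) vec \<Rightarrow> real" and s \<alpha> :: real and k :: nat and j :: 'n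
  assumes \<alpha>: "\<alpha> \<ge> 0"
    and F: "\<And>t. ((\<lambda>t. F (x + t *\<^sub>R axis j 1)) has_real_derivative DF (x + t *\<^sub>R axis j 1)) (at t)"
  defines "H \<equiv> \<lambda>l. F l * (l $ j ^ Suc k * wishart_weight \<alpha> s l)"
    and "H' \<equiv> \<lambda>l. (DF l + F l * ((real k + 1 + \<alpha>) / l $ j + vandermonde_log_derivative j l - s / 2))
            * (l $ j ^ Suc k * wishart_weight \<alpha> s l)"
  shows "continuous_on UNIV (\<lambda>t. H (x + t *\<^sub>R axis j 1))"
    and "\<exists>S. finite S \<and> (\<forall>t. t \<notin> S \<longrightarrow> ((\<lambda>t. H (x + t *\<^sub>R axis j 1)) has_real_derivative H' (x + t *\<^sub>R axis j 1)) (at t))"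
proof -
  let ?l = "\<lambda>t. x + t *\<^sub>R axis j 1"
  have lj: "?l t $ j = x $ j + t" for t by (simp add: axis_def)
  have li: "i \<noteq> j \<Longrightarrow> ?l t $ i = x $ i" for t i by (simp add: axis_def)
  \<comment> \<open>The part of the weight that motion along the line leaves constant.\<close>
  define c :: real where "c = (if \<forall>i. i \<noteq> j \<longrightarrow> 0 < x $ i then 1 else 0) * (\<Prod>i\<in>UNIV - {j}. x $ i powr \<alpha>)"
  have pr: "(\<Prod>i\<in>UNIV. ?l t $ i powr \<alpha>) = (x $ j + t) powr \<alpha> * (\<Prod>i\<in>UNIV - {j}. x $ i powr \<alpha>)" for t
    by (subst prod.remove[of _ j]) (auto simp: axis_def intro!: prod.cong)
  have ind: "indicator {l. \<forall>i. 0 < l $ i} (?l t) = (if 0 < x $ j + t then 1 else 0) * (if \<forall>i. i \<noteq> j \<longrightarrow> 0 < x $ i then 1 else (0::real))" for t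
  proof -
    have "(\<forall>i. 0 < ?l t $ i) \<longleftrightarrow> 0 < x $ j + t \<and> (\<forall>i. i \<noteq> j \<longrightarrow> 0 < x $ i)"
      by (metis lj li)
    then show ?thesis unfolding indicator_def mem_Collect_eq by auto
  qed
  define E where "E = (\<lambda>t. abs_vandermonde (?l t) * exp (- s * (\<Sum>i\<in>UNIV. ?l t $ i) / 2))"
  \<comment> \<open>Truncating the moving coordinate at 0 builds its positivity into a power with
    positive exponent, so \<open>H\<close> is visibly continuous across the wall.\<close>
  have Heq: "H (?l t) = F (?l t) * (max 0 (x $ j + t) powr (\<alpha> + real (Suc k)) * c * E t)" for t
  proof (cases "0 < x $ j + t")
    case True
    then have "(x $ j + t) ^ Suc k * (x $ j + t) powr \<alpha> = max 0 (x $ j + t) powr (\<alpha> + real (Suc k))"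
      by (simp add: powr_add powr_realpow[symmetric] max_def mult.commute del: power_Suc)
    then have "max 0 (x $ j + t) powr (\<alpha> + real (Suc k)) * c * E t = (x $ j + t) ^ Suc k * wishart_weight \<alpha> s (?l t)"
      unfolding wishart_weight_def pr ind E_def c_def using True by (simp add: mult_ac del: power_Suc)
    then show ?thesis unfolding H_def lj by simp
  next
    case False
    then have "wishart_weight \<alpha> s (?l t) = 0" unfolding wishart_weight_def ind by simp
    then show ?thesis using False by (simp add: H_def max_def)
  qed
  have Econt: "continuous_on UNIV E"
    unfolding E_def abs_vandermonde_def split_beta by (intro continuous_intros) auto
  have Fcont: "continuous_on UNIV (\<lambda>t. F (?l t))"
    using F DERIV_isCont by (intro continuous_at_imp_continuous_on ballI) blast
  have Mcont: "continuous_on UNIV (\<lambda>t. max 0 (x $ j + t) powr (\<alpha> + real (Suc k)))"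
    using \<alpha> by (intro continuous_on_powr' continuous_intros) auto
  show "continuous_on UNIV (\<lambda>t. H (?l t))"
    unfolding Heq by (intro continuous_on_mult continuous_on_const Mcont Econt Fcont)
  \<comment> \<open>The times at which the moving coordinate hits the wall or another coordinate; i
    = j merely adds t = 0.\<close>
  let ?S = "insert (- x $ j) ((\<lambda>i. x $ i - x $ j) ` UNIV)"
  have "((\<lambda>t. H (?l t)) has_real_derivative H' (?l t)) (at t)" if t: "t \<notin> ?S" for t
  proof (cases "0 < x $ j + t")
    case False
    then have neg: "x $ j + t < 0" using t by (auto simp: not_less)
    have "H' (?l t) = 0"
      using neg unfolding H'_def wishart_weight_def ind by simp
    moreover have "((\<lambda>t. H (?l t)) has_real_derivative 0) (at t)"
    proof (rule has_field_derivative_transform_within_open[where S = "{..< - x $ j}" and f = "\<lambda>_. 0"])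
      show "0 = H (?l u)" if "u \<in> {..< - x $ j}" for u
        using that unfolding Heq by (simp add: max_def)
    qed (use neg in auto)
    ultimately show ?thesis by simp
  next
    case True
    define y where "y = x $ j + t"
    have ne: "i \<noteq> j \<Longrightarrow> y - x $ i \<noteq> 0" for i
    proof
      assume "y - x $ i = 0"
      then have "t = x $ i - x $ j" by (simp add: y_def)
      then show False using t by blast
    qed
    have d1: "((\<lambda>t. (x $ j + t) ^ Suc k) has_real_derivative (x $ j + t) ^ Suc k * ((real k + 1) / y)) (at t)"
    proof -
      have "((\<lambda>t. x $ j + t) has_real_derivative 1) (at t)" by (auto intro!: derivative_eq_intros)
      from DERIV_power_Suc[OF this, of k] show ?thesis
        by (rule DERIV_cong) (use True in \<open>simp add: y_def field_simps\<close>)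
    qed
    have d2: "((\<lambda>t. (x $ j + t) powr \<alpha>) has_real_derivative (x $ j + t) powr \<alpha> * (\<alpha> / y)) (at t)"
      using True by (auto intro!: derivative_eq_intros simp: y_def powr_diff field_simps)
    have d3: "((\<lambda>t. exp (- s * (\<Sum>i\<in>UNIV. ?l t $ i) / 2)) has_real_derivative exp (- s * (\<Sum>i\<in>UNIV. ?l t $ i) / 2) * (- s / 2)) (at t)"
    proof -
      have "(\<Sum>i\<in>UNIV. ?l u $ i) = (\<Sum>i\<in>UNIV. x $ i) + u" for u
      proof -
        have "(\<Sum>i\<in>UNIV. u * axis j 1 $ i) = u" by (simp add: axis_def if_distrib cong: if_cong)
        then show ?thesis by (simp add: sum.distrib)
      qed
      then show ?thesis by (auto intro!: derivative_eq_intros)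
    qed
    have d4: "((\<lambda>t. abs_vandermonde (?l t)) has_real_derivative abs_vandermonde (?l t) * vandermonde_log_derivative j (?l t)) (at t)"
      unfolding abs_vandermonde_def vandermonde_log_derivative_def
    proof (rule DERIV_prod_log)
      fix p :: "'n \<times> 'n" assume "p \<in> {(a, b). a < b}"
      then obtain a b where p: "p = (a, b)" "a < b" by auto
      have absd: "((\<lambda>t. \<bar>x $ j + t - z\<bar>) has_real_derivative \<bar>y - z\<bar> * (1 / (y - z))) (at t)" if "y - z \<noteq> 0" for z
      proof -
        have d: "((\<lambda>t. e * (x $ j + t - z)) has_real_derivative e) (at t)" for e
          by (auto intro!: derivative_eq_intros)
        have "((\<lambda>t. \<bar>x $ j + t - z\<bar>) has_real_derivative sgn (y - z)) (at t)"
        proof (cases "y - z > 0")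
          case True
          show ?thesis
            by (rule has_field_derivative_transform_within_open[OF d[of "sgn (y - z)"], of "{z - x $ j <..}"])
               (use True in \<open>auto simp: y_def\<close>)
        next
          case False
          then have "y - z < 0" using that by simp
          then show ?thesis
            by (intro has_field_derivative_transform_within_open[OF d[of "sgn (y - z)"], of "{..< z - x $ j}"])
               (auto simp: y_def)
        qed
        moreover have "sgn (y - z) = \<bar>y - z\<bar> * (1 / (y - z))" using that by (auto simp: sgn_if abs_if field_simps)
        ultimately show ?thesis by simp
      qed
      consider "b = j" | "b \<noteq> j" "a = j" | "b \<noteq> j" "a \<noteq> j" by blast
      then have "((\<lambda>t. \<bar>?l t $ b - ?l t $ a\<bar>) has_real_derivative \<bar>?l t $ b - ?l t $ a\<bar> *
          (if b = j then 1 / (?l t $ b - ?l t $ a) else if a = j then 1 / (?l t $ a - ?l t $ b) else 0)) (at t)"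
      proof cases
        case 1
        then have aj: "a \<noteq> j" using p by auto
        then show ?thesis using absd[OF ne[OF aj]] unfolding 1 lj li[OF aj] by (simp add: y_def)
      next
        case 2
        show ?thesis using absd[OF ne[OF 2(1)]] unfolding 2(2) lj li[OF 2(1)] using 2(1)
          by (simp add: y_def abs_minus_commute)
      next
        case 3
        then show ?thesis unfolding li[OF 3(1)] li[OF 3(2)] by simp
      qed
      then show "((\<lambda>t. case p of (a, b) \<Rightarrow> \<bar>?l t $ b - ?l t $ a\<bar>) has_real_derivative
          (case p of (a, b) \<Rightarrow> \<bar>?l t $ b - ?l t $ a\<bar>) *
          (case p of (a, b) \<Rightarrow> if b = j then 1 / (?l t $ b - ?l t $ a) else if a = j then 1 / (?l t $ a - ?l t $ b) else 0)) (at t)"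
        by (simp only: p prod.case)
    qed simp
    let ?R = "\<lambda>t. (x $ j + t) ^ Suc k * (x $ j + t) powr \<alpha> * exp (- s * (\<Sum>i\<in>UNIV. ?l t $ i) / 2) * abs_vandermonde (?l t)"
    have dR: "(?R has_real_derivative ?R t * ((real k + 1) / y + \<alpha> / y + (- s / 2) + vandermonde_log_derivative j (?l t))) (at t)"
      by (intro DERIV_mult_log d1 d2 d3 d4)
    have wR: "(x $ j + u) ^ Suc k * wishart_weight \<alpha> s (?l u) = c * ?R u" if "0 < x $ j + u" for u
      unfolding wishart_weight_def pr ind c_def using that by (simp add: mult_ac del: power_Suc)
    define r where "r = ?R t"
    have Ht: "H' (?l t) = (DF (?l t) + F (?l t) * ((real k + 1 + \<alpha>) / y + vandermonde_log_derivative j (?l t) - s / 2)) * (c * r)"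
      unfolding H'_def r_def wR[OF True, symmetric] lj y_def ..
    have "((\<lambda>t. F (?l t) * (c * ?R t)) has_real_derivative H' (?l t)) (at t)"
      by (rule DERIV_cong[OF DERIV_mult[OF F DERIV_cmult[OF dR]]], unfold Ht r_def[symmetric])
         (simp add: algebra_simps add_divide_distrib)
    then show ?thesis
    proof (rule has_field_derivative_transform_within_open[where S = "{- x $ j <..}"])
      show "F (?l u) * (c * ?R u) = H (?l u)" if "u \<in> {- x $ j <..}" for u
        using wR[of u] that unfolding H_def lj by (simp del: power_Suc)
    qed (use True in auto)
  qed
  then show "\<exists>S. finite S \<and> (\<forall>t. t \<notin> S \<longrightarrow> ((\<lambda>t. H (?l t)) has_real_derivative H' (?l t)) (at t))"
    by (intro exI[of _ ?S]) auto
qed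

text \<open>The field has jth component l j ^ (k + 1). After doubling, the powers of the coordinates
  contribute 2 (k + 1 + \<alpha>) p k, and the Vandermonde factor contributes the sum of p r p (k -
  r) over r = 1..k plus (N - k - 1) p k; the coefficient of p k is therefore k + 2 \<alpha> + N +
  1.\<close>

theorem loop_equation_wishart_weight:
  assumes s: "s > 0" and \<alpha>: "\<alpha> \<ge> 0"
  shows "s * (\<integral>l. psum l (Suc k) * prod_list (map (psum l) ks) * wishart_weight \<alpha> s l \<partial>(lborel::(real^('n::{finite,linorder})) measure))
    = (\<integral>l. loop_term (2 * \<alpha> + real CARD('n) + 1) (psum l) k ks * wishart_weight \<alpha> s l \<partial>(lborel::(real^('n::{finite,linorder})) measure))"
proof -
  define F where "F = (\<lambda>l::(real,'n) vec. prod_list (map (psum l) ks))"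
  define w where "w = (wishart_weight \<alpha> s :: (real,'n) vec \<Rightarrow> real)"
  define DF where "DF = (\<lambda>j (l::(real,'n) vec). dmon (psum l) (\<lambda>m. real m * l $ j ^ (m - 1)) ks)"
  define H' where "H' = (\<lambda>j l. (DF j l + F l * ((real k + 1 + \<alpha>) / l $ j + vandermonde_log_derivative j l - s / 2))
            * (l $ j ^ Suc k * w l))"
  have pF: "real_polynomial_function F"
    unfolding F_def by (intro real_polynomial_function_prod_list real_polynomial_function_psum)
  have pDF: "real_polynomial_function (DF j)" for j
    unfolding DF_def by (rule real_polynomial_function_dmon_psum)
  have pp: "real_polynomial_function (\<lambda>l::(real,'n) vec. l $ j ^ i)" for i j
    by (intro real_polynomial_function_power real_polynomial_function_vec_nth)
  \<comment> \<open>The quotient by l j is cancelled against the power k + 1; at l j = 0 both sides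
    vanish with the weight. In this form each summand is integrable.\<close>
  have H'_eq: "H' j l = DF j l * l $ j ^ Suc k * w l + F l * ((real k + 1 + \<alpha>) * l $ j ^ k) * w l
      + F l * l $ j ^ Suc k * vandermonde_log_derivative j l * w l - F l * (s / 2 * l $ j ^ Suc k) * w l" for j l
  proof (cases "l $ j = 0")
    case True
    then have "w l = 0" unfolding w_def wishart_weight_def
      by (metis (no_types, lifting) indicator_simps(2) less_irrefl mem_Collect_eq mult_zero_left)
    then show ?thesis by (simp add: H'_def)
  next
    case False
    then show ?thesis by (simp add: H'_def field_simps)
  qed
  have intH': "integrable lborel (H' j)" for j
  proof -
    have "integrable lborel (\<lambda>l. DF j l * l $ j ^ Suc k * w l + F l * ((real k + 1 + \<alpha>) * l $ j ^ k) * w l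
      + F l * l $ j ^ Suc k * vandermonde_log_derivative j l * w l - F l * (s / 2 * l $ j ^ Suc k) * w l)"
      unfolding w_def
      by (intro Bochner_Integration.integrable_add Bochner_Integration.integrable_diff
          integrable_polynomial_wishart_weight[OF _ s \<alpha>] real_polynomial_function.intros(4) real_polynomial_function.intros(2) pF pDF pp)
    then show ?thesis by (simp add: H'_eq[abs_def])
  qed
  have zero: "(\<integral>l. H' j l \<partial>lborel) = 0" for j
  proof (rule integral_directional_derivative_eq_0[where H = "\<lambda>l. F l * (l $ j ^ Suc k * w l)" and b = "axis j 1"])
    have "integrable lborel (\<lambda>l. F l * l $ j ^ Suc k * w l)"
      unfolding w_def by (intro integrable_polynomial_wishart_weight[OF _ s \<alpha>] real_polynomial_function.intros(4) pF pp)
    then show "integrable lborel (\<lambda>l. F l * (l $ j ^ Suc k * w l))" by (simp only: mult.assoc)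
    have d: "((\<lambda>t. F (x + t *\<^sub>R axis j 1)) has_real_derivative DF j (x + t *\<^sub>R axis j 1)) (at t)" for x t
      unfolding F_def DF_def by (rule monomial_psum_has_real_derivative)
    note wl = weighted_power_line[OF \<alpha> d, where k = k and s = s]
    show "continuous_on UNIV (\<lambda>t. F (x + t *\<^sub>R axis j 1) * ((x + t *\<^sub>R axis j 1) $ j ^ Suc k * w (x + t *\<^sub>R axis j 1)))" for x
      using wl(1)[of x] by (simp only: w_def)
    show "\<exists>S. finite S \<and> (\<forall>t. t \<notin> S \<longrightarrow>
        ((\<lambda>t. F (x + t *\<^sub>R axis j 1) * ((x + t *\<^sub>R axis j 1) $ j ^ Suc k * w (x + t *\<^sub>R axis j 1))) has_real_derivative
        H' j (x + t *\<^sub>R axis j 1)) (at t))" for x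
      using wl(2)[of x] by (simp only: w_def H'_def)
  qed (rule intH')
  have "0 = (\<Sum>j\<in>UNIV. \<integral>l. H' j l \<partial>lborel)" by (simp add: zero)
  also have "\<dots> = (\<integral>l. (\<Sum>j\<in>UNIV. H' j l) \<partial>lborel)" by (simp add: intH')
  also have "\<dots> = (\<integral>l. (loop_term (2 * \<alpha> + real CARD('n) + 1) (psum l) k ks * w l - s * (psum l (Suc k) * F l * w l)) / 2 \<partial>lborel)"
  proof (intro arg_cong[where f = "integral\<^sup>L lborel"] ext)
    fix l :: "(real,'n) vec"
    show "(\<Sum>j\<in>UNIV. H' j l) = (loop_term (2 * \<alpha> + real CARD('n) + 1) (psum l) k ks * w l - s * (psum l (Suc k) * F l * w l)) / 2"
    proof (cases "\<forall>a b. a \<noteq> b \<longrightarrow> l $ a \<noteq> l $ b")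
      case False
      then obtain a b where "a \<noteq> b" "l $ a = l $ b" by blast
      then have "w l = 0" unfolding w_def wishart_weight_def by (simp add: abs_vandermonde_eq_0)
      then show ?thesis by (simp add: H'_def)
    next
      case True
      define V where "V = (\<Sum>(a, b)\<in>{(a, b). a < b}. \<Sum>r\<le>k. l $ b ^ r * l $ a ^ (k - r))"
      have 1: "(\<Sum>j\<in>UNIV. l $ j ^ Suc k * DF j l) = euler_term (psum l) k ks"
        unfolding DF_def by (rule sum_power_dmon_psum)
      have 2: "(\<Sum>j\<in>UNIV. l $ j ^ Suc k * vandermonde_log_derivative j l) = V"
        unfolding V_def using True by (intro sum_power_vandermonde_log_derivative) blast
      have 3: "2 * V = (\<Sum>r=1..k. psum l r * psum l (k - r)) + real CARD('n) * psum l k - (real k + 1) * psum l k"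
      proof -
        have "{..k} = insert 0 {1..k}" by auto
        then have "(\<Sum>r\<le>k. psum l r * psum l (k - r)) = real CARD('n) * psum l k + (\<Sum>r=1..k. psum l r * psum l (k - r))"
          by (simp add: psum_def)
        then show ?thesis using power_sum_product[where l = l and k = k] unfolding V_def by linarith
      qed
      have "(\<Sum>j\<in>UNIV. H' j l) = ((\<Sum>j\<in>UNIV. l $ j ^ Suc k * DF j l) + F l * (real k + 1 + \<alpha>) * (\<Sum>j\<in>UNIV. l $ j ^ k)
         + F l * (\<Sum>j\<in>UNIV. l $ j ^ Suc k * vandermonde_log_derivative j l) - F l * (s / 2) * (\<Sum>j\<in>UNIV. l $ j ^ Suc k)) * w l"
        unfolding H'_eq by (simp add: sum.distrib sum_subtractf sum_distrib_left sum_distrib_right algebra_simps)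
      also have "\<dots> = (euler_term (psum l) k ks + F l * (real k + 1 + \<alpha>) * psum l k + F l * V - F l * (s / 2) * psum l (Suc k)) * w l"
        unfolding 1 2 psum_def[symmetric] ..
      also have "\<dots> = ((2 * euler_term (psum l) k ks + 2 * (F l * (real k + 1 + \<alpha>) * psum l k) + F l * (2 * V) - s * (psum l (Suc k) * F l)) * w l) / 2"
        by (simp add: field_simps)
      also have "\<dots> = (loop_term (2 * \<alpha> + real CARD('n) + 1) (psum l) k ks * w l - s * (psum l (Suc k) * F l * w l)) / 2"
        unfolding 3 loop_term_def F_def by (simp add: algebra_simps sum_distrib_left sum_distrib_right)
      finally show ?thesis .
    qed
  qed
  also have "\<dots> = ((\<integral>l. loop_term (2 * \<alpha> + real CARD('n) + 1) (psum l) k ks * w l \<partial>lborel) - s * (\<integral>l. psum l (Suc k) * F l * w l \<partial>lborel)) / 2"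
  proof -
    have "integrable lborel (\<lambda>l. loop_term (2 * \<alpha> + real CARD('n) + 1) (psum l) k ks * w l)"
      unfolding w_def by (intro integrable_polynomial_wishart_weight[OF _ s \<alpha>] real_polynomial_function_loop_term real_polynomial_function_psum)
    moreover have "integrable lborel (\<lambda>l. s * (psum l (Suc k) * F l * w l))"
      unfolding w_def by (intro integrable_mult_right integrable_polynomial_wishart_weight[OF _ s \<alpha>] real_polynomial_function.intros(4) real_polynomial_function_psum pF)
    ultimately show ?thesis by simp
  qed
  finally show ?thesis by (simp add: F_def w_def)
qed

section \<open>Determination of the law by its moments\<close>

text \<open>\<open>formal_euler m k js ks\<close> is what a linear functional with moments \<open>m\<close> assigns to
  \<open>prod_list (map p js) * euler_term p k ks\<close>.\<close>
fun formal_euler :: "(nat list \<Rightarrow> real) \<Rightarrow> nat \<Rightarrow> nat list \<Rightarrow> nat list \<Rightarrow> real" where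
  "formal_euler m k pre [] = 0"
| "formal_euler m k pre (j # js) = real j * m ((k + j) # pre @ js) + formal_euler m k (pre @ [j]) js"

definition formal_loop :: "real \<Rightarrow> (nat list \<Rightarrow> real) \<Rightarrow> nat \<Rightarrow> nat list \<Rightarrow> real" where
  "formal_loop c m k ks = (real k + c) * m (k # ks) + (\<Sum>r=1..k. m (r # (k - r) # ks)) + 2 * formal_euler m k [] ks"

text \<open>Loop equations become identities between moments, free of the underlying space, so that
  matrices and eigenvalues can be compared by one induction.\<close>

lemma integral_loop_term:
  fixes p :: "'a \<Rightarrow> nat \<Rightarrow> real" and w :: "'a \<Rightarrow> real"
  assumes int: "\<And>ks. integrable M (\<lambda>x. prod_list (map (p x) ks) * w x)"
  defines "m \<equiv> \<lambda>ks. \<integral>x. prod_list (map (p x) ks) * w x \<partial>M"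
  shows "(\<integral>x. loop_term c (p x) k ks * w x \<partial>M) = formal_loop c m k ks"
proof -
  \<comment> \<open>The accumulator \<open>pre\<close> holds the factors already passed by the
    Leibniz rule.\<close>
  have e: "has_bochner_integral M (\<lambda>x. prod_list (map (p x) pre) * euler_term (p x) k js * w x) (formal_euler m k pre js)" for pre js
  proof (induction js arbitrary: pre)
    case (Cons j js)
    have 1: "has_bochner_integral M (\<lambda>x. real j * (prod_list (map (p x) ((k + j) # pre @ js)) * w x)) (real j * m ((k + j) # pre @ js))"
      unfolding m_def by (intro has_bochner_integral_mult_right has_bochner_integral_integrable int)
    have eq: "(\<lambda>x. prod_list (map (p x) pre) * euler_term (p x) k (j # js) * w x) =
      (\<lambda>x. real j * (prod_list (map (p x) ((k + j) # pre @ js)) * w x) + prod_list (map (p x) (pre @ [j])) * euler_term (p x) k js * w x)"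
      by (simp add: fun_eq_iff algebra_simps)
    show ?case unfolding eq formal_euler.simps by (intro has_bochner_integral_add 1 Cons.IH)
  qed (simp add: has_bochner_integral_zero)
  have "has_bochner_integral M (\<lambda>x. (real k + c) * (prod_list (map (p x) (k # ks)) * w x)
     + (\<Sum>r=1..k. prod_list (map (p x) (r # (k - r) # ks)) * w x) + 2 * (prod_list (map (p x) []) * euler_term (p x) k ks * w x)) (formal_loop c m k ks)"
    unfolding formal_loop_def
    by (intro has_bochner_integral_add has_bochner_integral_mult_right has_bochner_integral_sum e)
       (auto simp: m_def simp del: list.map prod_list.Cons intro!: has_bochner_integral_integrable int)
  moreover have "(real k + c) * (prod_list (map (p x) (k # ks)) * w x)
     + (\<Sum>r=1..k. prod_list (map (p x) (r # (k - r) # ks)) * w x) + 2 * (prod_list (map (p x) []) * euler_term (p x) k ks * w x)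
     = loop_term c (p x) k ks * w x" for x
    by (simp add: loop_term_def algebra_simps sum_distrib_left sum_distrib_right)
  ultimately show ?thesis by (simp add: has_bochner_integral_integral_eq)
qed

text \<open>Every moment occurring here has total degree k + sum_list pre + sum_list js, so
  proportionality in that one degree suffices.\<close>

lemma formal_euler_proportional:
  assumes "\<And>ks. sum_list ks = k + sum_list pre + sum_list js \<Longrightarrow> m1 ks * c2 = m2 ks * c1"
  shows "formal_euler m1 k pre js * c2 = formal_euler m2 k pre js * c1"
  using assms
proof (induction js arbitrary: pre)
  case (Cons j js)
  have "m1 ((k + j) # pre @ js) * c2 = m2 ((k + j) # pre @ js) * c1"
    by (rule Cons.prems) simp
  moreover have "formal_euler m1 k (pre @ [j]) js * c2 = formal_euler m2 k (pre @ [j]) js * c1"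
    by (rule Cons.IH, rule Cons.prems) simp
  ultimately show ?case by (simp add: distrib_right mult.assoc)
qed simp

text \<open>Every moment is expressed through moments of smaller total degree.\<close>
lemma loop_equations_determine_moments:
  assumes s: "s \<noteq> 0"
    and loop1: "\<And>k ks. s * m1 (Suc k # ks) = formal_loop c m1 k ks" and zero1: "\<And>ks. m1 (0 # ks) = n * m1 ks"
    and loop2: "\<And>k ks. s * m2 (Suc k # ks) = formal_loop c m2 k ks" and zero2: "\<And>ks. m2 (0 # ks) = n * m2 ks"
  shows "m1 ks * m2 [] = m2 ks * m1 []"
\<comment> \<open>The degree does not drop when a leading index 0 is stripped, so ties are broken by
  length.\<close>
proof (induction ks rule: wf_induct[of "measures [sum_list, length]"])
  case 1 show ?case by simp
next
  case (2 ks)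
  then have IH: "sum_list js < sum_list ks \<or> sum_list js = sum_list ks \<and> length js < length ks
     \<Longrightarrow> m1 js * m2 [] = m2 js * m1 []" for js by auto
  show ?case
  proof (cases ks)
    case (Cons j js)
    show ?thesis
    proof (cases j)
      case 0
      then have "m1 js * m2 [] = m2 js * m1 []" by (intro IH) (simp add: Cons)
      then show ?thesis by (simp add: Cons 0 zero1 zero2)
    next
      case (Suc k)
      have S: "(\<Sum>r=1..k. m1 (r # (k - r) # js)) * m2 [] = (\<Sum>r=1..k. m2 (r # (k - r) # js)) * m1 []"
        unfolding sum_distrib_right by (intro sum.cong IH) (auto simp: Cons Suc)
      have K: "m1 (k # js) * m2 [] = m2 (k # js) * m1 []" by (intro IH) (auto simp: Cons Suc)
      have E: "formal_euler m1 k [] js * m2 [] = formal_euler m2 k [] js * m1 []"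
        by (intro formal_euler_proportional IH) (auto simp: Cons Suc)
      have "formal_loop c m1 k js * m2 [] = (real k + c) * (m1 (k # js) * m2 []) + (\<Sum>r=1..k. m1 (r # (k - r) # js)) * m2 []
          + 2 * (formal_euler m1 k [] js * m2 [])"
        by (simp add: formal_loop_def distrib_right)
      also have "\<dots> = formal_loop c m2 k js * m1 []"
        unfolding S K E by (simp add: formal_loop_def distrib_right)
      finally have "s * m1 (Suc k # js) * m2 [] = s * m2 (Suc k # js) * m1 []" by (simp add: loop1 loop2)
      then show ?thesis using s by (simp add: Cons Suc)
    qed
  qed simp
qed

section \<open>From polynomial moments to measures\<close>

text \<open>Stone-Weierstrass passes from polynomials to continuous functions, the cutoffs
  \<open>max 0 (1 - n * infdist x D)\<close> decrease to the indicator of a closed set D, and the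
  closed sets generate the Borel sets and are stable under intersection.\<close>

lemma finite_measures_eq_if_polynomial_moments_eq:
  fixes \<mu> \<nu> :: "'a::euclidean_space measure"
  assumes fin: "finite_measure \<mu>" "finite_measure \<nu>"
    and sets: "sets \<mu> = sets borel" "sets \<nu> = sets borel"
    and K: "compact K" "AE x in \<mu>. x \<in> K" "AE x in \<nu>. x \<in> K"
    and poly: "\<And>f. real_polynomial_function f \<Longrightarrow> (\<integral>x. f x \<partial>\<mu>) = (\<integral>x. f x \<partial>\<nu>)"
  shows "\<mu> = \<nu>"
proof -
  note sets[measurable_cong]
  have space: "space \<mu> = UNIV" "space \<nu> = UNIV" using sets sets_eq_imp_space_eq by (metis space_borel)+
  have int: "integrable M f" if cf: "continuous_on UNIV f" and M: "finite_measure M" "sets M = sets borel" "AE x in M. x \<in> K"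
    for f :: "'a \<Rightarrow> real" and M
  proof -
    have "compact (f ` K)" using cf K(1) compact_continuous_image continuous_on_subset by blast
    then obtain B where B: "\<And>x. x \<in> K \<Longrightarrow> norm (f x) \<le> B"
      using compact_imp_bounded bounded_iff by (metis imageI)
    have "f \<in> borel_measurable M" using borel_measurable_continuous_onI[OF cf] M(2) measurable_cong_sets by blast
    moreover have "AE x in M. norm (f x) \<le> B" using M(3) by eventually_elim (rule B)
    ultimately show ?thesis
      using finite_measure.integrable_const_bound[OF M(1), of f B] by blast
  qed
  have cont_eq: "(\<integral>x. f x \<partial>\<mu>) = (\<integral>x. f x \<partial>\<nu>)" if cf: "continuous_on UNIV f" for f :: "'a \<Rightarrow> real"
  proof -
    define C where "C = measure \<mu> UNIV + measure \<nu> UNIV"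
    have "C \<ge> 0" by (simp add: C_def)
    have le: "\<bar>(\<integral>x. f x \<partial>\<mu>) - (\<integral>x. f x \<partial>\<nu>)\<bar> \<le> e * C" if "e > 0" for e
    proof -
      obtain g where g: "real_polynomial_function g" "\<And>x. x \<in> K \<Longrightarrow> \<bar>f x - g x\<bar> < e"
        using Stone_Weierstrass_real_polynomial_function[OF K(1) continuous_on_subset[OF cf] \<open>e > 0\<close>] by auto
      have cg: "continuous_on UNIV g"
        using g(1) by (simp add: continuous_on_polymonial_function real_polynomial_function_eq)
      have b: "\<bar>(\<integral>x. f x \<partial>M) - (\<integral>x. g x \<partial>M)\<bar> \<le> e * measure M UNIV"
        if M: "finite_measure M" "sets M = sets borel" "AE x in M. x \<in> K" "space M = UNIV" for M
      proof -
        have "\<bar>\<integral>x. f x - g x \<partial>M\<bar> \<le> (\<integral>x. \<bar>f x - g x\<bar> \<partial>M)" by (rule integral_abs_bound)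
        also have "\<dots> \<le> (\<integral>x. e \<partial>M)"
        proof (rule integral_mono_AE)
          show "integrable M (\<lambda>x. \<bar>f x - g x\<bar>)"
            by (intro int[OF _ M(1-3)] continuous_intros cf cg)
          show "integrable M (\<lambda>x. e)" using finite_measure.integrable_const[OF M(1)] by blast
          show "AE x in M. \<bar>f x - g x\<bar> \<le> e" using M(3) by eventually_elim (simp add: g(2) less_imp_le)
        qed
        also have "\<dots> = e * measure M UNIV" by (simp add: M(4))
        finally show ?thesis
          using int[OF cf M(1-3)] int[OF cg M(1-3)] by simp
      qed
      show ?thesis
        using b[OF fin(1) sets(1) K(2) space(1)] b[OF fin(2) sets(2) K(3) space(2)] poly[OF g(1)]
        by (simp add: C_def distrib_left)
    qed
    have "\<bar>(\<integral>x. f x \<partial>\<mu>) - (\<integral>x. f x \<partial>\<nu>)\<bar> \<le> 0"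
    proof (rule field_le_epsilon)
      fix e :: real assume "e > 0"
      have "\<bar>(\<integral>x. f x \<partial>\<mu>) - (\<integral>x. f x \<partial>\<nu>)\<bar> \<le> e / (C + 1) * C"
        using le[of "e / (C + 1)"] \<open>e > 0\<close> \<open>C \<ge> 0\<close> by simp
      also have "\<dots> \<le> e" using \<open>e > 0\<close> \<open>C \<ge> 0\<close> by (simp add: field_simps)
      finally show "\<bar>(\<integral>x. f x \<partial>\<mu>) - (\<integral>x. f x \<partial>\<nu>)\<bar> \<le> 0 + e" by simp
    qed
    then show ?thesis by simp
  qed
  have closed_eq: "measure \<mu> D = measure \<nu> D" if D: "closed D" for D
  proof (cases "D = {}")
    case False
    define f where "f = (\<lambda>n::nat. \<lambda>x. max 0 (1 - real n * infdist x D))"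
    have cf: "continuous_on UNIV (f n)" for n unfolding f_def by (intro continuous_intros)
    have lim: "(\<lambda>n. f n x) \<longlonglongrightarrow> indicator D x" for x
    proof (cases "x \<in> D")
      case True
      then show ?thesis by (simp add: f_def)
    next
      case False
      then have p: "infdist x D > 0" using in_closed_iff_infdist_zero[OF D \<open>D \<noteq> {}\<close>] infdist_nonneg[of x D]
        by (metis less_le)
      obtain n0 where n0: "1 < real n0 * infdist x D" using reals_Archimedean3[OF p] by blast
      have "eventually (\<lambda>n. f n x = 0) sequentially"
        unfolding eventually_sequentially
      proof (intro exI allI impI)
        fix n assume "n \<ge> n0"
        then have "real n0 * infdist x D \<le> real n * infdist x D" using p by (intro mult_right_mono) auto
        then show "f n x = 0" using n0 by (simp add: f_def)
      qed
      then show ?thesis using False by (simp add: tendsto_eventually)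
    qed
    have l: "(\<lambda>n. \<integral>x. f n x \<partial>M) \<longlonglongrightarrow> measure M D"
      if M: "finite_measure M" "sets M = sets borel" "space M = UNIV" for M
    proof -
      have [measurable]: "f n \<in> borel_measurable M" for n
        using borel_measurable_continuous_onI[OF cf] M(2) measurable_cong_sets by blast
      have DM[measurable]: "D \<in> sets M" using D M(2) by (simp add: borel_closed)
      have "(\<lambda>n. \<integral>x. f n x \<partial>M) \<longlonglongrightarrow> (\<integral>x. indicator D x \<partial>M)"
      proof (rule integral_dominated_convergence[where w = "\<lambda>_. 1"])
        show "integrable M (\<lambda>_. 1::real)" using finite_measure.integrable_const[OF M(1)] by blast
        show "AE x in M. norm (f n x) \<le> 1" for n
          using infdist_nonneg[of _ D] by (auto simp: f_def)
      qed (use lim in auto)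
      then show ?thesis using DM M(3) by simp
    qed
    show ?thesis
      using LIMSEQ_unique[OF l[OF fin(1) sets(1) space(1)]] l[OF fin(2) sets(2) space(2)] cont_eq[OF cf] by simp
  qed simp
  show ?thesis
  proof (rule measure_eqI_generator_eq[where E = "Collect closed" and \<Omega> = UNIV and A = "\<lambda>_. UNIV"])
    show "Int_stable (Collect (closed :: 'a set \<Rightarrow> bool))" by (auto simp: Int_stable_def)
    fix X :: "'a set" assume "X \<in> Collect closed"
    then show "emeasure \<mu> X = emeasure \<nu> X"
      using closed_eq[of X] finite_measure.emeasure_eq_measure[OF fin(1)] finite_measure.emeasure_eq_measure[OF fin(2)] by simp
  next
    show "sets \<mu> = sigma_sets UNIV (Collect closed)" using sets(1) by (simp add: borel_eq_closed)
    show "sets \<nu> = sigma_sets UNIV (Collect closed)" using sets(2) by (simp add: borel_eq_closed)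
    show "emeasure \<mu> UNIV \<noteq> \<infinity>" using finite_measure.emeasure_finite[OF fin(1), of UNIV] by simp
  qed auto
qed

text \<open>Monomials are kept as lists of coordinates: such a list, read in the coordinates of
  \<open>phi\<close>, is directly a list of power sum indices to which the moment statements
  apply.\<close>

lemma real_polynomial_function_monomials:
  fixes f :: "real^'k \<Rightarrow> real"
  assumes "real_polynomial_function f"
  obtains ts :: "(real \<times> 'k list) list" where "\<And>x. f x = (\<Sum>(c, bs)\<leftarrow>ts. c * prod_list (map (($) x) bs))"
proof -
  have "\<exists>ts :: (real \<times> 'k list) list. \<forall>x. f x = (\<Sum>(c, bs)\<leftarrow>ts. c * prod_list (map (($) x) bs))"
    using assms
  proof induction
    case (linear f)
    obtain xs where xs: "set xs = (UNIV :: 'k set)" "distinct xs" using finite_distinct_list[of "UNIV :: 'k set"] by auto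
    have "f x = (\<Sum>(c, bs)\<leftarrow>map (\<lambda>b. (f (axis b 1), [b])) xs. c * prod_list (map (($) x) bs))" for x
    proof -
      have "f x = f (\<Sum>b\<in>UNIV. x $ b *\<^sub>R axis b 1)" using basis_expansion[of x] by (simp add: scalar_mult_eq_scaleR)
      also have "\<dots> = (\<Sum>b\<in>UNIV. f (axis b 1) * x $ b)"
        using linear by (simp add: bounded_linear.linear linear_sum linear_scale mult.commute)
      also have "\<dots> = (\<Sum>b\<leftarrow>xs. f (axis b 1) * x $ b)"
        using xs by (metis sum_list_distinct_conv_sum_set)
      finally show ?thesis by (simp add: o_def)
    qed
    then show ?case by blast
  next
    case (const c)
    show ?case by (intro exI[of _ "[(c, [])]"]) simp
  next
    case (add f g)
    then obtain ts us where "\<forall>x. f x = (\<Sum>(c, bs)\<leftarrow>ts. c * prod_list (map (($) x) bs))"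
      "\<forall>x. g x = (\<Sum>(c, bs)\<leftarrow>us. c * prod_list (map (($) x) bs))" by blast
    then show ?case by (intro exI[of _ "ts @ us"]) simp
  next
    case (mult f g)
    then obtain ts us where tu: "\<forall>x. f x = (\<Sum>(c, bs)\<leftarrow>ts. c * prod_list (map (($) x) bs))"
      "\<forall>x. g x = (\<Sum>(c, bs)\<leftarrow>us. c * prod_list (map (($) x) bs))" by blast
    have 1: "(\<Sum>(d, cs)\<leftarrow>map (\<lambda>(d, cs). (c * d, bs @ cs)) us. d * prod_list (map (($) x) cs)) =
        c * prod_list (map (($) x) bs) * (\<Sum>(d, cs)\<leftarrow>us. d * prod_list (map (($) x) cs))" for c bs x
      by (induction us) (auto simp: algebra_simps)
    have 2: "(\<Sum>(d, cs)\<leftarrow>concat (map (\<lambda>(c, bs). map (\<lambda>(d, cs). (c * d, bs @ cs)) us) ts). d * prod_list (map (($) x) cs)) =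
        (\<Sum>(c, bs)\<leftarrow>ts. c * prod_list (map (($) x) bs)) * (\<Sum>(d, cs)\<leftarrow>us. d * prod_list (map (($) x) cs))" for x
    proof (induction ts)
      case (Cons a ts)
      obtain c bs where a: "a = (c, bs)" by fastforce
      show ?case unfolding a using Cons 1[of x c bs] by (simp add: distrib_right)
    qed simp
    show ?case using tu 2 by (intro exI[of _ "concat (map (\<lambda>(c, bs). map (\<lambda>(d, cs). (c * d, bs @ cs)) us) ts)"]) simp
  qed
  then show thesis using that by blast
qed

section \<open>A fundamental domain for permutations of the coordinates\<close>

text \<open>Each orbit under permutations meets this set in exactly one point, and the set is
  closed, as \<open>borel_factorization\<close> requires.\<close>

definition chamber :: "(real^('n::{finite,linorder})) set" where
  "chamber = {l. \<forall>i j. i \<le> j \<longrightarrow> l $ i \<le> l $ j}"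

lemma closed_chamber: "closed (chamber :: (real^('n::{finite,linorder})) set)"
proof -
  have "chamber = (\<Inter>i::'n. \<Inter>j\<in>{j. i \<le> j}. {l. l $ i \<le> l $ j})" by (auto simp: chamber_def)
  moreover have "closed (\<Inter>i::'n. \<Inter>j\<in>{j. i \<le> j}. {l::(real,'n) vec. l $ i \<le> l $ j})"
    by (intro closed_INT ballI closed_Collect_le continuous_intros)
  ultimately show ?thesis by simp
qed

text \<open>Listed in index order, the coordinates of both vectors form sorted lists with the same
  multiset, and such lists coincide.\<close>

lemma chamber_permutation_unique:
  assumes "l \<in> chamber" "m \<in> chamber" "p permutes UNIV" "m = (\<chi> i. l $ p i)"
  shows "l = m"
proof -
  let ?xs = "sorted_list_of_set (UNIV :: 'a set)"
  have s: "sorted (map (($) l) ?xs)" if "l \<in> chamber" for l :: "(real, 'a) vec"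
    using that sorted_sorted_list_of_set[of "UNIV :: 'a set"]
    by (simp add: sorted_map chamber_def sorted_wrt_mono_rel[of ?xs "(\<le>)"])
  have mx: "mset ?xs = mset_set UNIV" using mset_set_set[of ?xs] by simp
  have "image_mset (($) m) (mset_set UNIV) = image_mset (\<lambda>i. l $ p i) (mset_set UNIV)"
    by (rule image_mset_cong) (simp add: assms(4))
  also have "\<dots> = image_mset (($) l) (image_mset p (mset_set UNIV))"
    by (simp add: image_mset.compositionality o_def)
  also have "image_mset p (mset_set UNIV) = mset_set UNIV"
    using assms(3) by (simp add: image_mset_mset_set permutes_inj permutes_surj)
  finally have "mset (map (($) m) ?xs) = mset (map (($) l) ?xs)" by (simp add: mx)
  then have "map (($) m) ?xs = map (($) l) ?xs"
    using s[OF assms(1)] s[OF assms(2)] by (metis properties_for_sort)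
  then show ?thesis by (simp add: vec_eq_iff)
qed

lemma chamber_permutation_exists:
  fixes l :: "real^('n::{finite,linorder})"
  obtains p where "p permutes (UNIV :: 'n set)" "(\<chi> i. l $ p i) \<in> chamber"
proof -
  let ?xs = "sorted_list_of_set (UNIV :: 'n set)"
  define ys where "ys = sort (map (($) l) ?xs)"
  define m where "m = (\<chi> i::'n. the (map_of (zip ?xs ys) i))"
  have len: "length ?xs = length ys" by (simp add: ys_def)
  have mn: "m $ (?xs ! k) = ys ! k" if "k < length ?xs" for k
    using that len by (simp add: m_def map_of_zip_nth)
  have "map (($) m) ?xs = ys" using len mn by (intro nth_equalityI) auto
  then have "mset (map (($) m) ?xs) = mset (map (($) l) ?xs)" by (simp add: ys_def)
  moreover have "mset ?xs = mset_set UNIV" using mset_set_set[of ?xs] by simp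
  ultimately have "image_mset (($) m) (mset_set UNIV) = image_mset (($) l) (mset_set UNIV)" by simp
  from image_mset_eq_implies_permutes[OF _ this] obtain p
    where p: "p permutes (UNIV::'n set)" "\<forall>x\<in>UNIV. m $ x = l $ p x" by auto
  have "m $ i \<le> m $ j" if "i \<le> j" for i j
  proof -
    obtain a where a: "a < length ?xs" "?xs ! a = i" by (metis UNIV_I finite in_set_conv_nth set_sorted_list_of_set)
    obtain b where b: "b < length ?xs" "?xs ! b = j" by (metis UNIV_I finite in_set_conv_nth set_sorted_list_of_set)
    have "a \<le> b"
    proof (rule ccontr)
      assume "\<not> a \<le> b"
      then have "?xs ! b < ?xs ! a"
        using a(1) strict_sorted_list_of_set[of "UNIV :: 'n set"] by (simp add: sorted_wrt_nth_less)
      then show False using that a b by simp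
    qed
    then have "ys ! a \<le> ys ! b" using b(1) len by (intro sorted_nth_mono) (auto simp: ys_def)
    then show ?thesis using mn[OF a(1)] mn[OF b(1)] a b by simp
  qed
  then have "m \<in> chamber" by (simp add: chamber_def)
  moreover have "m = (\<chi> i. l $ p i)" using p(2) by (simp add: vec_eq_iff)
  ultimately show thesis using that p(1) by simp
qed

text \<open>A closed set is a countable union of compact sets, so the inverse of an injective continuous
  map on it pulls closed sets back to \<open>F\<^sub>\<sigma>\<close> sets.\<close>
lemma borel_factorization:
  fixes \<Phi> :: "'a::euclidean_space \<Rightarrow> 'b::euclidean_space" and f :: "'a \<Rightarrow> ennreal"
  assumes cont: "continuous_on UNIV \<Phi>" and C: "closed C" "inj_on \<Phi> C" and f[measurable]: "f \<in> borel_measurable borel"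
  obtains g where "g \<in> borel_measurable borel" "\<And>x. x \<in> C \<Longrightarrow> f x = g (\<Phi> x)"
proof -
  have img: "\<Phi> ` (C \<inter> D) \<in> sets borel" if "closed D" for D
  proof -
    have "\<Phi> ` (C \<inter> D) = (\<Union>n::nat. \<Phi> ` (C \<inter> D \<inter> cball 0 (real n)))"
    proof safe
      fix x assume "x \<in> C" "x \<in> D"
      moreover obtain n :: nat where "norm x \<le> real n" using real_arch_simple by blast
      ultimately show "\<Phi> x \<in> (\<Union>n::nat. \<Phi> ` (C \<inter> D \<inter> cball 0 (real n)))" by (intro UN_I[of n]) auto
    qed auto
    moreover have "compact (C \<inter> D \<inter> cball 0 (real n))" for n
      using C(1) that by (intro closed_Int_compact closed_Int) auto
    then have "closed (\<Phi> ` (C \<inter> D \<inter> cball 0 (real n)))" for n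
      using cont by (meson compact_continuous_image compact_imp_closed continuous_on_subset subset_UNIV)
    ultimately show ?thesis by auto
  qed
  \<comment> \<open>A left inverse of \<open>\<Phi>\<close> on C, set to 0 off the image of C; hence
    the extra piece in the preimage of D when 0 lies in D.\<close>
  define \<sigma> where "\<sigma> = (\<lambda>y. if y \<in> \<Phi> ` C then the_inv_into C \<Phi> y else 0)"
  have "\<sigma> \<in> borel_measurable borel"
  proof (rule borel_measurableI)
    fix S :: "'a set" assume "open S"
    define D where "D = - S"
    have D: "closed D" using \<open>open S\<close> by (simp add: D_def closed_Compl)
    have "\<sigma> -` D = \<Phi> ` (C \<inter> D) \<union> (if 0 \<in> D then - \<Phi> ` (C \<inter> UNIV) else {})"
      using C(2) by (auto simp: \<sigma>_def the_inv_into_f_f image_iff split: if_splits) blast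
    moreover have "\<dots> \<in> sets borel" using img[OF D] img[of UNIV] by auto
    ultimately have "- (\<sigma> -` D) \<in> sets borel" by (metis borel_comp)
    moreover have "\<sigma> -` S \<inter> space borel = - (\<sigma> -` D)" by (auto simp: D_def)
    ultimately show "\<sigma> -` S \<inter> space borel \<in> sets borel" by metis
  qed
  note [measurable] = this
  show thesis
  proof (rule that)
    show "(\<lambda>y. f (\<sigma> y)) \<in> borel_measurable borel" by measurable
    show "f x = f (\<sigma> (\<Phi> x))" if "x \<in> C" for x using that C(2) by (simp add: \<sigma>_def the_inv_into_f_f)
  qed
qed

section \<open>The null eigenvalue law\<close>

lemma diag_mat_mult: "diag_mat l ** diag_mat m = diag_mat (\<chi> i. l $ i * m $ i)"
  by (simp add: diag_mat_def matrix_matrix_mult_def vec_eq_iff if_distrib[of "\<lambda>x. x * _"] cong: if_cong)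

lemma mpow_diagonalized:
  fixes Q :: "real^'n^'n"
  assumes Q: "orthogonal_matrix Q"
  shows "mpow (Q ** diag_mat l ** transpose Q) k = Q ** diag_mat (\<chi> i. l $ i ^ k) ** transpose Q"
proof (induction k)
  case 0
  have "diag_mat (\<chi> i. 1) = (mat 1 :: real^'n^'n)" by (simp add: diag_mat_def mat_def vec_eq_iff)
  then show ?case using Q by (simp add: orthogonal_matrix_def)
next
  case (Suc k)
  have "mpow (Q ** diag_mat l ** transpose Q) (Suc k) =
      Q ** diag_mat (\<chi> i. l $ i ^ k) ** (transpose Q ** Q) ** diag_mat l ** transpose Q"
    unfolding mpow.simps Suc.IH by (simp add: matrix_mul_assoc)
  also have "\<dots> = Q ** (diag_mat (\<chi> i. l $ i ^ k) ** diag_mat l) ** transpose Q"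
    using Q by (simp add: orthogonal_matrix_def matrix_mul_assoc)
  finally show ?case by (simp add: diag_mat_mult mult.commute)
qed

lemma trace_diagonalized:
  assumes Q: "orthogonal_matrix Q"
  shows "trace (Q ** diag_mat l ** transpose Q) = (\<Sum>i\<in>UNIV. l $ i)"
proof -
  have "trace (Q ** diag_mat l ** transpose Q) = trace (transpose Q ** (Q ** diag_mat l))"
    by (rule trace_mul_sym)
  also have "transpose Q ** (Q ** diag_mat l) = diag_mat l"
    using Q by (simp add: matrix_mul_assoc orthogonal_matrix_def)
  finally show ?thesis by (simp add: trace_def diag_mat_def)
qed

lemma inner_diagonalized:
  "u \<bullet> ((Q ** diag_mat l ** transpose Q) *v u) = (\<Sum>i\<in>UNIV. l $ i * (transpose Q *v u) $ i ^ 2)"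
proof -
  define y where "y = transpose Q *v u"
  have "(Q ** diag_mat l ** transpose Q) *v u = Q *v (diag_mat l *v y)"
    by (simp add: matrix_vector_mul_assoc matrix_mul_assoc y_def del: transpose_matrix_vector)
  then have "u \<bullet> ((Q ** diag_mat l ** transpose Q) *v u) = y \<bullet> (diag_mat l *v y)"
    unfolding y_def by (metis dot_lmul_matrix transpose_matrix_vector)
  also have "\<dots> = (\<Sum>i\<in>UNIV. l $ i * y $ i ^ 2)"
  proof -
    have "(diag_mat l *v y) $ i = l $ i * y $ i" for i
      by (simp add: diag_mat_def matrix_vector_mult_def if_distrib[of "\<lambda>x. x * _"] cong: if_cong)
    then show ?thesis by (simp add: inner_vec_def power2_eq_square mult_ac)
  qed
  finally show ?thesis by (simp add: y_def)
qed

text \<open>Bridge between the two descriptions of the power sums. An eigenvalue is the quadratic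
  form of \<open>gram X\<close> at a unit eigenvector u, that is, the squared norm of
  \<open>transpose X *v u\<close>, hence nonnegative.\<close>

lemma gram_diagonalization:
  fixes X :: "real^'m^'n"
  obtains Q l where "orthogonal_matrix Q" "gram X = Q ** diag_mat l ** transpose Q" "\<And>i. 0 \<le> l $ i" "\<And>k. ptr X k = psum l k"
proof -
  obtain Q l where Q: "orthogonal_matrix Q" and A: "gram X = Q ** diag_mat l ** transpose Q"
    using symmetric_matrix_diagonalizable[OF transpose_gram] by blast
  have "0 \<le> l $ i" for i
  proof -
    let ?u = "Q *v axis i 1"
    have "transpose Q *v ?u = axis i 1"
      using Q by (metis matrix_vector_mul_assoc matrix_vector_mul_lid orthogonal_matrix_def)
    then have "?u \<bullet> (gram X *v ?u) = (\<Sum>j\<in>UNIV. l $ j * (axis i 1 $ j) ^ 2)"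
      unfolding A inner_diagonalized by simp
    also have "\<dots> = l $ i" by (simp add: axis_def if_distrib[of "\<lambda>x. x ^ 2"] if_distrib[of "\<lambda>x. _ * x"] cong: if_cong)
    finally have "l $ i = ?u \<bullet> (gram X *v ?u)" by (rule sym)
    also have "gram X *v ?u = X *v (transpose X *v ?u)"
      by (simp only: gram_def matrix_vector_mul_assoc matrix_mul_assoc)
    also have "?u \<bullet> \<dots> = (transpose X *v ?u) \<bullet> (transpose X *v ?u)"
      by (metis dot_lmul_matrix transpose_matrix_vector)
    finally show ?thesis by simp
  qed
  moreover have "ptr X k = psum l k" for k
    by (simp add: ptr_def A mpow_diagonalized[OF Q] trace_diagonalized[OF Q] psum_def)
  ultimately show thesis using that Q A by blast
qed

text \<open>This identity lets a damping factor in p 1 be absorbed into the Gaussian weight.\<close>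

lemma ptr_1: "ptr X 1 = (norm X)\<^sup>2"
  using trace_mult_transpose[of X X]
  by (simp add: ptr_def gram_def power2_norm_eq_inner inner_vec_def)

lemma integral_lborel_scaleR:
  fixes f :: "'a::euclidean_space \<Rightarrow> real"
  assumes [measurable]: "f \<in> borel_measurable borel" and "c > 0"
  shows "(\<integral>x. f x \<partial>lborel) = c ^ DIM('a) * (\<integral>x. f (c *\<^sub>R x) \<partial>lborel)"
  by (subst lborel_affine[of c 0])
     (use \<open>c > 0\<close> in \<open>simp_all add: integral_density integral_distr\<close>)

lemma card_pairs_less: "2 * card {(a::'n::{finite,linorder}, b). a < b} + CARD('n) = CARD('n) * CARD('n)"
proof -
  let ?L = "{(a::'n, b). a < b}" and ?G = "{(a::'n, b). b < a}" and ?D = "{(a::'n, b). a = b}"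
  have "card ?G = card ?L" by (rule bij_betw_same_card[of prod.swap]) (auto simp: bij_betw_def inj_on_def image_iff)
  moreover have "card ?D = CARD('n)"
    by (rule bij_betw_same_card[of fst]) (auto simp: bij_betw_def inj_on_def image_iff)
  moreover have "CARD('n \<times> 'n) = card (?L \<union> (?G \<union> ?D))"
    by (rule arg_cong[where f = card]) auto
  moreover have "card (?L \<union> (?G \<union> ?D)) = card ?L + (card ?G + card ?D)"
    by (subst card_Un_disjoint; (subst card_Un_disjoint)?) auto
  ultimately show ?thesis by simp
qed

lemma abs_vandermonde_scaleR:
  fixes l :: "real^('n::{finite,linorder})"
  assumes "c > 0"
  shows "abs_vandermonde (c *\<^sub>R l) = c ^ card {(a::'n, b). a < b} * abs_vandermonde l"
proof -
  have "abs_vandermonde (c *\<^sub>R l) = (\<Prod>(a, b)\<in>{(a, b). a < b}. c * \<bar>l $ b - l $ a\<bar>)"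
    unfolding abs_vandermonde_def using assms
    by (intro prod.cong) (auto simp: abs_mult right_diff_distrib[symmetric])
  then show ?thesis by (simp add: abs_vandermonde_def split_beta prod.distrib)
qed

lemma wishart_weight_scaleR:
  fixes l :: "real^('n::{finite,linorder})"
  assumes c: "c > 0"
  shows "wishart_weight \<alpha> s (c *\<^sub>R l) = c ^ card {(a::'n, b). a < b} * (c powr \<alpha>) ^ CARD('n) * wishart_weight \<alpha> (s * c) l"
proof (cases "\<forall>i. 0 < l $ i")
  case True
  then have "(\<Prod>i\<in>UNIV. (c *\<^sub>R l) $ i powr \<alpha>) = (c powr \<alpha>) ^ CARD('n) * (\<Prod>i\<in>UNIV. l $ i powr \<alpha>)"
    using c by (simp add: powr_mult less_imp_le prod.distrib)
  then show ?thesis using True c unfolding wishart_weight_def abs_vandermonde_scaleR[OF c]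
    by (simp add: sum_distrib_left mult_ac)
next
  case False
  then have "\<not> (\<forall>i. 0 < (c *\<^sub>R l) $ i)" using c by (simp add: zero_less_mult_iff)
  then show ?thesis using False by (simp add: wishart_weight_def)
qed

text \<open>The weight is nonzero on a nonempty open set, which cannot be a null set.\<close>

lemma integral_wishart_weight_pos:
  assumes s: "s > 0" and \<alpha>: "\<alpha> \<ge> 0"
  shows "(\<integral>l. wishart_weight \<alpha> s l \<partial>(lborel::(real^('n::{finite,linorder})) measure)) > 0"
proof -
  have int: "integrable lborel (wishart_weight \<alpha> s :: (real,'n) vec \<Rightarrow> real)"
    using integrable_polynomial_wishart_weight(1)[OF real_polynomial_function.intros(2)[of 1] s \<alpha>] by simp
  have "(\<integral>l. wishart_weight \<alpha> s l \<partial>(lborel::((real,'n) vec) measure)) \<noteq> 0"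
  proof
    assume "(\<integral>l. wishart_weight \<alpha> s l \<partial>(lborel::((real,'n) vec) measure)) = 0"
    then have "AE l in (lborel::((real,'n) vec) measure). wishart_weight \<alpha> s l = 0"
      using integral_nonneg_eq_0_iff_AE[OF int] by (simp add: wishart_weight_nonneg)
    then have ae: "AE l in (lebesgue::((real,'n) vec) measure). wishart_weight \<alpha> s l = 0"
      by (rule AE_completion)
    let ?U = "{l::(real,'n) vec. (\<forall>i. 0 < l $ i) \<and> (\<forall>a b. a \<noteq> b \<longrightarrow> l $ a \<noteq> l $ b)}"
    have "open ?U"
    proof -
      have "?U = (\<Inter>i. {l. 0 < l $ i}) \<inter> (\<Inter>a. \<Inter>b\<in>{b. a \<noteq> b}. {l. l $ a \<noteq> l $ b})" by auto
      then show ?thesis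
        by (auto intro!: open_INT open_Int open_Collect_less open_Collect_neq continuous_intros)
    qed
    have U: "wishart_weight \<alpha> s l \<noteq> 0" if "l \<in> ?U" for l
      using that by (auto simp: wishart_weight_def abs_vandermonde_def split_beta less_le)
    have "AE l in lebesgue. l \<in> - ?U" using ae by eventually_elim (use U in blast)
    then have "l \<in> - ?U" for l
      using mem_closed_if_AE_lebesgue[of "- ?U" l] \<open>open ?U\<close> by (simp add: closed_def)
    \<comment> \<open>One plus the rank of the index: positive and pairwise distinct.\<close>
    moreover have "(\<chi> i::'n. real (Suc (card {j. j < i}))) \<in> ?U"
    proof -
      have "card {j. j < a} \<noteq> card {j. j < b}" if "a \<noteq> b" for a b :: 'n
      proof -
        have lt: "card {j. j < a} < card {j. j < b}" if "a < b" for a b :: 'n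
          using that by (intro psubset_card_mono) auto
        show ?thesis using that lt[of a b] lt[of b a] by (cases a b rule: linorder_cases) auto
      qed
      then show ?thesis by auto
    qed
    ultimately show False by blast
  qed
  moreover have "(\<integral>l. wishart_weight \<alpha> s l \<partial>(lborel::((real,'n) vec) measure)) \<ge> 0"
    by (intro integral_nonneg_AE) (simp add: wishart_weight_nonneg)
  ultimately show ?thesis by simp
qed

lemma integral_gaussian_pos: "(\<integral>x. exp (- s * (norm x)\<^sup>2 / 2) \<partial>(lborel::'a::euclidean_space measure)) > 0" if "s > 0"
proof -
  have int: "integrable lborel (\<lambda>x::'a. exp (- s * (norm x)\<^sup>2 / 2))"
    using integrable_polynomial_times_gaussian[OF real_polynomial_function.intros(2)[of 1] that] by simp
  have "(\<integral>x. exp (- s * (norm x)\<^sup>2 / 2) \<partial>(lborel::'a measure)) \<noteq> 0"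
  proof
    assume "(\<integral>x. exp (- s * (norm x)\<^sup>2 / 2) \<partial>(lborel::'a measure)) = 0"
    then have "AE x in (lborel::'a measure). False"
      using integral_nonneg_eq_0_iff_AE[OF int] by simp
    then have "emeasure lborel (UNIV :: 'a set) = 0"
      using AE_iff_measurable[of UNIV "lborel :: 'a measure" "\<lambda>_. False"] by simp
    then show False by simp
  qed
  moreover have "(\<integral>x. exp (- s * (norm x)\<^sup>2 / 2) \<partial>(lborel::'a measure)) \<ge> 0" by simp
  ultimately show ?thesis by linarith
qed

text \<open>At a fixed s the loop equations make the moments proportional, with the total masses as
  factors. Both masses scale as s to the power - N M / 2, so their ratio is the ratio at s = 1; on
  the eigenvalue side the exponent is made up of N from the volume, N (N - 1) / 2 from the pairs,
  and N \<alpha>.\<close>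

theorem moments_proportional:
  fixes ks :: "nat list"
  assumes MN: "CARD('m) > CARD('n)" and s: "s > 0"
  defines "\<alpha> \<equiv> (real CARD('m) - real CARD('n) - 1) / 2"
  shows "(\<integral>X. prod_list (map (ptr X) ks) * exp (- s * (norm X)\<^sup>2 / 2) \<partial>(lborel::(real^'m^('n::{finite,linorder})) measure))
       / (\<integral>X. exp (- (norm X)\<^sup>2 / 2) \<partial>(lborel::(real^'m^('n::{finite,linorder})) measure)) =
      (\<integral>l. prod_list (map (psum l) ks) * wishart_weight \<alpha> s l \<partial>(lborel::(real^('n::{finite,linorder})) measure))
       / (\<integral>l. wishart_weight \<alpha> 1 l \<partial>(lborel::(real^('n::{finite,linorder})) measure))"
proof -
  have \<alpha>: "\<alpha> \<ge> 0" using MN by (simp add: \<alpha>_def)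
  define m1 where "m1 = (\<lambda>ks. \<integral>X. prod_list (map (ptr X) ks) * exp (- s * (norm X)\<^sup>2 / 2) \<partial>(lborel::(((real,'m) vec,'n) vec) measure))"
  define m2 where "m2 = (\<lambda>ks. \<integral>l. prod_list (map (psum l) ks) * wishart_weight \<alpha> s l \<partial>(lborel::((real,'n) vec) measure))"
  define ZA where "ZA = (\<integral>X. exp (- (norm X)\<^sup>2 / 2) \<partial>(lborel::(((real,'m) vec,'n) vec) measure))"
  define ZB where "ZB = (\<integral>l. wishart_weight \<alpha> 1 l \<partial>(lborel::((real,'n) vec) measure))"
  have c: "2 * \<alpha> + real CARD('n) + 1 = real CARD('m)" by (simp add: \<alpha>_def diff_divide_distrib)
  have int1: "integrable (lborel::(((real,'m) vec,'n) vec) measure) (\<lambda>X. prod_list (map (ptr X) ks) * exp (- s * (norm X)\<^sup>2 / 2))" for ks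
    by (intro integrable_polynomial_times_gaussian s real_polynomial_function_prod_list real_polynomial_function_ptr)
  have int2: "integrable (lborel::((real,'n) vec) measure) (\<lambda>l. prod_list (map (psum l) ks) * wishart_weight \<alpha> s l)" for ks
    by (intro integrable_polynomial_wishart_weight s \<alpha> real_polynomial_function_prod_list real_polynomial_function_psum)
  have 1: "m1 ks * m2 [] = m2 ks * m1 []"
  proof (rule loop_equations_determine_moments[where s = s and c = "real CARD('m)" and n = "real CARD('n)"])
    show "s \<noteq> 0" using s by simp
    show "s * m1 (Suc k # ks) = formal_loop (real CARD('m)) m1 k ks" for k ks
      using loop_equation_gaussian_matrix[OF s, where k = k and ks = ks and 'm = 'm and 'n = 'n]
        integral_loop_term[OF int1, of "real CARD('m)" k ks] by (simp add: m1_def)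
    show "s * m2 (Suc k # ks) = formal_loop (real CARD('m)) m2 k ks" for k ks
      using loop_equation_wishart_weight[OF s \<alpha>, where k = k and ks = ks and 'n = 'n]
        integral_loop_term[OF int2, of "real CARD('m)" k ks] by (simp add: m2_def c)
    have "ptr X 0 = real CARD('n)" for X :: "((real,'m) vec,'n) vec" by (simp add: ptr_def trace_def mat_def)
    then show "m1 (0 # ks) = real CARD('n) * m1 ks" for ks by (simp add: m1_def mult.assoc)
    have "psum l 0 = real CARD('n)" for l :: "(real,'n) vec" by (simp add: psum_def)
    then show "m2 (0 # ks) = real CARD('n) * m2 ks" for ks by (simp add: m2_def mult.assoc)
  qed
  have 2: "m1 [] * ZB = m2 [] * ZA"
  proof -
    let ?p = "card {(a::'n, b). a < b}"
    \<comment> \<open>The exponent N M / 2 of s may be a half-integer; in terms of \<open>r\<close>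
      it is the natural number N M.\<close>
    define r where "r = sqrt s"
    have r: "r > 0" "s = r\<^sup>2" using s by (simp_all add: r_def)
    have "ZA = r ^ (CARD('n) * CARD('m)) * (\<integral>X. exp (- (norm (r *\<^sub>R X))\<^sup>2 / 2) \<partial>(lborel::(((real,'m) vec,'n) vec) measure))"
      unfolding ZA_def by (subst integral_lborel_scaleR[OF _ r(1)]) auto
    also have "\<dots> = r ^ (CARD('n) * CARD('m)) * m1 []"
      by (simp add: m1_def power_mult_distrib r(2))
    finally have A: "ZA = r ^ (CARD('n) * CARD('m)) * m1 []" .
    have "ZB = s ^ CARD('n) * (\<integral>l. wishart_weight \<alpha> 1 (s *\<^sub>R l) \<partial>(lborel::((real,'n) vec) measure))"
      unfolding ZB_def by (subst integral_lborel_scaleR[OF _ s]) auto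
    also have "\<dots> = s ^ CARD('n) * (s ^ ?p * (s powr \<alpha>) ^ CARD('n)) * m2 []"
      by (simp add: m2_def wishart_weight_scaleR[OF s] mult.assoc)
    finally have B: "ZB = s ^ CARD('n) * (s ^ ?p * (s powr \<alpha>) ^ CARD('n)) * m2 []" .
    have "s ^ CARD('n) * (s ^ ?p * (s powr \<alpha>) ^ CARD('n)) = r powr (2 * (real CARD('n) + real ?p + \<alpha> * real CARD('n)))"
    proof -
      have 1: "s ^ n = r powr (2 * real n)" for n
      proof -
        have "r powr (2 * real n) = r powr real (2 * n)" by simp
        also have "\<dots> = r ^ (2 * n)" by (rule powr_realpow[OF r(1)])
        also have "\<dots> = s ^ n" by (simp add: r(2) power_mult)
        finally show ?thesis by simp
      qed
      have "(s powr \<alpha>) ^ CARD('n) = (s powr \<alpha>) powr real CARD('n)"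
        by (rule powr_realpow[symmetric]) (use s in simp)
      also have "\<dots> = (s ^ 1) powr (\<alpha> * real CARD('n))" by (simp add: powr_powr)
      also have "\<dots> = r powr (2 * (\<alpha> * real CARD('n)))" unfolding 1 by (simp add: powr_powr)
      finally have 2: "(s powr \<alpha>) ^ CARD('n) = r powr (2 * (\<alpha> * real CARD('n)))" .
      show ?thesis unfolding 1 2 powr_add[symmetric] by (simp add: algebra_simps)
    qed
    also have "2 * (real CARD('n) + real ?p + \<alpha> * real CARD('n)) = real (CARD('n) * CARD('m))"
    proof -
      have a: "2 * real ?p + real CARD('n) = real CARD('n) * real CARD('n)"
        using card_pairs_less[where 'n = 'n] by (metis of_nat_add of_nat_mult of_nat_numeral)
      have b: "2 * \<alpha> = real CARD('m) - real CARD('n) - 1" by (simp add: \<alpha>_def)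
      have "2 * (real CARD('n) + real ?p + \<alpha> * real CARD('n)) = (2 * real ?p + real CARD('n)) + real CARD('n) + (2 * \<alpha>) * real CARD('n)"
        by (simp add: algebra_simps)
      also have "\<dots> = real (CARD('n) * CARD('m))" unfolding a b by (simp add: algebra_simps)
      finally show ?thesis .
    qed
    also have "r powr real (CARD('n) * CARD('m)) = r ^ (CARD('n) * CARD('m))" by (rule powr_realpow[OF r(1)])
    finally show ?thesis using A B by simp
  qed
  have m2: "m2 [] > 0" using integral_wishart_weight_pos[OF s \<alpha>] by (simp add: m2_def)
  have "ZA > 0" using integral_gaussian_pos[OF zero_less_one] by (simp add: ZA_def)
  have "ZB > 0" unfolding ZB_def by (rule integral_wishart_weight_pos[OF zero_less_one \<alpha>])
  have "(m1 ks * ZB) * m2 [] = (m1 ks * m2 []) * ZB" by (simp only: mult_ac)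
  also have "\<dots> = m2 ks * (m1 [] * ZB)" unfolding 1 by (simp only: mult_ac)
  also have "\<dots> = (m2 ks * ZA) * m2 []" unfolding 2 by (simp only: mult_ac)
  finally have "m1 ks * ZB = m2 ks * ZA" using m2 by simp
  then show ?thesis using \<open>ZA > 0\<close> \<open>ZB > 0\<close> unfolding m1_def m2_def ZA_def ZB_def by (simp add: field_simps)
qed

section \<open>Damped power sums and the comparison of laws\<close>

text \<open>The factor \<open>exp (- p 1)\<close> makes the power sums bounded, because p k is at
  most N k! exp (p 1) for nonnegative eigenvalues. The function \<open>e\<close> lists the exponents
  in use; an exponent 0 yields N exp (- p 1), from which p 1 can be recovered.\<close>

definition phi :: "('k::finite \<Rightarrow> nat) \<Rightarrow> (nat \<Rightarrow> real) \<Rightarrow> real^('k::finite)" where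
  "phi e p = (\<chi> b. p (e b) * exp (- p 1))"

lemma prod_list_phi:
  "prod_list (map (($) (phi e p)) bs) = prod_list (map p (map e bs)) * exp (- real (length bs) * p 1)"
  by (induction bs) (simp_all add: phi_def algebra_simps exp_add exp_diff exp_minus field_simps)

lemma psum_growth:
  fixes l :: "real^'n"
  assumes "\<And>i. 0 \<le> l $ i"
  shows "0 \<le> psum l k" "psum l k \<le> real CARD('n) * psum l 1 ^ k"
proof -
  show "0 \<le> psum l k" unfolding psum_def using assms by (intro sum_nonneg) auto
  have "psum l k \<le> (\<Sum>i\<in>(UNIV::'n set). psum l 1 ^ k)"
    unfolding psum_def[of l k]
  proof (rule sum_mono)
    fix i :: 'n
    have "l $ i \<le> psum l 1" unfolding psum_def using assms by (simp add: member_le_sum)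
    then show "l $ i ^ k \<le> psum l 1 ^ k" using assms by (intro power_mono)
  qed
  then show "psum l k \<le> real CARD('n) * psum l 1 ^ k" by simp
qed

lemma norm_phi_psum_le:
  fixes e :: "'k::finite \<Rightarrow> nat" and l :: "real^'n"
  assumes l: "\<And>i. 0 \<le> l $ i"
  shows "norm (phi e (psum l)) \<le> (\<Sum>b\<in>UNIV. real CARD('n) * fact (e b))"
proof -
  have "norm (phi e (psum l)) \<le> (\<Sum>b\<in>UNIV. \<bar>phi e (psum l) $ b\<bar>)" by (rule norm_le_l1_cart)
  also have "\<dots> \<le> (\<Sum>b\<in>UNIV. real CARD('n) * fact (e b))"
  proof (rule sum_mono)
    fix b :: 'k
    have "psum l (e b) \<le> real CARD('n) * (fact (e b) * exp (psum l 1))"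
      by (rule order_trans[OF psum_growth(2)[OF l] mult_left_mono[OF power_le_fact_mult_exp[OF psum_growth(1)[OF l]]]]) simp
    then have "psum l (e b) * exp (- psum l 1) \<le> real CARD('n) * (fact (e b) * exp (psum l 1)) * exp (- psum l 1)"
      by (rule mult_right_mono) simp
    also have "\<dots> = real CARD('n) * fact (e b)" by (simp add: exp_minus)
    finally show "\<bar>phi e (psum l) $ b\<bar> \<le> real CARD('n) * fact (e b)"
      using psum_growth(1)[OF l, of "e b"] by (simp add: phi_def abs_mult)
  qed
  finally show ?thesis .
qed

lemma norm_phi_ptr_le:
  fixes e :: "'k::finite \<Rightarrow> nat" and X :: "real^'m^'n"
  shows "norm (phi e (ptr X)) \<le> (\<Sum>b\<in>UNIV. real CARD('n) * fact (e b))"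
proof -
  obtain Q l where "orthogonal_matrix Q" "gram X = Q ** diag_mat l ** transpose Q"
      and l: "\<And>i. 0 \<le> l $ i" "\<And>k. ptr X k = psum l k"
    by (rule gram_diagonalization[of X]) blast
  have "ptr X = psum l" using l(2) by (simp add: fun_eq_iff)
  then show ?thesis using norm_phi_psum_le[OF l(1)] by simp
qed

lemma continuous_on_phi:
  assumes "\<And>k. continuous_on UNIV (\<lambda>x. p x k)"
  shows "continuous_on UNIV (\<lambda>x. phi e (p x))"
  unfolding phi_def by (intro continuous_on_vec_lambda continuous_intros assms)

lemma continuous_on_ptr: "continuous_on UNIV (\<lambda>X::real^'m^'n. ptr X k)"
  using real_polynomial_function_ptr continuous_on_polymonial_function real_polynomial_function_eq by blast

lemma continuous_on_psum: "continuous_on UNIV (\<lambda>l::real^'n. psum l k)"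
  using real_polynomial_function_psum continuous_on_polymonial_function real_polynomial_function_eq by blast

lemma has_bochner_integral_monomials:
  fixes \<phi> :: "'a \<Rightarrow> real^'k" and w :: "'a \<Rightarrow> real"
  assumes "\<And>bs. has_bochner_integral M (\<lambda>x. prod_list (map (($) (\<phi> x)) bs) * w x) (v bs)"
  shows "has_bochner_integral M (\<lambda>x. (\<Sum>(c, bs)\<leftarrow>ts. c * prod_list (map (($) (\<phi> x)) bs)) * w x) (\<Sum>(c, bs)\<leftarrow>ts. c * v bs)"
proof (induction ts)
  case (Cons t ts)
  obtain c bs where t: "t = (c, bs)" by fastforce
  have "has_bochner_integral M (\<lambda>x. c * (prod_list (map (($) (\<phi> x)) bs) * w x)
      + (\<Sum>(c, bs)\<leftarrow>ts. c * prod_list (map (($) (\<phi> x)) bs)) * w x) (c * v bs + (\<Sum>(c, bs)\<leftarrow>ts. c * v bs))"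
    by (intro has_bochner_integral_add has_bochner_integral_mult_right assms Cons)
  then show ?case by (simp add: t algebra_simps)
qed (simp add: has_bochner_integral_zero)

lemma integral_distr_density:
  fixes f :: "'b::euclidean_space \<Rightarrow> real" and w :: "'a::euclidean_space \<Rightarrow> real"
  assumes [measurable]: "\<phi> \<in> borel_measurable borel" "f \<in> borel_measurable borel" "w \<in> borel_measurable borel"
    and "\<And>x. 0 \<le> w x"
  shows "(\<integral>y. f y \<partial>distr (density lborel (\<lambda>x. ennreal (w x))) borel \<phi>) = (\<integral>x. f (\<phi> x) * w x \<partial>lborel)"
  using assms(4) by (simp add: integral_distr integral_density mult.commute)

text \<open>Both laws live in the ball \<open>K\<close>. A monomial of length n in the coordinates
  of \<open>phi\<close> carries \<open>exp (- n * p 1)\<close>, which raises the scale from 1 to 1 +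
  2 n; \<open>moments_proportional\<close> at that scale gives the same integral \<open>v\<close> on
  both sides.\<close>

theorem distr_phi_eq:
  fixes e :: "'k::finite \<Rightarrow> nat"
  assumes MN: "CARD('m) > CARD('n::{finite,linorder})"
  defines "\<alpha> \<equiv> (real CARD('m) - real CARD('n) - 1) / 2"
  defines "ZA \<equiv> (\<integral>X. exp (- (norm X)\<^sup>2 / 2) \<partial>(lborel::(real^'m^('n::{finite,linorder})) measure))"
    and "ZB \<equiv> (\<integral>l. wishart_weight \<alpha> 1 l \<partial>(lborel::(real^('n::{finite,linorder})) measure))"
  shows "distr (density (lborel::(real^'m^('n::{finite,linorder})) measure) (\<lambda>X. ennreal (exp (- (norm X)\<^sup>2 / 2) / ZA))) borel (\<lambda>X. phi e (ptr X))
       = distr (density (lborel::(real^('n::{finite,linorder})) measure) (\<lambda>l. ennreal (wishart_weight \<alpha> 1 l / ZB))) borel (\<lambda>l. phi e (psum l))"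
    (is "?\<mu> = ?\<nu>")
proof -
  have \<alpha>: "\<alpha> \<ge> 0" using MN by (simp add: \<alpha>_def)
  have ZA: "ZA > 0" using integral_gaussian_pos[OF zero_less_one] by (simp add: ZA_def)
  have ZB: "ZB > 0" unfolding ZB_def by (rule integral_wishart_weight_pos[OF zero_less_one \<alpha>])
  have mA[measurable]: "(\<lambda>X::((real,'m) vec,'n) vec. phi e (ptr X)) \<in> borel_measurable borel"
    by (intro borel_measurable_continuous_onI continuous_on_phi continuous_on_ptr)
  have mB[measurable]: "(\<lambda>l::(real,'n) vec. phi e (psum l)) \<in> borel_measurable borel"
    by (intro borel_measurable_continuous_onI continuous_on_phi continuous_on_psum)
  define K where "K = cball (0::(real,'k) vec) (\<Sum>b\<in>UNIV. real CARD('n) * fact (e b))"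
  define v where "v = (\<lambda>bs. (\<integral>X. prod_list (map (ptr X) (map e bs)) * exp (- (1 + 2 * real (length bs)) * (norm X)\<^sup>2 / 2)
      \<partial>(lborel::(((real,'m) vec,'n) vec) measure)) / ZA)"
  have vA: "has_bochner_integral (lborel::(((real,'m) vec,'n) vec) measure)
      (\<lambda>X. prod_list (map (($) (phi e (ptr X))) bs) * (exp (- (norm X)\<^sup>2 / 2) / ZA)) (v bs)" for bs
  proof -
    have s: "1 + 2 * real (length bs) > 0" by simp
    have eq: "prod_list (map (($) (phi e (ptr X))) bs) * (exp (- (norm X)\<^sup>2 / 2) / ZA) =
       prod_list (map (ptr X) (map e bs)) * exp (- (1 + 2 * real (length bs)) * (norm X)\<^sup>2 / 2) / ZA" for X :: "((real,'m) vec,'n) vec"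
      unfolding prod_list_phi ptr_1 by (simp add: mult_exp_exp field_simps)
    show ?thesis unfolding eq v_def
      by (intro has_bochner_integral_divide_zero has_bochner_integral_integrable
          integrable_polynomial_times_gaussian[OF _ s] real_polynomial_function_prod_list real_polynomial_function_ptr)
  qed
  have vB: "has_bochner_integral (lborel::((real,'n) vec) measure)
      (\<lambda>l. prod_list (map (($) (phi e (psum l))) bs) * (wishart_weight \<alpha> 1 l / ZB)) (v bs)" for bs
  proof -
    have s: "1 + 2 * real (length bs) > 0" by simp
    have veq: "v bs = (\<integral>l. prod_list (map (psum l) (map e bs)) * wishart_weight \<alpha> (1 + 2 * real (length bs)) l \<partial>(lborel::((real,'n) vec) measure)) / ZB"
      unfolding v_def ZA_def ZB_def \<alpha>_def using moments_proportional[OF MN s, of "map e bs"] by simp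
    have ww: "exp (- real (length bs) * psum l 1) * wishart_weight \<alpha> 1 l = wishart_weight \<alpha> (1 + 2 * real (length bs)) l" for l :: "(real,'n) vec"
    proof -
      have "exp (- real (length bs) * psum l 1) * exp (- 1 * (\<Sum>i\<in>UNIV. l $ i) / 2) = exp (- (1 + 2 * real (length bs)) * (\<Sum>i\<in>UNIV. l $ i) / 2)"
        by (simp add: mult_exp_exp psum_def field_simps)
      then show ?thesis unfolding wishart_weight_def by (simp add: mult_ac)
    qed
    have eq: "prod_list (map (($) (phi e (psum l))) bs) * (wishart_weight \<alpha> 1 l / ZB) =
       prod_list (map (psum l) (map e bs)) * wishart_weight \<alpha> (1 + 2 * real (length bs)) l / ZB" for l :: "(real,'n) vec"
      unfolding prod_list_phi ww[symmetric] by simp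
    show ?thesis unfolding eq veq
      by (intro has_bochner_integral_divide_zero has_bochner_integral_integrable
          integrable_polynomial_wishart_weight(1)[OF _ s \<alpha>] real_polynomial_function_prod_list real_polynomial_function_psum)
  qed
  have finA: "finite_measure ?\<mu>"
  proof (rule finite_measure.finite_measure_distr)
    have "integrable (lborel::(((real,'m) vec,'n) vec) measure) (\<lambda>X. exp (- (norm X)\<^sup>2 / 2) / ZA)"
      using vA[of "[]"] by (simp add: has_bochner_integral_iff)
    then show "finite_measure (density (lborel::(((real,'m) vec,'n) vec) measure) (\<lambda>X. ennreal (exp (- (norm X)\<^sup>2 / 2) / ZA)))"
      using ZA by (intro finite_measureI) (auto simp: emeasure_density integrable_iff_bounded)
  qed simp
  have finB: "finite_measure ?\<nu>"
  proof (rule finite_measure.finite_measure_distr)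
    have "integrable (lborel::((real,'n) vec) measure) (\<lambda>l. wishart_weight \<alpha> 1 l / ZB)"
      using vB[of "[]"] by (simp add: has_bochner_integral_iff)
    then show "finite_measure (density (lborel::((real,'n) vec) measure) (\<lambda>l. ennreal (wishart_weight \<alpha> 1 l / ZB)))"
      using ZB by (intro finite_measureI) (auto simp: emeasure_density integrable_iff_bounded abs_mult wishart_weight_nonneg)
  qed simp
  show ?thesis
  proof (rule finite_measures_eq_if_polynomial_moments_eq[OF finA finB, where K = K])
    show "compact K" by (simp add: K_def)
    show "AE x in ?\<mu>. x \<in> K"
      using norm_phi_ptr_le[of e] by (subst AE_distr_iff) (auto simp: K_def)
    have pos: "0 < l $ i" if "wishart_weight \<alpha> 1 l \<noteq> 0" for l :: "(real,'n) vec" and i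
      using that by (auto simp: wishart_weight_def indicator_def split: if_splits)
    have kk: "phi e (psum l) \<in> K" if "0 < wishart_weight \<alpha> 1 l / ZB" for l :: "(real,'n) vec"
    proof -
      have "wishart_weight \<alpha> 1 l \<noteq> 0" using that by auto
      then show ?thesis using norm_phi_psum_le[of l e] pos[of l] by (simp add: K_def less_imp_le)
    qed
    have [measurable]: "K \<in> sets borel" by (simp add: K_def)
    show "AE x in ?\<nu>. x \<in> K"
      by (subst AE_distr_iff) (auto simp: AE_density intro!: AE_I2 kk)
    fix f :: "(real,'k) vec \<Rightarrow> real" assume f: "real_polynomial_function f"
    obtain ts where ts: "\<And>x. f x = (\<Sum>(c, bs)\<leftarrow>ts. c * prod_list (map (($) x) bs))"
      using real_polynomial_function_monomials[OF f] by blast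
    have [measurable]: "f \<in> borel_measurable borel"
      using f by (intro borel_measurable_continuous_onI) (simp add: continuous_on_polymonial_function real_polynomial_function_eq)
    have "(\<integral>x. f x \<partial>?\<mu>) = (\<integral>X. f (phi e (ptr X)) * (exp (- (norm X)\<^sup>2 / 2) / ZA) \<partial>(lborel::(((real,'m) vec,'n) vec) measure))"
      using ZA by (intro integral_distr_density) auto
    also have "\<dots> = (\<Sum>(c, bs)\<leftarrow>ts. c * v bs)"
      unfolding ts by (rule has_bochner_integral_integral_eq[OF has_bochner_integral_monomials[OF vA]])
    also have "\<dots> = (\<integral>l. f (phi e (psum l)) * (wishart_weight \<alpha> 1 l / ZB) \<partial>(lborel::((real,'n) vec) measure))"
      unfolding ts by (rule has_bochner_integral_integral_eq[OF has_bochner_integral_monomials[OF vB], symmetric])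
    also have "\<dots> = (\<integral>x. f x \<partial>?\<nu>)"
      using ZB by (intro integral_distr_density[symmetric]) (auto simp: wishart_weight_nonneg)
    finally show "(\<integral>x. f x \<partial>?\<mu>) = (\<integral>x. f x \<partial>?\<nu>)" .
  qed auto
qed

text \<open>The exponents below 2 N, indexed by \<open>'n \<times> bool\<close>, separate vectors up
  to permutation, so \<open>phi\<close> is injective on \<open>chamber\<close>. There f factors by
  \<open>borel_factorization\<close>, and the symmetry of f and of the power sums extends the
  factorization to all vectors.\<close>

lemma symmetric_fun_factors_through_phi:
  fixes f :: "real^('n::{finite,linorder}) \<Rightarrow> ennreal"
  assumes f: "f \<in> borel_measurable borel" "symmetric_fun f"
  obtains e :: "'n \<times> bool \<Rightarrow> nat" and g where "g \<in> borel_measurable borel" "\<And>l. f l = g (phi e (psum l))"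
proof -
  have "\<exists>e. bij_betw e (UNIV :: ('n \<times> bool) set) {..<2 * CARD('n)}"
    by (rule finite_same_card_bij) simp_all
  then obtain e where e: "bij_betw e (UNIV :: ('n \<times> bool) set) {..<2 * CARD('n)}" ..
  let ?\<Phi> = "\<lambda>l::(real,'n) vec. phi e (psum l)"
  have perm: "\<exists>p. p permutes UNIV \<and> m = (\<chi> i. l $ p i)" if eq: "?\<Phi> l = ?\<Phi> m" for l m :: "(real,'n) vec"
  proof -
    have ex: "psum l k * exp (- psum l 1) = psum m k * exp (- psum m 1)" if "k < 2 * CARD('n)" for k
    proof -
      have "k \<in> range e" using bij_betw_imp_surj_on[OF e] that by simp
      then obtain b where "e b = k" by blast
      then show ?thesis using arg_cong[OF eq, of "\<lambda>v. v $ b"] by (simp add: phi_def)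
    qed
    \<comment> \<open>The component with exponent 0 is N times this exponential; dividing by it
      undoes the damping.\<close>
    have "exp (- psum l 1) = exp (- psum m 1)" using ex[of 0] by (simp add: psum_def)
    then have "(\<Sum>i\<in>UNIV. l $ i ^ k) = (\<Sum>i\<in>UNIV. m $ i ^ k)" if "k < 2 * CARD('n)" for k
      using ex[OF that] by (simp add: psum_def)
    from permutation_of_power_sums_eq[OF this] show ?thesis by metis
  qed
  have inj: "inj_on ?\<Phi> chamber"
  proof (rule inj_onI)
    fix l m assume lm: "l \<in> chamber" "m \<in> chamber" "?\<Phi> l = ?\<Phi> m"
    obtain p where "p permutes UNIV" "m = (\<chi> i. l $ p i)" using perm[OF lm(3)] by blast
    then show "l = m" using chamber_permutation_unique[OF lm(1,2)] by blast
  qed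
  obtain g where g: "g \<in> borel_measurable borel" "\<And>l. l \<in> chamber \<Longrightarrow> f l = g (?\<Phi> l)"
    using borel_factorization[OF continuous_on_phi[OF continuous_on_psum] closed_chamber inj f(1)] by blast
  have "f l = g (?\<Phi> l)" for l
  proof -
    obtain p where p: "p permutes (UNIV :: 'n set)" "(\<chi> i. l $ p i) \<in> chamber" using chamber_permutation_exists by blast
    have "psum (\<chi> i. l $ p i) k = psum l k" for k
      unfolding psum_def using sum.permute[OF p(1), of "\<lambda>i. l $ i ^ k"] by (simp add: o_def)
    then have "psum (\<chi> i. l $ p i) = psum l" by (simp add: fun_eq_iff)
    then show ?thesis using g(2)[OF p(2)] f(2) p(1) by (simp add: symmetric_fun_def)
  qed
  then show thesis using that g(1) by blast
qed

lemma symmetric_fun_eigvals_gram: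
  fixes X :: "real^'m^('n::{finite,linorder})"
  assumes "symmetric_fun f" "\<And>l. f l = g (phi e (psum l))"
  shows "f (eigvals (gram X)) = g (phi e (ptr X))"
proof -
  obtain Q l where Q: "orthogonal_matrix Q" "gram X = Q ** diag_mat l ** transpose Q" and "\<And>i. 0 \<le> l $ i"
      and p: "\<And>k. ptr X k = psum l k"
    by (rule gram_diagonalization[of X]) blast
  have "ptr X = psum l" using p by (simp add: fun_eq_iff)
  then show ?thesis using symmetric_fun_eigvals[OF assms(1) Q(1), of l] Q(2) assms(2) by simp
qed

text \<open>Since \<open>eigvals\<close> is defined by choice, measurability is obtained from the
  continuous map taking X to its damped traces.\<close>

lemma measurable_eigvals_gram:
  fixes f :: "real^('n::{finite,linorder}) \<Rightarrow> ennreal"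
  assumes "f \<in> borel_measurable borel" "symmetric_fun f"
  shows "(\<lambda>X::real^'m^('n::{finite,linorder}). f (eigvals (gram X))) \<in> borel_measurable borel"
proof -
  obtain e :: "'n \<times> bool \<Rightarrow> nat" and g where g[measurable]: "g \<in> borel_measurable borel" and fg: "\<And>l. f l = g (phi e (psum l))"
    using symmetric_fun_factors_through_phi[OF assms] by metis
  have [measurable]: "(\<lambda>X::((real,'m) vec,'n) vec. phi e (ptr X)) \<in> borel_measurable borel"
    by (intro borel_measurable_continuous_onI continuous_on_phi continuous_on_ptr)
  show ?thesis unfolding symmetric_fun_eigvals_gram[OF assms(2) fg] by measurable
qed

text \<open>Both sides integrate one function g against one law, the common image under
  \<open>phi\<close>.\<close>

theorem eigenvalue_law_gaussian:
  fixes f :: "real^('n::{finite,linorder}) \<Rightarrow> ennreal"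
  assumes MN: "CARD('m) > CARD('n)" and f: "f \<in> borel_measurable borel" "symmetric_fun f"
  defines "\<alpha> \<equiv> (real CARD('m) - real CARD('n) - 1) / 2"
  defines "ZA \<equiv> (\<integral>X. exp (- (norm X)\<^sup>2 / 2) \<partial>(lborel::(real^'m^('n::{finite,linorder})) measure))"
    and "ZB \<equiv> (\<integral>l. wishart_weight \<alpha> 1 l \<partial>(lborel::(real^('n::{finite,linorder})) measure))"
  shows "(\<integral>\<^sup>+X. ennreal (exp (- (norm X)\<^sup>2 / 2) / ZA) * f (eigvals (gram X)) \<partial>(lborel::(real^'m^('n::{finite,linorder})) measure))
       = (\<integral>\<^sup>+l. ennreal (wishart_weight \<alpha> 1 l / ZB) * f l \<partial>lborel)"
proof -
  obtain e :: "'n \<times> bool \<Rightarrow> nat" and g where g[measurable]: "g \<in> borel_measurable borel" and fg: "\<And>l. f l = g (phi e (psum l))"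
    using symmetric_fun_factors_through_phi[OF f] by metis
  have [measurable]: "(\<lambda>X::((real,'m) vec,'n) vec. phi e (ptr X)) \<in> borel_measurable borel"
    by (intro borel_measurable_continuous_onI continuous_on_phi continuous_on_ptr)
  have [measurable]: "(\<lambda>l::(real,'n) vec. phi e (psum l)) \<in> borel_measurable borel"
    by (intro borel_measurable_continuous_onI continuous_on_phi continuous_on_psum)
  have "(\<integral>\<^sup>+y. g y \<partial>distr (density (lborel::(((real,'m) vec,'n) vec) measure) (\<lambda>X. ennreal (exp (- (norm X)\<^sup>2 / 2) / ZA))) borel (\<lambda>X. phi e (ptr X)))
     = (\<integral>\<^sup>+y. g y \<partial>distr (density (lborel::((real,'n) vec) measure) (\<lambda>l. ennreal (wishart_weight \<alpha> 1 l / ZB))) borel (\<lambda>l. phi e (psum l)))"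
    unfolding \<alpha>_def ZA_def ZB_def using distr_phi_eq[OF MN, of e] by simp
  then show ?thesis
    unfolding symmetric_fun_eigvals_gram[OF f(2) fg] unfolding fg by (simp add: nn_integral_distr nn_integral_density)
qed

section \<open>Averaging over the spike direction\<close>

lemma diag_mat_one: "diag_mat (\<chi> i. 1) = mat 1"
  by (simp add: diag_mat_def mat_def vec_eq_iff)

lemma matrix_inv_diagonalized:
  fixes Q :: "real^'n^'n"
  assumes Q: "orthogonal_matrix Q" and d: "\<And>i. d $ i \<noteq> 0"
  shows "matrix_inv (Q ** diag_mat d ** transpose Q) = Q ** diag_mat (\<chi> i. 1 / d $ i) ** transpose Q"
proof -
  have prod: "(Q ** diag_mat a ** transpose Q) ** (Q ** diag_mat b ** transpose Q) = mat 1"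
    if "\<And>i. a $ i * b $ i = 1" for a b
  proof -
    have "(Q ** diag_mat a ** transpose Q) ** (Q ** diag_mat b ** transpose Q) =
        Q ** diag_mat a ** (transpose Q ** Q) ** diag_mat b ** transpose Q" by (simp add: matrix_mul_assoc)
    also have "\<dots> = Q ** (diag_mat a ** diag_mat b) ** transpose Q"
      using Q by (simp add: orthogonal_matrix_def matrix_mul_assoc)
    also have "\<dots> = mat 1" using Q that by (simp add: diag_mat_mult diag_mat_one orthogonal_matrix_def)
    finally show ?thesis .
  qed
  let ?A = "Q ** diag_mat d ** transpose Q" and ?B = "Q ** diag_mat (\<chi> i. 1 / d $ i) ** transpose Q"
  have AB: "?A ** ?B = mat 1" "?B ** ?A = mat 1" using d by (auto intro!: prod)
  have "?A ** matrix_inv ?A = mat 1 \<and> matrix_inv ?A ** ?A = mat 1"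
    unfolding matrix_inv_def by (rule someI[of _ ?B]) (use AB in simp)
  then show ?thesis using AB by (metis matrix_mul_assoc matrix_mul_lid matrix_mul_rid)
qed

lemma norm_orthogonal_matrix_mult:
  fixes Q :: "real^'n^'n"
  assumes "orthogonal_matrix Q"
  shows "norm (Q *v x) = norm x"
  using assms orthogonal_transformation_matrix[of "\<lambda>x. Q *v x"] orthogonal_transformation_norm[of "\<lambda>x. Q *v x"]
  by simp

text \<open>In an eigenbasis the inverse covariance is the identity except for 1 / (1 + \<tau>) on
  the spike axis, and 1 - 1 / (1 + \<tau>) = \<tau> / (1 + \<tau>). The condition \<tau> > -1 makes
  all eigenvalues and the determinant positive.\<close>

lemma spiked_mvn_density:
  fixes \<Sigma> :: "real^'n^'n"
  assumes sym: "transpose \<Sigma> = \<Sigma>"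
    and char: "\<And>x. det (x *\<^sub>R mat 1 - \<Sigma>) = (x - 1) ^ (CARD('n) - 1) * (x - (1 + \<tau>))"
    and \<tau>: "\<tau> > -1"
  obtains v C where "norm v = 1" "C > 0"
    "\<And>x. mvn_density \<Sigma> x = C * exp (- ((norm x)\<^sup>2 - \<tau> / (1 + \<tau>) * (v \<bullet> x)\<^sup>2) / 2)"
proof -
  obtain Q d where Q: "orthogonal_matrix Q" and \<Sigma>: "\<Sigma> = Q ** diag_mat d ** transpose Q"
    using symmetric_matrix_diagonalizable[OF sym] by blast
  have Qt: "orthogonal_matrix (transpose Q)" using Q by (simp add: orthogonal_matrix_transpose)
  \<comment> \<open>An arbitrary index at which the model spectrum \<open>d1\<close> carries the
    spike; the permutation leading to the actual spectrum \<open>d\<close> moves it to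
    \<open>i0\<close>.\<close>
  define i1 :: 'n where "i1 = undefined"
  define d1 :: "real^'n" where "d1 = (\<chi> i. if i = i1 then 1 + \<tau> else 1)"
  have "(\<Prod>i\<in>UNIV. x - d1 $ i) = (\<Prod>i\<in>UNIV. x - d $ i)" for x
  proof -
    have "(\<Prod>i\<in>UNIV. x - d1 $ i) = (x - d1 $ i1) * (\<Prod>i\<in>UNIV - {i1}. x - d1 $ i)"
      by (rule prod.remove) auto
    also have "(\<Prod>i\<in>UNIV - {i1}. x - d1 $ i) = (\<Prod>i\<in>UNIV - {i1}. x - 1)"
      by (rule prod.cong) (auto simp: d1_def)
    finally have "(\<Prod>i\<in>UNIV. x - d1 $ i) = (x - 1) ^ (CARD('n) - 1) * (x - (1 + \<tau>))"
      by (simp add: d1_def card_Diff_singleton)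
    then show ?thesis using char[of x] det_char_diag[OF Q, of x d] \<Sigma> by simp
  qed
  from permutation_of_linear_factors_eq[OF this] obtain p where
    p: "p permutes UNIV" "d = (\<chi> i. d1 $ p i)" by blast
  define i0 where "i0 = inv p i1"
  have pi: "p i = i1 \<longleftrightarrow> i = i0" for i
    using p(1) by (metis i0_def permutes_inverses(1) permutes_inverses(2))
  have di: "d $ i = (if i = i0 then 1 + \<tau> else 1)" for i by (simp add: p(2) d1_def pi)
  have dpos: "d $ i > 0" for i using \<tau> by (simp add: di)
  have "det \<Sigma> = det (Q ** transpose Q) * det (diag_mat d)" by (simp add: \<Sigma> det_mul)
  also have "\<dots> = (\<Prod>i\<in>UNIV. d $ i)"
    using Q det_diagonal[of "diag_mat d"] by (simp add: orthogonal_matrix_def diag_mat_def)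
  finally have detpos: "det \<Sigma> > 0" using dpos by (simp add: prod_pos)
  define v where "v = Q *v axis i0 1"
  have "norm v = 1" unfolding v_def norm_orthogonal_matrix_mult[OF Q] by simp
  moreover have "1 / sqrt ((2 * pi) ^ CARD('n) * det \<Sigma>) > 0" using detpos by simp
  moreover have "mvn_density \<Sigma> x = 1 / sqrt ((2 * pi) ^ CARD('n) * det \<Sigma>) *
      exp (- ((norm x)\<^sup>2 - \<tau> / (1 + \<tau>) * (v \<bullet> x)\<^sup>2) / 2)" for x
  proof -
    define y where "y = transpose Q *v x"
    have ny: "(norm x)\<^sup>2 = (\<Sum>i\<in>UNIV. y $ i ^ 2)"
      using norm_orthogonal_matrix_mult[OF Qt, of x]
      by (simp add: y_def[symmetric] norm_vec_def L2_set_def sum_nonneg del: transpose_matrix_vector)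
    have vx: "v \<bullet> x = y $ i0"
    proof -
      have "v \<bullet> x = axis i0 1 \<bullet> (transpose Q *v x)"
        unfolding v_def by (metis dot_lmul_matrix inner_commute transpose_matrix_vector)
      then show ?thesis by (simp add: y_def inner_axis' del: transpose_matrix_vector)
    qed
    have "x \<bullet> (matrix_inv \<Sigma> *v x) = (\<Sum>i\<in>UNIV. 1 / d $ i * y $ i ^ 2)"
      unfolding \<Sigma> using matrix_inv_diagonalized[OF Q, of d] dpos inner_diagonalized[of x Q "\<chi> i. 1 / d $ i"]
      by (simp add: y_def less_imp_neq[OF dpos, symmetric] del: transpose_matrix_vector)
    also have "\<dots> = (\<Sum>i\<in>UNIV. y $ i ^ 2 - (if i = i0 then \<tau> / (1 + \<tau>) * y $ i ^ 2 else 0))"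
      using \<tau> by (intro sum.cong) (auto simp: di field_simps)
    also have "\<dots> = (norm x)\<^sup>2 - \<tau> / (1 + \<tau>) * (v \<bullet> x)\<^sup>2"
      by (simp add: sum_subtractf ny vx)
    finally show ?thesis by (simp add: mvn_density_def)
  qed
  ultimately show thesis using that by blast
qed

lemma gram_orthogonal_mult: "gram (Q ** X) = Q ** gram X ** transpose Q"
  by (simp add: gram_def matrix_transpose_mul matrix_mul_assoc)

lemma symmetric_fun_eigvals_conjugate:
  fixes X :: "real^'m^'n"
  assumes f: "symmetric_fun f" and Q: "orthogonal_matrix Q"
  shows "f (eigvals (gram (Q ** X))) = f (eigvals (gram X))"
proof -
  obtain P l where P: "orthogonal_matrix P" "gram X = P ** diag_mat l ** transpose P"
    and "\<And>i. 0 \<le> l $ i" "\<And>k. ptr X k = psum l k"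
    by (rule gram_diagonalization[of X]) blast
  have "gram (Q ** X) = (Q ** P) ** diag_mat l ** transpose (Q ** P)"
    unfolding gram_orthogonal_mult P(2) by (simp add: matrix_transpose_mul matrix_mul_assoc)
  then show ?thesis
    using symmetric_fun_eigvals[OF f orthogonal_matrix_mul[OF Q P(1)], of l] symmetric_fun_eigvals[OF f P(1), of l] P(2) by simp
qed

lemma norm_orthogonal_mult_matrix:
  fixes X :: "real^'m^'n"
  assumes Q: "orthogonal_matrix Q"
  shows "norm (Q ** X) = norm X"
proof -
  have "(norm (Q ** X))\<^sup>2 = trace (Q ** gram X ** transpose Q)"
    using ptr_1[of "Q ** X"] by (simp add: ptr_def gram_orthogonal_mult)
  also have "\<dots> = trace (transpose Q ** (Q ** gram X))" by (rule trace_mul_sym)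
  also have "\<dots> = (norm X)\<^sup>2" using Q ptr_1[of X] by (simp add: ptr_def matrix_mul_assoc orthogonal_matrix_def)
  finally show ?thesis by simp
qed

lemma quadratic_form_gram: "v \<bullet> (gram X *v v) = (norm (transpose X *v v))\<^sup>2"
proof -
  have "v \<bullet> (gram X *v v) = v \<bullet> (X *v (transpose X *v v))"
    by (simp only: gram_def matrix_vector_mul_assoc matrix_mul_assoc)
  also have "\<dots> = (transpose X *v v) \<bullet> (transpose X *v v)"
    by (metis dot_lmul_matrix transpose_matrix_vector)
  finally show ?thesis by (simp only: power2_norm_eq_inner)
qed

lemma measurable_quadratic_form_gram [measurable]:
  "(\<lambda>(X::real^'m^'n, v). v \<bullet> (gram X *v v)) \<in> borel_measurable (borel \<Otimes>\<^sub>M borel)"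
  "(\<lambda>X::real^'m^'n. w \<bullet> (gram X *v w)) \<in> borel_measurable borel"
proof -
  have c: "continuous_on UNIV (\<lambda>p::(real^'m^'n) \<times> (real^'n). snd p \<bullet> (gram (fst p) *v snd p))"
    unfolding gram_def matrix_vector_mult_def matrix_matrix_mult_def transpose_def
    by (simp, intro continuous_intros continuous_on_vec_lambda)
  then have "(\<lambda>p::(real^'m^'n) \<times> (real^'n). snd p \<bullet> (gram (fst p) *v snd p)) \<in> borel_measurable borel"
    by (rule borel_measurable_continuous_onI)
  then show "(\<lambda>(X::real^'m^'n, v). v \<bullet> (gram X *v v)) \<in> borel_measurable (borel \<Otimes>\<^sub>M borel)"
    by (simp add: borel_prod case_prod_beta')
  have "continuous_on UNIV (\<lambda>X::real^'m^'n. w \<bullet> (gram X *v w))"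
    using continuous_on_compose2[OF c, of UNIV "\<lambda>X. (X, w)"] by (simp add: continuous_on_Pair continuous_on_id)
  then show "(\<lambda>X::real^'m^'n. w \<bullet> (gram X *v w)) \<in> borel_measurable borel"
    by (rule borel_measurable_continuous_onI)
qed

text \<open>An orthogonal matrix Q with Q u = v acts on X as a linear isometry, so it preserves
  Lebesgue measure, and it preserves F; in the quadratic form it turns v into u.\<close>

lemma nn_integral_spike_direction:
  fixes F :: "real^'m^'n \<Rightarrow> ennreal" and u v :: "real^'n"
  assumes F[measurable]: "F \<in> borel_measurable borel"
    and inv: "\<And>Q X. orthogonal_matrix Q \<Longrightarrow> F (Q ** X) = F X" and n: "norm u = 1" "norm v = 1"
  shows "(\<integral>\<^sup>+X. F X * ennreal (exp (c * (v \<bullet> (gram X *v v)))) \<partial>lborel) = (\<integral>\<^sup>+X. F X * ennreal (exp (c * (u \<bullet> (gram X *v u)))) \<partial>lborel)"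
proof -
  obtain g where g: "orthogonal_transformation g" "g u = v" using orthogonal_transformation_exists_1[OF n] .
  define Q where "Q = matrix g"
  have Q: "orthogonal_matrix Q" and Qu: "Q *v u = v"
    using g by (auto simp: Q_def orthogonal_transformation_matrix matrix_works)
  have Qv: "transpose Q *v v = u"
    using Q by (metis Qu matrix_vector_mul_assoc matrix_vector_mul_lid orthogonal_matrix_def)
  have lin: "linear (\<lambda>X::real^'m^'n. Q ** X)"
    using bounded_bilinear.bounded_linear_right[OF bounded_bilinear_matrix_mult] bounded_linear.linear by blast
  have d: "distr lborel borel (\<lambda>X::real^'m^'n. Q ** X) = lborel"
    by (rule lborel_distr_isometry[OF lin norm_orthogonal_mult_matrix[OF Q]])
  have m: "(\<lambda>X::real^'m^'n. Q ** X) \<in> borel_measurable borel"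
    by (intro borel_measurable_continuous_onI linear_continuous_on)
       (use bounded_bilinear.bounded_linear_right[OF bounded_bilinear_matrix_mult] in blast)
  have q: "v \<bullet> (gram (Q ** X) *v v) = u \<bullet> (gram X *v u)" for X :: "real^'m^'n"
  proof -
    have "transpose (Q ** X) *v v = transpose X *v (transpose Q *v v)"
      by (simp only: matrix_transpose_mul matrix_vector_mul_assoc)
    then show ?thesis unfolding quadratic_form_gram Qv by simp
  qed
  have "(\<integral>\<^sup>+X. F X * ennreal (exp (c * (v \<bullet> (gram X *v v)))) \<partial>lborel)
     = (\<integral>\<^sup>+X. F X * ennreal (exp (c * (v \<bullet> (gram X *v v)))) \<partial>distr lborel borel (\<lambda>X::real^'m^'n. Q ** X))"
    by (simp add: d)
  also have "\<dots> = (\<integral>\<^sup>+X. F (Q ** X) * ennreal (exp (c * (v \<bullet> (gram (Q ** X) *v v)))) \<partial>lborel)"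
    by (rule nn_integral_distr) (use m in auto)
  finally show ?thesis by (simp add: q inv[OF Q])
qed

section \<open>The spherical average\<close>

text \<open>The Rayleigh quotient of the diagonal matrix of l. It is homogeneous of degree 0 and
  bounded by \<open>norm l\<close>, so a Gaussian u can stand in for a uniform direction.\<close>

definition sphere_ratio :: "real^'n \<Rightarrow> real^'n \<Rightarrow> real" where
  "sphere_ratio l u = (\<Sum>i\<in>UNIV. l $ i * u $ i ^ 2) / (norm u)\<^sup>2"

text \<open>The average of \<open>exp (c * \<Sum>i. l\<^sub>i u\<^sub>i\<^sup>2)\<close> over the unit sphere; the uniform distribution on the
  sphere is realised as the direction of a Gaussian vector.\<close>
definition sphere_average :: "real \<Rightarrow> real^'n \<Rightarrow> real" where
  "sphere_average c l = (\<integral>u. exp (- (norm u)\<^sup>2 / 2) * exp (c * sphere_ratio l u) \<partial>lborel)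
     / (\<integral>u. exp (- (norm u)\<^sup>2 / 2) \<partial>(lborel :: (real^'n) measure))"

lemma abs_sphere_ratio_le:
  fixes l u :: "real^'n"
  shows "\<bar>sphere_ratio l u\<bar> \<le> norm l"
proof (cases "u = 0")
  case False
  have "\<bar>\<Sum>i\<in>UNIV. l $ i * u $ i ^ 2\<bar> \<le> (\<Sum>i\<in>UNIV. norm l * u $ i ^ 2)"
    by (rule order_trans[OF sum_abs], rule sum_mono) (auto simp: abs_mult component_le_norm_cart intro!: mult_right_mono)
  also have "\<dots> = norm l * (norm u)\<^sup>2"
    by (simp add: sum_distrib_left[symmetric] norm_vec_def L2_set_def sum_nonneg)
  finally show ?thesis using False by (simp add: sphere_ratio_def field_simps)
qed (simp add: sphere_ratio_def)

lemma measurable_sphere_ratio [measurable]: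
  "(\<lambda>(l, u). sphere_ratio l u) \<in> borel_measurable (borel \<Otimes>\<^sub>M borel)"
  "(\<lambda>u. sphere_ratio l u) \<in> borel_measurable borel"
  unfolding sphere_ratio_def split_beta by measurable

lemma integrable_sphere_average:
  "integrable lborel (\<lambda>u::real^'n. exp (- (norm u)\<^sup>2 / 2) * exp (c * sphere_ratio l u))"
proof -
  have "integrable lborel (\<lambda>u::real^'n. exp (c * sphere_ratio l u) * exp (- 1 * (norm u)\<^sup>2 / 2))"
  proof (rule integrable_polynomial_growth_times_gaussian[where C = "exp (\<bar>c\<bar> * norm l)" and d = 0])
    fix u :: "real^'n"
    have "c * sphere_ratio l u \<le> \<bar>c\<bar> * \<bar>sphere_ratio l u\<bar>" by (metis abs_ge_self abs_mult)
    also have "\<dots> \<le> \<bar>c\<bar> * norm l" by (intro mult_left_mono abs_sphere_ratio_le) simp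
    finally show "\<bar>exp (c * sphere_ratio l u)\<bar> \<le> exp (\<bar>c\<bar> * norm l) * (1 + norm u) ^ 0" by simp
  qed auto
  then show ?thesis by (simp add: mult.commute)
qed

lemma nn_integral_sphere_average:
  fixes l :: "real^'n"
  shows "(\<integral>\<^sup>+u. ennreal (exp (- (norm u)\<^sup>2 / 2) * exp (c * sphere_ratio l u)) \<partial>lborel) =
     ennreal ((\<integral>u. exp (- (norm u)\<^sup>2 / 2) \<partial>(lborel :: (real^'n) measure)) * sphere_average c l)"
proof -
  have "(\<integral>u. exp (- (norm u)\<^sup>2 / 2) \<partial>(lborel :: (real^'n) measure)) > 0" using integral_gaussian_pos[OF zero_less_one, where 'a = "real^'n"] by simp
  then show ?thesis
    unfolding sphere_average_def by (subst nn_integral_eq_integral[OF integrable_sphere_average]) auto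
qed

lemma sphere_average_nonneg: "sphere_average c l \<ge> 0"
  unfolding sphere_average_def by (intro divide_nonneg_nonneg integral_nonneg_AE) auto

lemma measurable_sphere_average [measurable]:
  "(sphere_average c :: real^'n \<Rightarrow> real) \<in> borel_measurable borel"
proof -
  have "(\<lambda>l::real^'n. \<integral>u. exp (- (norm u)\<^sup>2 / 2) * exp (c * sphere_ratio l u) \<partial>lborel) \<in> borel_measurable borel"
    by (rule lborel.borel_measurable_lebesgue_integral) measurable
  then show ?thesis unfolding sphere_average_def[abs_def] by measurable
qed

lemma sphere_average_scaleR: "sphere_average c (r *\<^sub>R l) = sphere_average (c * r) l"
  unfolding sphere_average_def sphere_ratio_def by (simp add: sum_distrib_left[symmetric] mult.assoc)

lemma symmetric_fun_sphere_average: "symmetric_fun (sphere_average c :: real^'n \<Rightarrow> real)"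
  unfolding symmetric_fun_def
proof (intro allI impI)
  fix l :: "real^'n" and p :: "'n \<Rightarrow> 'n" assume p: "p permutes UNIV"
  define g where "g = (\<lambda>u::real^'n. \<chi> i. u $ p i)"
  have nrm: "norm (g u) = norm u" for u
    using sum.permute[OF p, of "\<lambda>i. (u $ i)\<^sup>2"] by (simp add: norm_vec_def L2_set_def g_def o_def)
  have "linear g" by (simp add: linear_iff g_def vec_eq_iff)
  then have d: "distr lborel borel g = lborel" by (rule lborel_distr_isometry[OF _ nrm])
  have [measurable]: "g \<in> borel_measurable borel"
    unfolding g_def by (intro borel_measurable_continuous_onI continuous_on_vec_lambda continuous_intros)
  have r: "sphere_ratio (\<chi> i. l $ p i) (g u) = sphere_ratio l u" for u
    using sum.permute[OF p, of "\<lambda>i. l $ i * (u $ i)\<^sup>2"] unfolding sphere_ratio_def nrm by (simp add: g_def o_def)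
  have "(\<integral>u. exp (- (norm u)\<^sup>2 / 2) * exp (c * sphere_ratio (\<chi> i. l $ p i) u) \<partial>distr lborel borel g) =
     (\<integral>u. exp (- (norm (g u))\<^sup>2 / 2) * exp (c * sphere_ratio (\<chi> i. l $ p i) (g u)) \<partial>lborel)"
    by (rule integral_distr) auto
  then show "sphere_average c (\<chi> i. l $ p i) = sphere_average c l"
    unfolding sphere_average_def d nrm r by simp
qed

text \<open>In an eigenbasis of \<open>gram X\<close> the Rayleigh quotient is
  \<open>sphere_ratio\<close> of the eigenvalues, and the rotation to these coordinates preserves
  both the Gaussian weight and Lebesgue measure.\<close>

lemma nn_integral_direction_average:
  fixes X :: "real^'m^'n"
  shows "(\<integral>\<^sup>+u. ennreal (exp (- (norm u)\<^sup>2 / 2) * exp (c * ((u \<bullet> (gram X *v u)) / (norm u)\<^sup>2))) \<partial>lborel) =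
    ennreal ((\<integral>u. exp (- (norm u)\<^sup>2 / 2) \<partial>(lborel :: (real^'n) measure)) * sphere_average c (eigvals (gram X)))"
proof -
  obtain Q l where Q: "orthogonal_matrix Q" and A: "gram X = Q ** diag_mat l ** transpose Q"
    and "\<And>i. 0 \<le> l $ i" "\<And>k. ptr X k = psum l k"
    by (rule gram_diagonalization[of X]) blast
  have Qt: "orthogonal_matrix (transpose Q)" using Q by (simp add: orthogonal_matrix_transpose)
  let ?g = "\<lambda>u. transpose Q *v u"
  have d: "distr lborel borel ?g = lborel"
    by (rule lborel_distr_isometry) (auto simp: norm_orthogonal_matrix_mult[OF Qt] simp del: transpose_matrix_vector)
  have m: "?g \<in> borel_measurable borel"
    by (intro borel_measurable_continuous_onI matrix_vector_mult_linear_continuous_on)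
  have r: "(u \<bullet> (gram X *v u)) / (norm u)\<^sup>2 = sphere_ratio l (?g u)" for u
    unfolding A inner_diagonalized sphere_ratio_def norm_orthogonal_matrix_mult[OF Qt] ..
  have "(\<integral>\<^sup>+u. ennreal (exp (- (norm u)\<^sup>2 / 2) * exp (c * ((u \<bullet> (gram X *v u)) / (norm u)\<^sup>2))) \<partial>lborel) =
     (\<integral>\<^sup>+u. ennreal (exp (- (norm (?g u))\<^sup>2 / 2) * exp (c * sphere_ratio l (?g u))) \<partial>lborel)"
    unfolding r norm_orthogonal_matrix_mult[OF Qt] ..
  also have "\<dots> = (\<integral>\<^sup>+u. ennreal (exp (- (norm u)\<^sup>2 / 2) * exp (c * sphere_ratio l u)) \<partial>distr lborel borel ?g)"
    by (rule nn_integral_distr[symmetric]) (use m in auto)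
  also have "\<dots> = ennreal ((\<integral>u. exp (- (norm u)\<^sup>2 / 2) \<partial>(lborel :: (real^'n) measure)) * sphere_average c l)"
    unfolding d by (rule nn_integral_sphere_average)
  also have "sphere_average c l = sphere_average c (eigvals (gram X))"
    unfolding A by (rule symmetric_fun_eigvals[OF symmetric_fun_sphere_average Q, symmetric])
  finally show ?thesis .
qed

text \<open>The left side, \<open>J v\<close>, is the same for every unit vector. So it may be
  evaluated at u / |u| and integrated over a Gaussian vector u; exchanging the integrals produces
  the average for each fixed X.\<close>

theorem nn_integral_spike_average:
  fixes F :: "real^'m^'n \<Rightarrow> ennreal" and v :: "real^'n"
  assumes F[measurable]: "F \<in> borel_measurable borel"
    and inv: "\<And>Q X. orthogonal_matrix Q \<Longrightarrow> F (Q ** X) = F X" and n: "norm v = 1"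
  shows "(\<integral>\<^sup>+X. F X * ennreal (exp (c * (v \<bullet> (gram X *v v)))) \<partial>lborel) =
    (\<integral>\<^sup>+X. F X * ennreal (sphere_average c (eigvals (gram X))) \<partial>lborel)"
proof -
  define G where "G = (\<integral>u. exp (- (norm u)\<^sup>2 / 2) \<partial>(lborel :: (real^'n) measure))"
  have G: "G > 0" using integral_gaussian_pos[OF zero_less_one, where 'a = "real^'n"] by (simp add: G_def)
  define J where "J = (\<lambda>v. \<integral>\<^sup>+X. F X * ennreal (exp (c * (v \<bullet> (gram X *v v)))) \<partial>lborel)"
  let ?e = "\<lambda>u::real^'n. ennreal (exp (- (norm u)\<^sup>2 / 2))"
  let ?q = "\<lambda>(X::real^'m^'n) u. ennreal (exp (- (norm u)\<^sup>2 / 2) * exp (c * ((u \<bullet> (gram X *v u)) / (norm u)\<^sup>2)))"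
  have eG: "(\<integral>\<^sup>+u. ?e u \<partial>lborel) = ennreal G"
    unfolding G_def using integrable_polynomial_times_gaussian[OF real_polynomial_function.intros(2)[of 1] zero_less_one, where 'a = "real^'n"]
    by (intro nn_integral_eq_integral) auto
  have Ju: "(\<integral>\<^sup>+X. F X * ?q X u \<partial>lborel) = ?e u * J v" if "u \<noteq> 0" for u
  proof -
    have nu: "norm (u /\<^sub>R norm u) = 1" using that by simp
    have r: "(u \<bullet> (gram X *v u)) / (norm u)\<^sup>2 = (u /\<^sub>R norm u) \<bullet> (gram X *v (u /\<^sub>R norm u))" for X :: "real^'m^'n"
      by (simp add: matrix_vector_mult_scaleR power2_eq_square field_simps)
    have "(\<integral>\<^sup>+X. F X * ?q X u \<partial>lborel) = (\<integral>\<^sup>+X. ?e u * (F X * ennreal (exp (c * ((u /\<^sub>R norm u) \<bullet> (gram X *v (u /\<^sub>R norm u)))))) \<partial>lborel)"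
      unfolding r by (simp add: ennreal_mult mult_ac)
    also have "\<dots> = ?e u * J (u /\<^sub>R norm u)" unfolding J_def by (rule nn_integral_cmult) measurable
    also have "J (u /\<^sub>R norm u) = J v"
      unfolding J_def by (rule nn_integral_spike_direction[OF F inv n nu])
    finally show ?thesis .
  qed
  have meas: "(\<lambda>(X, u). F X * ?q X u) \<in> borel_measurable (lborel \<Otimes>\<^sub>M lborel)"
    using measurable_quadratic_form_gram(1)[where 'm = 'm and 'n = 'n] unfolding split_beta by measurable
  have "ennreal G * J v = (\<integral>\<^sup>+u. ?e u * J v \<partial>lborel)"
    unfolding eG[symmetric] by (rule nn_integral_multc[symmetric]) simp
  also have "\<dots> = (\<integral>\<^sup>+u. (\<integral>\<^sup>+X. F X * ?q X u \<partial>lborel) \<partial>lborel)"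
    by (rule nn_integral_cong_AE, rule AE_mp[OF AE_lborel_singleton[of 0]], intro AE_I2 impI)
       (rule Ju[symmetric])
  also have "\<dots> = (\<integral>\<^sup>+X. (\<integral>\<^sup>+u. F X * ?q X u \<partial>lborel) \<partial>lborel)"
    by (rule lborel_pair.Fubini'[OF meas])
  also have "\<dots> = (\<integral>\<^sup>+X. F X * ennreal (G * sphere_average c (eigvals (gram X))) \<partial>lborel)"
  proof (rule nn_integral_cong)
    fix X :: "real^'m^'n"
    have "(\<integral>\<^sup>+u. F X * ?q X u \<partial>lborel) = F X * (\<integral>\<^sup>+u. ?q X u \<partial>lborel)"
      by (rule nn_integral_cmult) (use measurable_quadratic_form_gram(1)[where 'm = 'm and 'n = 'n] in measurable)
    then show "(\<integral>\<^sup>+u. F X * ?q X u \<partial>lborel) = F X * ennreal (G * sphere_average c (eigvals (gram X)))"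
      unfolding nn_integral_direction_average G_def .
  qed
  finally have eq: "ennreal G * J v = (\<integral>\<^sup>+X. F X * ennreal (G * sphere_average c (eigvals (gram X))) \<partial>lborel)" .
  \<comment> \<open>Measurability in X comes from the integral with a parameter, not from the
    eigenvalues.\<close>
  have "(\<lambda>X. \<integral>\<^sup>+u. ?q X u \<partial>lborel) \<in> borel_measurable borel"
    by (rule lborel.borel_measurable_nn_integral)
       (use measurable_quadratic_form_gram(1)[where 'm = 'm and 'n = 'n] in \<open>unfold split_beta, measurable\<close>)
  then have [measurable]: "(\<lambda>X::real^'m^'n. ennreal (G * sphere_average c (eigvals (gram X)))) \<in> borel_measurable borel"
    unfolding nn_integral_direction_average G_def .
  have G1: "ennreal (1 / G) * ennreal G = 1" using G by (simp add: ennreal_mult[symmetric])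
  have "(\<integral>\<^sup>+X. F X * ennreal (sphere_average c (eigvals (gram X))) \<partial>lborel)
     = (\<integral>\<^sup>+X. ennreal (1 / G) * (F X * ennreal (G * sphere_average c (eigvals (gram X)))) \<partial>lborel)"
  proof (rule nn_integral_cong)
    fix X :: "real^'m^'n"
    have "ennreal (1 / G) * (F X * ennreal (G * sphere_average c (eigvals (gram X)))) =
        (ennreal (1 / G) * ennreal G) * (F X * ennreal (sphere_average c (eigvals (gram X))))"
      using G by (simp add: ennreal_mult sphere_average_nonneg mult_ac)
    then show "F X * ennreal (sphere_average c (eigvals (gram X))) =
        ennreal (1 / G) * (F X * ennreal (G * sphere_average c (eigvals (gram X))))" by (simp add: G1)
  qed
  also have "\<dots> = ennreal (1 / G) * (ennreal G * J v)"
    unfolding eq by (rule nn_integral_cmult) measurable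
  also have "\<dots> = J v" by (simp add: mult.assoc[symmetric] G1)
  finally show ?thesis by (simp add: J_def)
qed

section \<open>The series of the spherical average\<close>

lemma nn_integral_exp_tail:
  assumes "a > 0"
  shows "(\<integral>\<^sup>+s. ennreal (a * exp (- s * a)) * indicator {1..} s \<partial>lborel) = ennreal (exp (- a))"
proof -
  have "((\<lambda>s. inverse (exp (a * s))) \<longlongrightarrow> 0) at_top"
    by (intro tendsto_inverse_0_at_top filterlim_compose[OF exp_at_top]
        filterlim_tendsto_pos_mult_at_top[OF tendsto_const assms] filterlim_ident)
  then have "((\<lambda>s. - exp (- s * a)) \<longlongrightarrow> - 0) at_top"
    by (intro tendsto_minus) (simp add: exp_minus mult.commute)
  then have "(\<integral>\<^sup>+s. ennreal (a * exp (- s * a)) * indicator {1..} s \<partial>lborel) = ennreal (- 0 - (- exp (- 1 * a)))"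
    using assms by (intro nn_integral_FTC_atLeast) (auto intro!: derivative_eq_intros)
  then show ?thesis by simp
qed

lemma nn_integral_power_tail:
  assumes "p > 0"
  shows "(\<integral>\<^sup>+s. ennreal (1 / s ^ Suc p) * indicator {1..} s \<partial>lborel) = ennreal (1 / real p)"
proof -
  obtain q where q: "p = Suc q" using assms by (cases p) auto
  have "((\<lambda>s::real. - (1 / real p) * inverse s ^ p) \<longlongrightarrow> - (1 / real p) * 0 ^ p) at_top"
    by (intro tendsto_mult tendsto_const tendsto_power tendsto_inverse_0_at_top filterlim_ident)
  moreover have "((\<lambda>s::real. - (1 / real p) * inverse s ^ p) has_real_derivative 1 / s ^ Suc p) (at s)" if "s \<ge> 1" for s
  proof -
    define y where "y = inverse s"
    have "(inverse has_real_derivative - (y ^ Suc (Suc 0))) (at s)"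
      using DERIV_inverse[of s UNIV] that by (simp add: y_def)
    from DERIV_cmult[OF DERIV_power_Suc[OF this, of q], of "- (1 / real p)"]
    have "((\<lambda>s::real. - (1 / real p) * inverse s ^ p) has_real_derivative
        - (1 / real p) * ((1 + real q) * (- (y ^ Suc (Suc 0)) * y ^ q))) (at s)"
      by (simp add: q y_def)
    also have "- (1 / real p) * ((1 + real q) * (- (y ^ Suc (Suc 0)) * y ^ q)) = y ^ Suc p"
      by (simp add: q field_simps)
    also have "y ^ Suc p = 1 / s ^ Suc p" by (simp add: y_def power_inverse divide_inverse del: power_Suc)
    finally show ?thesis .
  qed
  ultimately have "(\<integral>\<^sup>+s. ennreal (1 / s ^ Suc p) * indicator {1..} s \<partial>lborel) = ennreal (- (1 / real p) * 0 ^ p - (- (1 / real p) * inverse 1 ^ p))"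
    by (intro nn_integral_FTC_atLeast) auto
  then show ?thesis by (simp add: q)
qed

text \<open>Radial recursion for Gaussian moments of a function that is homogeneous of degree 0, obtained by
  writing \<open>exp (- r\<^sup>2/2)\<close> as an integral over \<open>s \<ge> 1\<close> of \<open>r\<^sup>2/2 * exp (- s r\<^sup>2/2)\<close> and rescaling.\<close>
lemma gaussian_radial_recursion:
  fixes h :: "real^'n \<Rightarrow> real"
  assumes h[measurable]: "h \<in> borel_measurable borel" and nn: "\<And>u. 0 \<le> h u"
    and hom: "\<And>r u. r > 0 \<Longrightarrow> h (r *\<^sub>R u) = h u" and N: "CARD('n) = 2 * m"
  shows "(\<integral>\<^sup>+u. ennreal (h u * (norm u)\<^sup>2 ^ Suc k * exp (- (norm u)\<^sup>2 / 2)) \<partial>lborel) =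
    ennreal (2 * real (m + k)) * (\<integral>\<^sup>+u. ennreal (h u * (norm u)\<^sup>2 ^ k * exp (- (norm u)\<^sup>2 / 2)) \<partial>lborel)"
proof -
  define I where "I = (\<lambda>k. \<integral>\<^sup>+u. ennreal (h u * (norm u)\<^sup>2 ^ k * exp (- (norm u)\<^sup>2 / 2)) \<partial>lborel)"
  have "m > 0" using N by (cases m) auto
  let ?f = "\<lambda>(s::real) u::real^'n. ennreal (h u * (norm u)\<^sup>2 ^ Suc k / 2 * exp (- s * (norm u)\<^sup>2 / 2)) * indicator {1..} s"
  have inner: "(\<integral>\<^sup>+s. ?f s u \<partial>lborel) = ennreal (h u * (norm u)\<^sup>2 ^ k * exp (- (norm u)\<^sup>2 / 2))" if "u \<noteq> 0" for u
  proof -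
    define a where "a = (norm u)\<^sup>2 / 2"
    have a: "a > 0" using that by (simp add: a_def)
    have "(\<integral>\<^sup>+s. ?f s u \<partial>lborel) = (\<integral>\<^sup>+s. ennreal (h u * (norm u)\<^sup>2 ^ k) * (ennreal (a * exp (- s * a)) * indicator {1..} s) \<partial>lborel)"
    proof (rule nn_integral_cong)
      fix s :: real
      have e: "h u * (norm u)\<^sup>2 ^ Suc k / 2 * exp (- s * (norm u)\<^sup>2 / 2) = (h u * (norm u)\<^sup>2 ^ k) * (a * exp (- s * a))"
        by (simp add: a_def)
      have e1: "0 \<le> h u * (norm u)\<^sup>2 ^ k" and e2: "0 \<le> a * exp (- s * a)" using nn[of u] a by simp_all
      show "?f s u = ennreal (h u * (norm u)\<^sup>2 ^ k) * (ennreal (a * exp (- s * a)) * indicator {1..} s)"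
        unfolding e ennreal_mult[OF e1 e2] by (rule mult.assoc)
    qed
    also have "\<dots> = ennreal (h u * (norm u)\<^sup>2 ^ k) * ennreal (exp (- a))"
      unfolding nn_integral_exp_tail[OF a, symmetric] by (rule nn_integral_cmult) measurable
    finally show ?thesis using nn[of u] by (simp add: a_def ennreal_mult)
  qed
  have outer: "(\<integral>\<^sup>+u. ?f s u \<partial>lborel) = I (Suc k) * (ennreal (1 / 2) * (ennreal (1 / s ^ Suc (m + k)) * indicator {1..} s))" for s
  proof (cases "s \<ge> 1")
    case True
    \<comment> \<open>Rescaling by \<open>c\<close> removes s from the exponential; the volume gives
      s ^ (- m), since the dimension is 2 m, and the factor |u| ^ (2 k + 2) gives s ^ (- k -
      1).\<close>
    define c where "c = 1 / sqrt s"
    have c: "c > 0" "c\<^sup>2 = 1 / s" using True by (simp_all add: c_def power_divide)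
    have "(\<integral>\<^sup>+u. ?f s u \<partial>lborel) = ennreal (c ^ CARD('n)) * (\<integral>\<^sup>+u. ?f s (c *\<^sub>R u) \<partial>lborel)"
      by (subst nn_integral_lborel_scaleR[OF _ c(1)]) auto
    also have "(\<integral>\<^sup>+u. ?f s (c *\<^sub>R u) \<partial>lborel) =
       (\<integral>\<^sup>+u. ennreal (1 / 2 * (1 / s ^ Suc k)) * ennreal (h u * (norm u)\<^sup>2 ^ Suc k * exp (- (norm u)\<^sup>2 / 2)) \<partial>lborel)"
    proof (rule nn_integral_cong)
      fix u :: "real^'n"
      have n2: "(norm (c *\<^sub>R u))\<^sup>2 = (norm u)\<^sup>2 / s" using c by (simp add: power_mult_distrib)
      have "h (c *\<^sub>R u) * (norm (c *\<^sub>R u))\<^sup>2 ^ Suc k / 2 * exp (- s * (norm (c *\<^sub>R u))\<^sup>2 / 2) =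
          1 / 2 * (1 / s ^ Suc k) * (h u * (norm u)\<^sup>2 ^ Suc k * exp (- (norm u)\<^sup>2 / 2))"
        unfolding n2 hom[OF c(1)] using True by (simp add: power_divide field_simps)
      then show "?f s (c *\<^sub>R u) = ennreal (1 / 2 * (1 / s ^ Suc k)) * ennreal (h u * (norm u)\<^sup>2 ^ Suc k * exp (- (norm u)\<^sup>2 / 2))"
        using True nn[of u] by (simp add: ennreal_mult[symmetric])
    qed
    also have "\<dots> = ennreal (1 / 2 * (1 / s ^ Suc k)) * I (Suc k)"
      unfolding I_def by (rule nn_integral_cmult) measurable
    also have "ennreal (c ^ CARD('n)) * (ennreal (1 / 2 * (1 / s ^ Suc k)) * I (Suc k)) = (ennreal (c ^ CARD('n)) * ennreal (1 / 2 * (1 / s ^ Suc k))) * I (Suc k)"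
      by (simp only: mult.assoc)
    also have "ennreal (c ^ CARD('n)) * ennreal (1 / 2 * (1 / s ^ Suc k)) = ennreal (1 / 2) * ennreal (1 / s ^ Suc (m + k))"
    proof -
      have "c ^ CARD('n) = 1 / s ^ m" unfolding N power_mult c(2) by (simp add: power_divide)
      then have e: "c ^ CARD('n) * (1 / 2 * (1 / s ^ Suc k)) = 1 / 2 * (1 / s ^ Suc (m + k))" by (simp add: power_add)
      have "ennreal (c ^ CARD('n)) * ennreal (1 / 2 * (1 / s ^ Suc k)) = ennreal (c ^ CARD('n) * (1 / 2 * (1 / s ^ Suc k)))"
        by (rule ennreal_mult[symmetric]) (use True c(1) in auto)
      also have "\<dots> = ennreal (1 / 2) * ennreal (1 / s ^ Suc (m + k))"
        unfolding e by (rule ennreal_mult) (use True in auto)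
      finally show ?thesis .
    qed
    finally show ?thesis using True by (simp add: mult_ac del: power_Suc)
  qed simp
  have "I k = (\<integral>\<^sup>+u. (\<integral>\<^sup>+s. ?f s u \<partial>lborel) \<partial>lborel)"
    unfolding I_def by (rule nn_integral_cong_AE, rule AE_mp[OF AE_lborel_singleton[of 0]], intro AE_I2 impI)
       (rule inner[symmetric])
  also have "\<dots> = (\<integral>\<^sup>+s. (\<integral>\<^sup>+u. ?f s u \<partial>lborel) \<partial>lborel)"
    by (rule lborel_pair.Fubini') measurable
  also have "\<dots> = I (Suc k) * (ennreal (1 / 2) * ennreal (1 / real (m + k)))"
  proof -
    have "p > 0 \<Longrightarrow> (\<integral>\<^sup>+s. I (Suc k) * (ennreal (1 / 2) * (ennreal (1 / s ^ Suc p) * indicator {1..} s)) \<partial>lborel) =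
      I (Suc k) * (ennreal (1 / 2) * ennreal (1 / real p))" for p
      unfolding nn_integral_power_tail[symmetric] by (subst nn_integral_cmult; (subst nn_integral_cmult)?) measurable
    then show ?thesis unfolding outer using \<open>m > 0\<close> by simp
  qed
  finally have "ennreal (2 * real (m + k)) * I k = I (Suc k) * (ennreal (2 * real (m + k)) * (ennreal (1 / 2) * ennreal (1 / real (m + k))))"
    by (simp only: mult_ac)
  also have "ennreal (2 * real (m + k)) * (ennreal (1 / 2) * ennreal (1 / real (m + k))) = 1"
  proof -
    have *: "ennreal (2 * q) * (ennreal (1 / 2) * ennreal (1 / q)) = 1" if q: "q > 0" for q
    proof -
      have "ennreal (1 / 2) * ennreal (1 / q) = ennreal (1 / 2 * (1 / q))"
        by (rule ennreal_mult[symmetric]) (use q in auto)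
      moreover have "ennreal (2 * q) * ennreal (1 / 2 * (1 / q)) = ennreal (2 * q * (1 / 2 * (1 / q)))"
        by (rule ennreal_mult[symmetric]) (use q in auto)
      ultimately show ?thesis using q by simp
    qed
    show ?thesis by (rule *) (use \<open>m > 0\<close> in simp)
  qed
  finally show ?thesis by (simp add: I_def)
qed

lemma fact_eq_prod_shift:
  assumes "m > 0"
  shows "fact (m + n - 1) = fact (m - 1) * (\<Prod>k<n. real (m + k))"
proof -
  obtain q where "m = Suc q" using assms by (cases m) auto
  moreover have "fact (q + n) = fact q * (\<Prod>k<n. real (Suc q + k))"
    by (induction n) (simp_all add: algebra_simps)
  ultimately show ?thesis by simp
qed

definition gaussian_mass :: "'n::finite itself \<Rightarrow> real" where
  "gaussian_mass _ = (\<integral>u. exp (- (norm u)\<^sup>2 / 2) \<partial>(lborel :: (real^('n::finite)) measure))"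

lemma gaussian_mass_pos: "gaussian_mass TYPE('n::finite) > 0"
  unfolding gaussian_mass_def using integral_gaussian_pos[OF zero_less_one, where 'a = "real^'n"] by simp

text \<open>\<open>2 ^ n * n! * quad_moment l n\<close> is the \<open>n\<close>th moment of \<open>\<Sum>i. l\<^sub>i u\<^sub>i\<^sup>2\<close> for a standard Gaussian vector \<open>u\<close>,
  so that \<open>quad_moment l n\<close> are the Taylor coefficients of \<open>\<Prod>i. (1 - s l\<^sub>i) powr (-1/2)\<close>.\<close>
definition quad_moment :: "real^'n \<Rightarrow> nat \<Rightarrow> real" where
  "quad_moment l n = (\<integral>u. (\<Sum>i\<in>UNIV. l $ i * u $ i ^ 2) ^ n * exp (- (norm u)\<^sup>2 / 2) \<partial>lborel)
     / (gaussian_mass TYPE('n) * (2 ^ n * fact n))"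

lemma real_polynomial_function_quad: "real_polynomial_function (\<lambda>u::real^'n. (\<Sum>i\<in>UNIV. l $ i * u $ i ^ 2) ^ n)"
  by (intro real_polynomial_function_power real_polynomial_function_sum real_polynomial_function.intros(4)
      real_polynomial_function.intros(2) real_polynomial_function_vec_nth) auto

lemma integrable_quad_moment:
  "integrable lborel (\<lambda>u::real^'n. (\<Sum>i\<in>UNIV. l $ i * u $ i ^ 2) ^ n * exp (- (norm u)\<^sup>2 / 2))"
  using integrable_polynomial_times_gaussian[OF real_polynomial_function_quad zero_less_one, of l n] by simp

lemma quad_nonneg: "(\<And>i. 0 \<le> l $ i) \<Longrightarrow> 0 \<le> (\<Sum>i\<in>UNIV. l $ i * (u::real^'n) $ i ^ 2)"
  by (intro sum_nonneg) auto

lemma quad_moment_nonneg: "(\<And>i. 0 \<le> l $ i) \<Longrightarrow> 0 \<le> quad_moment l n"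
  unfolding quad_moment_def using gaussian_mass_pos[where 'n = 'a]
  by (intro divide_nonneg_nonneg integral_nonneg_AE) (auto intro!: AE_I2 mult_nonneg_nonneg zero_le_power quad_nonneg)

text \<open>Radius and direction decouple: multiplying the degree-0 function
  \<open>sphere_ratio l u ^ n\<close> by |u| ^ (2 n) turns it into a power of the quadratic form,
  and the n radial steps cost the factors 2 (m + k) for k < n.\<close>

lemma integral_sphere_ratio_power:
  fixes l :: "real^'n"
  assumes l: "\<And>i. 0 \<le> l $ i" and N: "CARD('n) = 2 * m"
  shows "(\<integral>u. sphere_ratio l u ^ n * exp (- (norm u)\<^sup>2 / 2) \<partial>lborel) =
     gaussian_mass TYPE('n) * (quad_moment l n * fact n * fact (m - 1) / fact (m + n - 1))"
proof -
  have m: "m > 0" using N by (cases m) auto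
  have nn: "0 \<le> sphere_ratio l u" for u unfolding sphere_ratio_def by (intro divide_nonneg_nonneg quad_nonneg l) auto
  define I where "I = (\<lambda>k. \<integral>\<^sup>+u. ennreal (sphere_ratio l u ^ n * (norm u)\<^sup>2 ^ k * exp (- (norm u)\<^sup>2 / 2)) \<partial>lborel)"
  have "sphere_ratio l (r *\<^sub>R u) = sphere_ratio l u" if "r > 0" for r u
  proof -
    have "(\<Sum>i\<in>UNIV. l $ i * (r *\<^sub>R u) $ i ^ 2) = r\<^sup>2 * (\<Sum>i\<in>UNIV. l $ i * u $ i ^ 2)"
      by (simp add: sum_distrib_left power_mult_distrib mult_ac)
    then show ?thesis using that by (simp add: sphere_ratio_def power_mult_distrib)
  qed
  then have rec: "I (Suc k) = ennreal (2 * real (m + k)) * I k" for k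
    unfolding I_def using nn by (intro gaussian_radial_recursion N) auto
  have I: "I k = ennreal (2 ^ k * (\<Prod>j<k. real (m + j))) * I 0" for k
  proof (induction k)
    case (Suc k)
    have "ennreal (2 * real (m + k)) * ennreal (2 ^ k * (\<Prod>j<k. real (m + j))) = ennreal (2 ^ Suc k * (\<Prod>j<Suc k. real (m + j)))"
    proof -
      have e1: "0 \<le> 2 ^ k * (\<Prod>j<k. real (m + j))" by (intro mult_nonneg_nonneg prod_nonneg) auto
      have e2: "2 ^ Suc k * (\<Prod>j<Suc k. real (m + j)) = 2 * real (m + k) * (2 ^ k * (\<Prod>j<k. real (m + j)))"
        by (simp only: power_Suc prod.lessThan_Suc mult_ac)
      show ?thesis unfolding e2 by (rule ennreal_mult[OF _ e1, symmetric]) simp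
    qed
    then show ?case unfolding rec Suc by (simp add: mult.assoc[symmetric] del: power_Suc prod.lessThan_Suc)
  qed simp
  let ?E = "\<integral>u. sphere_ratio l u ^ n * exp (- (norm u)\<^sup>2 / 2) \<partial>lborel"
  let ?V = "\<integral>u. (\<Sum>i\<in>UNIV. l $ i * u $ i ^ 2) ^ n * exp (- (norm u)\<^sup>2 / 2) \<partial>lborel"
  have "integrable lborel (\<lambda>u. sphere_ratio l u ^ n * exp (- 1 * (norm u)\<^sup>2 / 2))"
  proof (rule integrable_polynomial_growth_times_gaussian[where C = "norm l ^ n" and d = 0])
    show "\<bar>sphere_ratio l u ^ n\<bar> \<le> norm l ^ n * (1 + norm u) ^ 0" for u
      using power_mono[OF abs_sphere_ratio_le[of l u], of n] by (simp add: power_abs)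
  qed auto
  then have "I 0 = ennreal ?E"
    unfolding I_def by (subst nn_integral_eq_integral[symmetric]) (use nn in \<open>auto intro!: AE_I2 mult_nonneg_nonneg\<close>)
  moreover have "I n = ennreal ?V"
  proof -
    have "I n = (\<integral>\<^sup>+u. ennreal ((\<Sum>i\<in>UNIV. l $ i * u $ i ^ 2) ^ n * exp (- (norm u)\<^sup>2 / 2)) \<partial>lborel)"
      unfolding I_def
    proof (rule nn_integral_cong_AE, rule AE_mp[OF AE_lborel_singleton[of 0]], intro AE_I2 impI)
      fix u :: "real^'n" assume "u \<noteq> 0"
      then have "sphere_ratio l u ^ n * (norm u)\<^sup>2 ^ n = (\<Sum>i\<in>UNIV. l $ i * u $ i ^ 2) ^ n"
        by (simp add: sphere_ratio_def power_mult_distrib[symmetric])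
      then show "ennreal (sphere_ratio l u ^ n * (norm u)\<^sup>2 ^ n * exp (- (norm u)\<^sup>2 / 2)) =
         ennreal ((\<Sum>i\<in>UNIV. l $ i * u $ i ^ 2) ^ n * exp (- (norm u)\<^sup>2 / 2))" by simp
    qed
    also have "\<dots> = ennreal ?V"
      by (rule nn_integral_eq_integral[OF integrable_quad_moment]) (auto intro!: AE_I2 mult_nonneg_nonneg zero_le_power quad_nonneg l)
    finally show ?thesis .
  qed
  ultimately have eq: "ennreal ?V = ennreal (2 ^ n * (\<Prod>j<n. real (m + j))) * ennreal ?E" using I[of n] by simp
  have E0: "?E \<ge> 0" using nn by (intro integral_nonneg_AE) auto
  have V0: "?V \<ge> 0" using l by (intro integral_nonneg_AE) (auto intro!: AE_I2 mult_nonneg_nonneg zero_le_power quad_nonneg)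
  have VE: "?V = 2 ^ n * (\<Prod>j<n. real (m + j)) * ?E"
    using eq E0 V0 by (simp add: ennreal_mult[symmetric] prod_nonneg)
  define p where "p = (\<Prod>j<n. real (m + j))"
  have p: "p > 0" unfolding p_def using m by (intro prod_pos) auto
  have e: "quad_moment l n * fact n = p * ?E / gaussian_mass TYPE('n)"
    unfolding quad_moment_def VE p_def by simp
  show ?thesis
    unfolding fact_eq_prod_shift[OF m, of n] p_def[symmetric] e
    using gaussian_mass_pos[where 'n = 'n] p by simp
qed

text \<open>Termwise integration of the exponential series; the bound on \<open>sphere_ratio\<close>
  supplies a majorant that is itself an exponential series.\<close>

lemma sphere_average_sums:
  fixes l :: "real^'n"
  assumes l: "\<And>i. 0 \<le> l $ i" and N: "CARD('n) = 2 * m"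
  shows "(\<lambda>n. c ^ n * quad_moment l n * fact (m - 1) / fact (m + n - 1)) sums sphere_average c l"
proof -
  let ?f = "\<lambda>n u. c ^ n / fact n * (sphere_ratio l u ^ n * exp (- (norm u)\<^sup>2 / 2))"
  have int: "integrable lborel (\<lambda>u. sphere_ratio l u ^ n * exp (- (norm u)\<^sup>2 / 2))" for n
  proof -
    have "integrable lborel (\<lambda>u. sphere_ratio l u ^ n * exp (- 1 * (norm u)\<^sup>2 / 2))"
    proof (rule integrable_polynomial_growth_times_gaussian[where C = "norm l ^ n" and d = 0])
      show "\<bar>sphere_ratio l u ^ n\<bar> \<le> norm l ^ n * (1 + norm u) ^ 0" for u
        using power_mono[OF abs_sphere_ratio_le[of l u], of n] by (simp add: power_abs)
    qed auto
    then show ?thesis by simp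
  qed
  have suminf: "(\<lambda>n. ?f n u) sums (exp (- (norm u)\<^sup>2 / 2) * exp (c * sphere_ratio l u))" for u
    using sums_mult2[OF exp_converges[of "c * sphere_ratio l u"], of "exp (- (norm u)\<^sup>2 / 2)"]
    by (simp add: power_mult_distrib field_simps scaleR_conv_of_real)
  have bnd: "(\<integral>u. norm (?f n u) \<partial>lborel) \<le> gaussian_mass TYPE('n) * ((\<bar>c\<bar> * norm l) ^ n / fact n)" for n
  proof -
    have "(\<integral>u. norm (?f n u) \<partial>lborel) \<le> (\<integral>u. (\<bar>c\<bar> * norm l) ^ n / fact n * exp (- (norm u)\<^sup>2 / 2) \<partial>(lborel :: (real^'n) measure))"
    proof (rule integral_mono)
      show "integrable lborel (\<lambda>u. norm (?f n u))" using int by (intro integrable_norm integrable_mult_right)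
      show "integrable (lborel :: (real^'n) measure) (\<lambda>u. (\<bar>c\<bar> * norm l) ^ n / fact n * exp (- (norm u)\<^sup>2 / 2))"
        using integrable_polynomial_times_gaussian[OF real_polynomial_function.intros(2)[of 1] zero_less_one, where 'a = "real^'n"]
        by (intro integrable_mult_right) simp
      fix u :: "real^'n"
      have "\<bar>sphere_ratio l u\<bar> ^ n \<le> norm l ^ n" by (intro power_mono abs_sphere_ratio_le) simp
      then have "\<bar>c\<bar> ^ n / fact n * (\<bar>sphere_ratio l u\<bar> ^ n * exp (- (norm u)\<^sup>2 / 2)) \<le> \<bar>c\<bar> ^ n / fact n * (norm l ^ n * exp (- (norm u)\<^sup>2 / 2))"
        by (intro mult_left_mono mult_right_mono) auto
      then show "norm (?f n u) \<le> (\<bar>c\<bar> * norm l) ^ n / fact n * exp (- (norm u)\<^sup>2 / 2)"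
        by (simp add: abs_mult power_abs power_mult_distrib)
    qed
    then show ?thesis by (simp add: gaussian_mass_def mult.commute)
  qed
  have "(\<lambda>n. \<integral>u. ?f n u \<partial>lborel) sums (\<integral>u. (\<Sum>n. ?f n u) \<partial>lborel)"
  proof (rule sums_integral)
    show "integrable lborel (?f n)" for n using int by (intro integrable_mult_right)
    have "summable (\<lambda>n. norm (?f n u))" for u
      using summable_mult2[OF summable_norm_exp[of "c * sphere_ratio l u"], of "exp (- (norm u)\<^sup>2 / 2)"]
      by (simp add: power_mult_distrib abs_mult field_simps)
    then show "AE u in lborel. summable (\<lambda>n. norm (?f n u))" by simp
    show "summable (\<lambda>n. \<integral>u. norm (?f n u) \<partial>lborel)"
    proof (rule summable_comparison_test'[where N = 0])
      show "summable (\<lambda>n. gaussian_mass TYPE('n) * ((\<bar>c\<bar> * norm l) ^ n / fact n))"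
        using summable_exp[of "\<bar>c\<bar> * norm l"] by (intro summable_mult) (simp add: field_simps)
      show "norm (\<integral>u. norm (?f n u) \<partial>lborel) \<le> gaussian_mass TYPE('n) * ((\<bar>c\<bar> * norm l) ^ n / fact n)" for n
        using bnd[of n] by simp
    qed
  qed
  also have "(\<integral>u. (\<Sum>n. ?f n u) \<partial>lborel) = gaussian_mass TYPE('n) * sphere_average c l"
    unfolding sums_unique[OF suminf, symmetric] using gaussian_mass_pos[where 'n = 'n]
    by (simp add: sphere_average_def gaussian_mass_def)
  finally have "(\<lambda>n. (\<integral>u. ?f n u \<partial>lborel) / gaussian_mass TYPE('n)) sums (gaussian_mass TYPE('n) * sphere_average c l / gaussian_mass TYPE('n))"
    by (rule sums_divide)
  moreover have "(\<integral>u. ?f n u \<partial>lborel) / gaussian_mass TYPE('n) = c ^ n * quad_moment l n * fact (m - 1) / fact (m + n - 1)" for n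
    using integral_sphere_ratio_power[OF l N, of n] gaussian_mass_pos[where 'n = 'n] by simp
  ultimately show ?thesis using gaussian_mass_pos[where 'n = 'n] by simp
qed

text \<open>The series, times the Gaussian mass, integrates exp (s q / 2) for the quadratic form q
  against the Gaussian; all terms are nonnegative, so sum and integral commute. The result is a
  Gaussian with variances 1 / (1 - s l i), and the scaling that makes it standard has the product on
  the right as its volume factor.\<close>

lemma quad_moment_sums:
  fixes l :: "real^'n"
  assumes l: "\<And>i. 0 \<le> l $ i" and s: "0 \<le> s" "\<And>i. s * l $ i < 1"
  shows "(\<lambda>n. quad_moment l n * s ^ n) sums (\<Prod>i\<in>UNIV. (1 - s * l $ i) powr (-1/2))"
proof -
  let ?G = "gaussian_mass TYPE('n)"
  let ?q = "\<lambda>u::real^'n. \<Sum>i\<in>UNIV. l $ i * u $ i ^ 2"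
  define p where "p = (\<Prod>i\<in>UNIV. (1 - s * l $ i) powr (-1/2))"
  have pw: "0 < (1 - s * l $ i) powr (-1/2)" for i
    unfolding powr_gt_zero using s(2)[of i] by linarith
  have p: "p > 0" unfolding p_def by (intro prod_pos ballI pw)
  let ?f = "\<lambda>n u. ennreal ((s / 2) ^ n / fact n * (?q u ^ n * exp (- (norm u)\<^sup>2 / 2)))"
  have terms: "(\<integral>\<^sup>+u. ?f n u \<partial>lborel) = ennreal (?G * (quad_moment l n * s ^ n))" for n
  proof -
    have "(\<integral>\<^sup>+u. ?f n u \<partial>lborel) = ennreal (\<integral>u. (s / 2) ^ n / fact n * (?q u ^ n * exp (- (norm u)\<^sup>2 / 2)) \<partial>lborel)"
      using s(1) l by (intro nn_integral_eq_integral integrable_mult_right integrable_quad_moment)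
        (auto intro!: AE_I2 mult_nonneg_nonneg divide_nonneg_nonneg zero_le_power quad_nonneg)
    also have "(\<integral>u. (s / 2) ^ n / fact n * (?q u ^ n * exp (- (norm u)\<^sup>2 / 2)) \<partial>lborel) = ?G * (quad_moment l n * s ^ n)"
      using gaussian_mass_pos[where 'n = 'n] by (simp add: quad_moment_def power_divide field_simps)
    finally show ?thesis .
  qed
  have "(\<Sum>n. ennreal (?G * (quad_moment l n * s ^ n))) = (\<integral>\<^sup>+u. (\<Sum>n. ?f n u) \<partial>lborel)"
    unfolding terms[symmetric] by (rule nn_integral_suminf[symmetric]) measurable
  also have "\<dots> = (\<integral>\<^sup>+u. ennreal (exp (- (\<Sum>i\<in>UNIV. (1 - s * l $ i) * u $ i ^ 2) / 2)) \<partial>(lborel :: (real^'n) measure))"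
  proof (rule nn_integral_cong)
    fix u :: "real^'n"
    have q: "0 \<le> s / 2 * ?q u" using s(1) quad_nonneg[of l u, OF l] by simp
    have "(\<lambda>n. (s / 2) ^ n / fact n * (?q u ^ n * exp (- (norm u)\<^sup>2 / 2))) sums (exp (s / 2 * ?q u) * exp (- (norm u)\<^sup>2 / 2))"
      using sums_mult2[OF exp_converges[of "s / 2 * ?q u"], of "exp (- (norm u)\<^sup>2 / 2)"]
      by (simp add: power_mult_distrib field_simps scaleR_conv_of_real)
    then have "(\<Sum>n. ?f n u) = ennreal (exp (s / 2 * ?q u) * exp (- (norm u)\<^sup>2 / 2))"
      using s(1) quad_nonneg[of l u, OF l] by (intro suminf_ennreal_eq) auto
    also have "exp (s / 2 * ?q u) * exp (- (norm u)\<^sup>2 / 2) = exp (- (\<Sum>i\<in>UNIV. (1 - s * l $ i) * u $ i ^ 2) / 2)"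
    proof -
      have "(norm u)\<^sup>2 = (\<Sum>i\<in>UNIV. u $ i ^ 2)" by (simp add: norm_vec_def L2_set_def sum_nonneg)
      then have "s / 2 * ?q u + - (norm u)\<^sup>2 / 2 = - (\<Sum>i\<in>UNIV. (1 - s * l $ i) * u $ i ^ 2) / 2"
        by (simp add: left_diff_distrib sum_subtractf sum_distrib_left mult_ac diff_divide_distrib sum_divide_distrib)
      then show ?thesis by (simp add: mult_exp_exp)
    qed
    finally show "(\<Sum>n. ?f n u) = ennreal (exp (- (\<Sum>i\<in>UNIV. (1 - s * l $ i) * u $ i ^ 2) / 2))" .
  qed
  also have "\<dots> = ennreal p * (\<integral>\<^sup>+u. ennreal (exp (- (\<Sum>i\<in>UNIV. (1 - s * l $ i) * (\<chi> i. (1 - s * l $ i) powr (-1/2) * u $ i) $ i ^ 2) / 2)) \<partial>(lborel :: (real^'n) measure))"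
    unfolding p_def by (intro nn_integral_lborel_scale_coordinates pw) measurable
  also have "(\<integral>\<^sup>+u. ennreal (exp (- (\<Sum>i\<in>UNIV. (1 - s * l $ i) * (\<chi> i. (1 - s * l $ i) powr (-1/2) * u $ i) $ i ^ 2) / 2)) \<partial>(lborel :: (real^'n) measure))
     = (\<integral>\<^sup>+u. ennreal (exp (- (norm u)\<^sup>2 / 2)) \<partial>(lborel :: (real^'n) measure))"
  proof (rule nn_integral_cong)
    fix u :: "real^'n"
    have "(1 - s * l $ i) * ((1 - s * l $ i) powr (-1/2) * u $ i) ^ 2 = u $ i ^ 2" for i
    proof -
      have "1 - s * l $ i > 0" using s(2)[of i] by simp
      then have "((1 - s * l $ i) powr (-1/2)) ^ 2 = 1 / (1 - s * l $ i)"
        by (simp add: power2_eq_square powr_add[symmetric] powr_minus_divide)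
      then show ?thesis using \<open>1 - s * l $ i > 0\<close> by (simp add: power_mult_distrib)
    qed
    then show "ennreal (exp (- (\<Sum>i\<in>UNIV. (1 - s * l $ i) * (\<chi> i. (1 - s * l $ i) powr (-1/2) * u $ i) $ i ^ 2) / 2)) = ennreal (exp (- (norm u)\<^sup>2 / 2))"
      by (simp add: norm_vec_def L2_set_def sum_nonneg)
  qed
  also have "\<dots> = ennreal ?G"
    unfolding gaussian_mass_def using integrable_polynomial_times_gaussian[OF real_polynomial_function.intros(2)[of 1] zero_less_one, where 'a = "real^'n"]
    by (intro nn_integral_eq_integral) auto
  finally have eq: "(\<Sum>n. ennreal (?G * (quad_moment l n * s ^ n))) = ennreal (p * ?G)"
    using p gaussian_mass_pos[where 'n = 'n] by (simp add: ennreal_mult)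
  have nn: "0 \<le> ?G * (quad_moment l n * s ^ n)" for n
    using gaussian_mass_pos[where 'n = 'n] quad_moment_nonneg[of l n] l s(1) by simp
  have "(\<lambda>n. ?G * (quad_moment l n * s ^ n)) sums (p * ?G)"
  proof -
    have sm: "summable (\<lambda>n. ?G * (quad_moment l n * s ^ n))"
      using eq nn by (intro summable_suminf_not_top) auto
    then have "ennreal (\<Sum>n. ?G * (quad_moment l n * s ^ n)) = ennreal (p * ?G)"
      using eq suminf_ennreal2[OF nn sm] by simp
    then have "(\<Sum>n. ?G * (quad_moment l n * s ^ n)) = p * ?G"
      using suminf_nonneg[OF sm nn] p gaussian_mass_pos[where 'n = 'n] by simp
    then show ?thesis using summable_sums[OF sm] by simp
  qed
  from sums_divide[OF this, of ?G] show ?thesis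
    using gaussian_mass_pos[where 'n = 'n] by (simp add: p_def)
qed

section \<open>The contour integral\<close>

text \<open>The logarithms of z and -z differ by i pi, with a sign given by the half-plane, and
  halving this leaves the factor -i or i. Points of the negative real axis are counted with the
  upper half-plane, as the principal branch does.\<close>

lemma powr_minus_half_reflect:
  assumes "Im z \<noteq> 0 \<or> Re z < 0"
  shows "z powr (-1/2) = (if Im z \<ge> 0 then - \<i> else \<i>) * (- z) powr (-1/2 :: complex)"
proof -
  have z: "z \<noteq> 0" using assms by auto
  have e2: "exp (\<i> * of_real pi / 2) = \<i>"
    using cis_pi_half unfolding cis_conv_exp by simp
  then have e1: "exp (- (\<i> * of_real pi / 2)) = - \<i>" by (simp add: exp_minus)
  show ?thesis
  proof (cases "Im z \<ge> 0")
    case True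
    then have "\<not> (Im z \<le> 0 \<and> \<not> (Re z < 0 \<and> Im z = 0))" using assms by auto
    then have "Ln z = Ln (- z) + \<i> * of_real pi" using Ln_minus[OF z] by auto
    then have "z powr (-1/2) = exp (- 1 / 2 * Ln (- z)) * exp (- (\<i> * of_real pi) / 2)"
      using z by (simp add: powr_def exp_add[symmetric] algebra_simps)
    then show ?thesis using True z by (simp add: e1 powr_def)
  next
    case False
    then have Lz: "Ln z = Ln (- z) - \<i> * of_real pi" using Ln_minus[OF z] by auto
    have "z powr (-1/2) = exp (- 1 / 2 * Ln z)" using z by (simp add: powr_def)
    also have "- 1 / 2 * Ln z = - 1 / 2 * Ln (- z) + \<i> * of_real pi / 2"
      unfolding Lz by (simp add: algebra_simps)
    finally have "z powr (-1/2) = exp (- 1 / 2 * Ln (- z)) * exp (\<i> * of_real pi / 2)"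
      by (simp only: exp_add)
    then show ?thesis using False z by (simp add: e2 powr_def)
  qed
qed

definition inv_sqrt_prod :: "real^'n \<Rightarrow> complex \<Rightarrow> complex" where
  "inv_sqrt_prod l t = (\<Prod>j\<in>UNIV. (t - of_real (l $ j)) powr (-1/2))"

text \<open>The segment from the smallest to the largest eigenvalue, in the form in which the
  contour hypotheses speak of it.\<close>

definition real_hull :: "real^'n \<Rightarrow> complex set" where
  "real_hull l = of_real ` {x. \<exists>i j. l $ i \<le> x \<and> x \<le> l $ j}"

lemma real_hull_eq:
  fixes l :: "real^'n"
  shows "real_hull l = closed_segment (of_real (Min (range (($) l)))) (of_real (Max (range (($) l))))"
proof -
  let ?a = "Min (range (($) l))" and ?b = "Max (range (($) l))"
  have ab: "?a \<le> ?b" by (meson Max_ge Min_le finite finite_imageI order_trans rangeI)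
  have "{x. \<exists>i j. l $ i \<le> x \<and> x \<le> l $ j} = {?a..?b}"
  proof (intro equalityI subsetI)
    fix x assume "x \<in> {x. \<exists>i j. l $ i \<le> x \<and> x \<le> l $ j}"
    then obtain i j where x: "l $ i \<le> x" "x \<le> l $ j" by blast
    have "?a \<le> l $ i" "l $ j \<le> ?b" by (auto intro!: Min_le Max_ge)
    from order_trans[OF this(1) x(1)] order_trans[OF x(2) this(2)] show "x \<in> {?a..?b}"
      unfolding atLeastAtMost_iff by (rule conjI)
  next
    fix x assume "x \<in> {?a..?b}"
    moreover have "?a \<in> range (($) l)" "?b \<in> range (($) l)" by (auto intro!: Min_in Max_in)
    ultimately show "x \<in> {x. \<exists>i j. l $ i \<le> x \<and> x \<le> l $ j}" by (metis (mono_tags) atLeastAtMost_iff imageE mem_Collect_eq)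
  qed
  then have "real_hull l = of_real ` closed_segment ?a ?b"
    unfolding real_hull_def using ab by (simp add: closed_segment_eq_real_ivl)
  then show ?thesis by (simp add: closed_segment_of_real)
qed

text \<open>\<open>U1\<close> omits the real axis up to the largest eigenvalue, and there each
  principal root is holomorphic. \<open>U2\<close> omits the real axis from the smallest eigenvalue
  on; there each root is rewritten through (l j - t) powr (-1/2) at the price of i or -i, and the
  even power of these factors is (-1) ^ (N / 2) on both sides of the axis. The two sets cover the
  complement of the hull.\<close>

lemma holomorphic_inv_sqrt_prod:
  fixes l :: "real^'n"
  assumes N: "even CARD('n)"
  shows "inv_sqrt_prod l holomorphic_on - real_hull l"
proof -
  define U1 where "U1 = {t. Im t \<noteq> 0} \<union> (\<Inter>j. {t. Re t > l $ j})"
  define U2 where "U2 = {t. Im t \<noteq> 0} \<union> (\<Inter>j. {t. Re t < l $ j})"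
  have op: "open U1" "open U2" unfolding U1_def U2_def
    by (intro open_Un open_INT ballI open_Collect_neq open_halfspace_Re_gt open_halfspace_Re_lt continuous_intros finite)+
  have sub: "- real_hull l \<subseteq> U1 \<union> U2"
  proof
    fix t assume t: "t \<in> - real_hull l"
    show "t \<in> U1 \<union> U2"
    proof (rule ccontr)
      assume "t \<notin> U1 \<union> U2"
      then obtain i j where "Im t = 0" "\<not> Re t > l $ j" "\<not> Re t < l $ i" by (auto simp: U1_def U2_def)
      then have "t = of_real (Re t)" "l $ i \<le> Re t" "Re t \<le> l $ j" by (auto simp: complex_eq_iff)
      then show False using t unfolding real_hull_def by blast
    qed
  qed
  have h1: "inv_sqrt_prod l holomorphic_on U1"
    unfolding inv_sqrt_prod_def[abs_def]
    by (intro holomorphic_on_prod holomorphic_on_powr holomorphic_intros)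
       (auto simp: U1_def complex_nonpos_Reals_iff, meson not_le)
  have eq: "inv_sqrt_prod l t = (-1) ^ (CARD('n) div 2) * (\<Prod>j\<in>UNIV. (of_real (l $ j) - t) powr (-1/2))" if "t \<in> U2" for t
  proof -
    have "inv_sqrt_prod l t = (\<Prod>j\<in>(UNIV::'n set). (if Im t \<ge> 0 then - \<i> else \<i>) * (of_real (l $ j) - t) powr (-1/2))"
      unfolding inv_sqrt_prod_def
    proof (rule prod.cong[OF refl])
      fix j :: 'n
      have "Im (t - of_real (l $ j)) \<noteq> 0 \<or> Re (t - of_real (l $ j)) < 0" using that by (auto simp: U2_def)
      from powr_minus_half_reflect[OF this]
      show "(t - of_real (l $ j)) powr (-1/2) = (if Im t \<ge> 0 then - \<i> else \<i>) * (of_real (l $ j) - t) powr (-1/2)" by simp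
    qed
    also have "\<dots> = (if Im t \<ge> 0 then - \<i> else \<i>) ^ CARD('n) * (\<Prod>j\<in>UNIV. (of_real (l $ j) - t) powr (-1/2))"
      by (simp add: prod.distrib)
    also have "(if Im t \<ge> 0 then - \<i> else \<i>) ^ CARD('n) = (-1) ^ (CARD('n) div 2)"
    proof -
      obtain k where k: "CARD('n) = 2 * k" using N by (elim evenE)
      show ?thesis unfolding k power_mult by simp
    qed
    finally show ?thesis .
  qed
  have "(\<lambda>t. (-1) ^ (CARD('n) div 2) * (\<Prod>j\<in>UNIV. (of_real (l $ j) - t) powr (-1/2))) holomorphic_on U2"
    by (intro holomorphic_on_mult holomorphic_on_const holomorphic_on_prod holomorphic_on_powr holomorphic_intros)
       (auto simp: U2_def complex_nonpos_Reals_iff, meson not_le)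
  then have h2: "inv_sqrt_prod l holomorphic_on U2"
    by (rule holomorphic_transform) (simp add: eq)
  show ?thesis using holomorphic_on_Un[OF h1 h2 op] sub holomorphic_on_subset by blast
qed

text \<open>Two cycles with the same winding numbers around the complement of the domain give the same
  integral: join them by a path and apply the global Cauchy theorem.\<close>
lemma contour_integral_eq_if_winding_number_eq:
  assumes S: "open S" "connected S" and hol: "f holomorphic_on S"
    and g: "valid_path g" "pathfinish g = pathstart g" "path_image g \<subseteq> S"
    and h: "valid_path h" "pathfinish h = pathstart h" "path_image h \<subseteq> S"
    and w: "\<And>z. z \<notin> S \<Longrightarrow> winding_number g z = winding_number h z"
  shows "contour_integral g f = contour_integral h f"
proof -
  have ends: "pathstart g \<in> S" "pathstart h \<in> S" using g(3) h(3) pathstart_in_path_image by blast+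
  obtain p where p: "polynomial_function p" "path_image p \<subseteq> S" "pathstart p = pathstart g" "pathfinish p = pathstart h"
    using connected_open_polynomial_connected[OF S ends] by blast
  have vp: "valid_path p" by (rule valid_path_polynomial_function[OF p(1)])
  define q where "q = g +++ (p +++ (reversepath h +++ reversepath p))"
  have vq: "valid_path q" unfolding q_def using g h p vp by (auto intro!: valid_path_join)
  have loop: "pathfinish q = pathstart q" unfolding q_def using g p by simp
  have im: "path_image q \<subseteq> S" unfolding q_def using g h p vp
    by (auto simp: path_image_join valid_path_imp_path)
  have wn: "winding_number q z = 0" if "z \<notin> S" for z
  proof -
    have n: "z \<notin> path_image g" "z \<notin> path_image h" "z \<notin> path_image p" using that g h p by auto
    have pt: "path g" "path h" "path p" using g h vp by (auto simp: valid_path_imp_path)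
    have "winding_number q z = winding_number g z + (winding_number p z + (winding_number (reversepath h) z + winding_number (reversepath p) z))"
      unfolding q_def using n pt g h p by (simp add: winding_number_join path_image_join)
    then show ?thesis using w[OF that] n pt by (simp add: winding_number_reversepath)
  qed
  have ci: "f contour_integrable_on c" if "valid_path c" "path_image c \<subseteq> S" for c
    using contour_integrable_holomorphic_simple[OF hol S(1) that] .
  have "contour_integral q f = 0"
    using Cauchy_theorem_global[OF S(1) hol vq loop im wn] contour_integral_unique by blast
  moreover have "contour_integral q f = contour_integral g f + (contour_integral p f + (contour_integral (reversepath h) f + contour_integral (reversepath p) f))"
    unfolding q_def using g h p vp ci by (simp add: contour_integrable_reversepath)
  ultimately show ?thesis using h vp by (simp add: contour_integral_reversepath)
qed

lemma higher_deriv_exp_mult: "(deriv ^^ k) (\<lambda>t::complex. exp (c * t)) = (\<lambda>t. c ^ k * exp (c * t))"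
proof (induction k)
  case (Suc k)
  have "deriv (\<lambda>t::complex. c ^ k * exp (c * t)) t = c ^ Suc k * exp (c * t)" for t
    by (rule DERIV_imp_deriv) (auto intro!: derivative_eq_intros)
  then show ?case by (simp add: Suc fun_eq_iff)
qed simp

lemma contour_integral_exp_over_power:
  assumes "R > 0"
  shows "((\<lambda>t. exp (c * t) / t ^ Suc k) has_contour_integral (2 * of_real pi * \<i>) / fact k * c ^ k) (circlepath 0 R)"
proof -
  have "continuous_on (cball 0 R) (\<lambda>t. exp (c * t))" "(\<lambda>t. exp (c * t)) holomorphic_on ball 0 R" "0 \<in> ball (0::complex) R"
    using assms by (auto intro!: continuous_intros holomorphic_intros)
  from Cauchy_has_contour_integral_higher_derivative_circlepath[OF this, of k] show ?thesis
    by (simp add: higher_deriv_exp_mult del: power_Suc)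
qed

text \<open>On the real ray beyond b the expansion is \<open>quad_moment_sums\<close> at s = 1 / t,
  with (1 / t) ^ m from the leading powers of t. Both sides are holomorphic on the exterior of the
  closed disc of radius b, a connected set, so the identity theorem extends the equation to all t
  there.\<close>

lemma inv_sqrt_prod_sums:
  fixes l :: "real^'n"
  assumes l: "\<And>i. 0 \<le> l $ i" "\<And>i. l $ i \<le> b" and N: "CARD('n) = 2 * m" and b: "b > 0" and t: "norm t > b"
  shows "(\<lambda>n. of_real (quad_moment l n) * (1 / t) ^ (m + n)) sums inv_sqrt_prod l t"
    and "summable (\<lambda>n. quad_moment l n * (1 / norm t) ^ n)"
proof -
  have sm: "summable (\<lambda>n. quad_moment l n * (1 / r) ^ n)" if "r > b" for r
  proof -
    have "1 / r * l $ i < 1" for i using l(2)[of i] that b by (simp add: field_simps)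
    then show ?thesis using quad_moment_sums[of l "1 / r", OF l(1)] that b by (auto simp: sums_iff)
  qed
  then show "summable (\<lambda>n. quad_moment l n * (1 / norm t) ^ n)" using t .
  define k where "k = (\<lambda>z::complex. \<Sum>n. of_real (quad_moment l n) * z ^ n)"
  have ks: "summable (\<lambda>n. of_real (quad_moment l n) * z ^ n)" if "norm z < 1 / b" for z :: complex
  proof (cases "z = 0")
    case False
    have "1 / norm z > b" using that False b by (simp add: field_simps)
    from sm[OF this] have "summable (\<lambda>n. norm (of_real (quad_moment l n) * z ^ n))"
      by (simp add: norm_mult norm_power quad_moment_nonneg[of l, OF l(1)])
    then show ?thesis by (rule summable_norm_cancel)
  next
    case True
    then show ?thesis using powser_sums_zero[of "\<lambda>n. of_real (quad_moment l n) :: complex"] by (auto simp: sums_iff)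
  qed
  have invb: "norm (1 / z) < 1 / b" if "norm z > b" for z :: complex
  proof -
    have "1 / norm z < 1 / b" using that b by (intro divide_strict_left_mono mult_pos_pos) auto
    then show ?thesis by (simp add: norm_divide)
  qed
  have kh: "k holomorphic_on ball 0 (1 / b)"
  proof (rule power_series_holomorphic)
    fix z :: complex assume "z \<in> ball 0 (1 / b)"
    then have "norm z < 1 / b" by simp
    from summable_sums[OF ks[OF this]] show "(\<lambda>n. of_real (quad_moment l n) * (z - 0) ^ n) sums k z"
      by (simp add: k_def)
  qed
  let ?W = "- cball (0::complex) b"
  have W: "open ?W" "connected ?W"
    by (auto intro!: connected_complement_bounded_convex simp: open_Compl)
  have hullW: "?W \<subseteq> - real_hull l"
  proof -
    have "norm (of_real x :: complex) \<le> b" if "l $ i \<le> x" "x \<le> l $ j" for i j x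
      using that l(1)[of i] l(2)[of j] by simp
    then show ?thesis by (force simp: real_hull_def)
  qed
  define F where "F = (\<lambda>t. inv_sqrt_prod l t - (1 / t) ^ m * k (1 / t))"
  have Fhol: "F holomorphic_on ?W"
  proof -
    have 1: "inv_sqrt_prod l holomorphic_on ?W"
      using holomorphic_inv_sqrt_prod[of l] N hullW holomorphic_on_subset by auto
    have inv: "(\<lambda>t. 1 / t) holomorphic_on ?W" using b by (intro holomorphic_intros) auto
    have "(\<lambda>t. 1 / t) ` ?W \<subseteq> ball 0 (1 / b)"
      using invb by auto
    then have "(\<lambda>t. k (1 / t)) holomorphic_on ?W"
      using holomorphic_on_compose_gen[OF inv kh] by (simp add: o_def)
    then show ?thesis unfolding F_def by (intro holomorphic_intros 1 inv)
  qed
  have Fzero: "F (of_real x) = 0" if "x > b" for x :: real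
  proof -
    have x: "x > 0" using that b by simp
    have lx: "l $ i < x" for i using l(2)[of i] that by simp
    have c1: "1 / x * l $ i < 1" for i using lx[of i] x by (simp add: field_simps)
    have "(\<lambda>n. quad_moment l n * (1 / x) ^ n) sums (\<Prod>i\<in>UNIV. (1 - 1 / x * l $ i) powr (-1/2))"
      using quad_moment_sums[of l "1 / x", OF l(1) _ c1] x by simp
    then have "(\<lambda>n. complex_of_real (quad_moment l n * (1 / x) ^ n)) sums of_real (\<Prod>i\<in>UNIV. (1 - 1 / x * l $ i) powr (-1/2))"
      by (rule sums_of_real)
    then have e1: "k (1 / of_real x) = of_real (\<Prod>i\<in>UNIV. (1 - 1 / x * l $ i) powr (-1/2))"
      unfolding k_def by (simp add: sums_iff)
    have e2: "inv_sqrt_prod l (of_real x) = of_real (\<Prod>j\<in>UNIV. (x - l $ j) powr (-1/2))"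
    proof -
      have "(of_real x - of_real (l $ j)) powr (-1/2) = complex_of_real ((x - l $ j) powr (-1/2))" for j
        using powr_of_real[of "x - l $ j" "-1/2"] lx[of j] by simp
      then show ?thesis by (simp add: inv_sqrt_prod_def)
    qed
    have e3: "(\<Prod>j\<in>UNIV. (x - l $ j) powr (-1/2)) = (1 / x) ^ m * (\<Prod>i\<in>UNIV. (1 - 1 / x * l $ i) powr (-1/2))"
    proof -
      have "(x - l $ j) powr (-1/2) = x powr (-1/2) * (1 - 1 / x * l $ j) powr (-1/2)" for j
      proof -
        have "x - l $ j = x * (1 - 1 / x * l $ j)" using x by (simp add: field_simps)
        then show ?thesis using x c1[of j] by (simp only: powr_mult less_imp_le diff_ge_0_iff_ge) 
      qed
      then have "(\<Prod>j\<in>UNIV. (x - l $ j) powr (-1/2)) = (x powr (-1/2)) ^ CARD('n) * (\<Prod>i\<in>UNIV. (1 - 1 / x * l $ i) powr (-1/2))"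
        by (simp add: prod.distrib)
      also have "(x powr (-1/2)) ^ CARD('n) = (1 / x) ^ m"
      proof -
        have "(x powr (-1/2)) ^ 2 = 1 / x" using x by (simp add: power2_eq_square powr_add[symmetric] powr_minus_divide)
        then show ?thesis unfolding N power_mult by simp
      qed
      finally show ?thesis .
    qed
    show ?thesis
      unfolding F_def e1 e2 e3 by (simp only: of_real_mult of_real_power of_real_divide of_real_1 diff_self)
  qed
  \<comment> \<open>The zeros of \<open>F\<close> on the real ray accumulate at a point inside the
    exterior of the disc.\<close>
  have lim: "of_real (b + 2) islimpt (of_real ` {b + 1<..} :: complex set)"
  proof -
    have "\<exists>y\<in>complex_of_real ` {b + 1<..}. y \<noteq> of_real (b + 2) \<and> dist y (of_real (b + 2)) < e" if "e > 0" for e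
    proof (intro bexI conjI)
      show "complex_of_real (b + 2 + e / 2) \<noteq> of_real (b + 2)" unfolding of_real_eq_iff using that by simp
      show "dist (complex_of_real (b + 2 + e / 2)) (of_real (b + 2)) < e"
        unfolding dist_of_real using that by (simp add: dist_real_def)
      show "complex_of_real (b + 2 + e / 2) \<in> of_real ` {b + 1<..}" by (rule imageI) (use that in auto)
    qed
    then show ?thesis unfolding islimpt_approachable by blast
  qed
  have inW: "complex_of_real x \<in> ?W" if "x > b" for x
    unfolding Compl_iff mem_cball_0 norm_of_real using that b by simp
  have "complex_of_real ` {b + 1<..} \<subseteq> ?W" using inW by auto
  moreover have "complex_of_real (b + 2) \<in> ?W" by (rule inW) simp
  moreover have "F z = 0" if "z \<in> complex_of_real ` {b + 1<..}" for z using that Fzero by auto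
  moreover have "t \<in> ?W" using t by simp
  ultimately have "F t = 0" using analytic_continuation[OF Fhol W _ _ lim] by blast
  then have Ft: "inv_sqrt_prod l t = (1 / t) ^ m * k (1 / t)" by (simp add: F_def)
  from sums_mult[OF summable_sums[OF ks[OF invb[OF t]]], of "(1 / t) ^ m"]
  show "(\<lambda>n. of_real (quad_moment l n) * (1 / t) ^ (m + n)) sums inv_sqrt_prod l t"
    unfolding Ft k_def by (simp add: power_add mult_ac)
qed

lemma contour_integrable_spike:
  fixes l :: "real^'n"
  assumes "even CARD('n)" "valid_path \<gamma>" "path_image \<gamma> \<inter> real_hull l = {}"
  shows "(\<lambda>t. exp (of_real c * t) * inv_sqrt_prod l t) contour_integrable_on \<gamma>"
proof (rule contour_integrable_holomorphic_simple[where S = "- real_hull l"])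
  show "(\<lambda>t. exp (of_real c * t) * inv_sqrt_prod l t) holomorphic_on - real_hull l"
    by (intro holomorphic_intros holomorphic_inv_sqrt_prod assms)
  show "open (- real_hull l)" unfolding real_hull_eq by (auto intro!: open_Compl)
qed (use assms in auto)

text \<open>The contour may be replaced by a circle around the hull, on which the series of
  \<open>inv_sqrt_prod\<close> converges uniformly. The term of order n leaves c ^ (m + n - 1) / (m
  + n - 1)!, which matches the series of \<open>sphere_average\<close> once c ^ (m - 1) / (m - 1)!
  is split off.\<close>

theorem contour_integral_spike:
  fixes l :: "real^'n" and c :: real
  assumes l: "\<And>i. 0 < l $ i" and N: "CARD('n) = 2 * m"
    and g: "valid_path \<gamma>" "pathfinish \<gamma> = pathstart \<gamma>"
    and w: "\<And>x. (\<exists>i j. l $ i \<le> x \<and> x \<le> l $ j) \<Longrightarrow> of_real x \<notin> path_image \<gamma> \<and> winding_number \<gamma> (of_real x) = 1"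
  shows "contour_integral \<gamma> (\<lambda>t. exp (of_real c * t) * inv_sqrt_prod l t) =
    2 * of_real pi * \<i> * of_real (c ^ (m - 1) / fact (m - 1) * sphere_average c l)"
proof -
  have m: "m > 0" using N by (cases m) auto
  define b where "b = Max (range (($) l))"
  have lb: "l $ i \<le> b" for i by (simp add: b_def)
  have b: "b > 0" using l lb less_le_trans by blast
  define R where "R = b + 1"
  have R: "R > b" "R > 0" using b by (simp_all add: R_def)
  let ?f = "\<lambda>t. exp (of_real c * t) * inv_sqrt_prod l t"
  let ?S = "- real_hull l"
  have hol: "?f holomorphic_on ?S"
    using N by (intro holomorphic_intros holomorphic_inv_sqrt_prod) auto
  have S: "open ?S" "connected ?S"
    unfolding real_hull_eq by (auto intro!: open_Compl connected_complement_bounded_convex bounded_closed_segment)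
  have hull: "norm z \<le> b" if "z \<in> real_hull l" for z
  proof -
    from that obtain x where x: "z = of_real x" "\<exists>i j. l $ i \<le> x \<and> x \<le> l $ j"
      unfolding real_hull_def by blast
    then obtain i j where "l $ i \<le> x" "x \<le> l $ j" by blast
    with x(1) show ?thesis using l[of i] lb[of j] by simp
  qed
  have "contour_integral \<gamma> ?f = contour_integral (circlepath 0 R) ?f"
  proof (rule contour_integral_eq_if_winding_number_eq[OF S hol g])
    show "path_image \<gamma> \<subseteq> ?S" using w by (auto simp: real_hull_def)
    show "path_image (circlepath 0 R) \<subseteq> ?S" using hull R by (force simp: path_image_circlepath_nonneg)
    fix z assume "z \<notin> ?S"
    then have z: "z \<in> real_hull l" by simp
    then have "winding_number \<gamma> z = 1" using w by (auto simp: real_hull_def)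
    moreover have "winding_number (circlepath 0 R) z = 1"
      using hull[OF z] R by (intro winding_number_circlepath) auto
    ultimately show "winding_number \<gamma> z = winding_number (circlepath 0 R) z" by simp
  qed auto
  also have "contour_integral (circlepath 0 R) ?f = (\<Sum>n. of_real (quad_moment l n) * (2 * of_real pi * \<i> / fact (m + n - 1) * of_real c ^ (m + n - 1)))"
  proof -
    let ?t = "\<lambda>n (t::complex). exp (of_real c * t) * (of_real (quad_moment l n) * (1 / t) ^ (m + n))"
    have tint: "(?t n has_contour_integral of_real (quad_moment l n) * (2 * of_real pi * \<i> / fact (m + n - 1) * of_real c ^ (m + n - 1))) (circlepath 0 R)" for n
    proof -
      have "(\<lambda>t. of_real (quad_moment l n) * (exp (of_real c * t) / t ^ Suc (m + n - 1))) = ?t n"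
        using m by (simp add: fun_eq_iff power_divide)
      then show ?thesis
        using has_contour_integral_lmul[OF contour_integral_exp_over_power[OF R(2), of "of_real c" "m + n - 1"], of "of_real (quad_moment l n)"]
        by simp
    qed
    have unif: "uniform_limit (sphere 0 R) (\<lambda>K t. \<Sum>n<K. ?t n t) ?f sequentially"
    proof -
      have U: "uniform_limit (sphere 0 R) (\<lambda>K t. \<Sum>n<K. ?t n t) (\<lambda>t. \<Sum>n. ?t n t) sequentially"
      proof (rule Weierstrass_m_test)
        fix n and t :: complex assume "t \<in> sphere 0 R"
        then have t: "norm t = R" by simp
        have "norm (exp (of_real c * t)) \<le> exp (\<bar>c\<bar> * R)"
          using norm_exp[of "of_real c * t"] t by (simp add: norm_mult)
        then show "norm (?t n t) \<le> exp (\<bar>c\<bar> * R) * ((1 / R) ^ m * (quad_moment l n * (1 / R) ^ n))"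
          using R quad_moment_nonneg[of l n] l
          by (simp add: norm_mult norm_power norm_divide t power_add mult_ac less_imp_le mult_mono)
      next
        have "norm (of_real R :: complex) > b" using R by simp
        from inv_sqrt_prod_sums(2)[OF _ lb N b this] l
        have "summable (\<lambda>n. quad_moment l n * (1 / R) ^ n)" using R by (simp add: less_imp_le)
        then show "summable (\<lambda>n. exp (\<bar>c\<bar> * R) * ((1 / R) ^ m * (quad_moment l n * (1 / R) ^ n)))"
          by (intro summable_mult)
      qed
      have E: "(\<Sum>n. ?t n t) = ?f t" if "t \<in> sphere 0 R" for t
      proof -
        have "norm t > b" using that R by simp
        from sums_mult[OF inv_sqrt_prod_sums(1)[OF _ lb N b this], of "exp (of_real c * t)"] l
        show ?thesis by (simp add: sums_iff less_imp_le)
      qed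
      show ?thesis by (rule uniform_limit_cong'[THEN iffD1, OF refl E U])
    qed
    have pint: "((\<lambda>t. \<Sum>n<K. ?t n t) has_contour_integral (\<Sum>n<K. of_real (quad_moment l n) * (2 * of_real pi * \<i> / fact (m + n - 1) * of_real c ^ (m + n - 1)))) (circlepath 0 R)" for K
      by (intro has_contour_integral_sum tint) auto
    have "(\<lambda>K. contour_integral (circlepath 0 R) (\<lambda>t. \<Sum>n<K. ?t n t)) \<longlonglongrightarrow> contour_integral (circlepath 0 R) ?f"
      using contour_integral_uniform_limit_circlepath(2)[OF _ unif _ R(2)] pint
      by (auto simp: contour_integrable_on_def intro!: always_eventually)
    then have "(\<lambda>n. of_real (quad_moment l n) * (2 * of_real pi * \<i> / fact (m + n - 1) * of_real c ^ (m + n - 1))) sums contour_integral (circlepath 0 R) ?f"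
      unfolding sums_def contour_integral_unique[OF pint] .
    then show ?thesis by (simp add: sums_iff)
  qed
  also have "\<dots> = 2 * of_real pi * \<i> * of_real (c ^ (m - 1) / fact (m - 1) * sphere_average c l)"
  proof -
    have eq: "2 * of_real pi * \<i> * of_real (c ^ (m - 1) / fact (m - 1) * (c ^ n * quad_moment l n * fact (m - 1) / fact (m + n - 1)))
      = of_real (quad_moment l n) * (2 * of_real pi * \<i> / fact (m + n - 1) * of_real c ^ (m + n - 1))" for n
    proof -
      have "m + n - 1 = (m - 1) + n" using m by simp
      then show ?thesis by (simp add: power_add field_simps)
    qed
    have "(\<lambda>n. 2 * of_real pi * \<i> * of_real (c ^ (m - 1) / fact (m - 1) * (c ^ n * quad_moment l n * fact (m - 1) / fact (m + n - 1))))
       sums (2 * of_real pi * \<i> * of_real (c ^ (m - 1) / fact (m - 1) * sphere_average c l))"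
      using l by (intro sums_mult sums_of_real sphere_average_sums N) (simp add: less_imp_le)
    then show ?thesis unfolding eq by (simp add: sums_iff)
  qed
  finally show ?thesis .
qed

section \<open>The spiked eigenvalue law\<close>

text \<open>The square of the product runs over all ordered pairs of distinct indices, and a
  permutation merely rearranges those.\<close>

lemma abs_vandermonde_permute:
  fixes l :: "real^('n::{finite,linorder})"
  assumes p: "p permutes (UNIV :: 'n set)"
  shows "abs_vandermonde (\<chi> i. l $ p i) = abs_vandermonde l"
proof -
  have sq: "(abs_vandermonde l)\<^sup>2 = (\<Prod>(a, b)\<in>{(a, b). a \<noteq> b}. \<bar>l $ b - l $ a\<bar>)" for l :: "(real,'n) vec"
  proof -
    have "{(a::'n, b). a \<noteq> b} = {(a, b). a < b} \<union> {(a, b). b < a}" by auto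
    then have "(\<Prod>(a, b)\<in>{(a, b). a \<noteq> b}. \<bar>l $ b - l $ a\<bar>) =
        (\<Prod>(a, b)\<in>{(a, b). a < b}. \<bar>l $ b - l $ a\<bar>) * (\<Prod>(a, b)\<in>{(a, b). b < a}. \<bar>l $ b - l $ a\<bar>)"
      by (simp only:) (rule prod.union_disjoint, auto)
    also have "(\<Prod>(a, b)\<in>{(a::'n, b). b < a}. \<bar>l $ b - l $ a\<bar>) = (\<Prod>(a, b)\<in>{(a, b). a < b}. \<bar>l $ b - l $ a\<bar>)"
      by (rule prod.reindex_bij_witness[of _ prod.swap prod.swap]) (auto simp: abs_minus_commute)
    finally show ?thesis by (simp add: abs_vandermonde_def power2_eq_square)
  qed
  have inj: "p a = p b \<longleftrightarrow> a = b" for a b using permutes_inj[OF p] by (auto simp: inj_def)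
  have "(abs_vandermonde (\<chi> i. l $ p i))\<^sup>2 = (\<Prod>(a, b)\<in>{(a, b). a \<noteq> b}. \<bar>l $ p b - l $ p a\<bar>)"
    unfolding sq by (simp add: split_beta)
  also have "\<dots> = (\<Prod>(a, b)\<in>{(a, b). a \<noteq> b}. \<bar>l $ b - l $ a\<bar>)"
    by (rule prod.reindex_bij_witness[of _ "map_prod (inv p) (inv p)" "map_prod p p"])
       (auto simp: inj permutes_inverses[OF p] dest!: arg_cong[of "inv p _" _ p])
  also have "\<dots> = (abs_vandermonde l)\<^sup>2" by (simp only: sq)
  finally show ?thesis by (simp add: abs_vandermonde_nonneg power2_eq_iff_nonneg)
qed

lemma symmetric_fun_wishart_weight:
  "symmetric_fun (wishart_weight \<alpha> s :: real^('n::{finite,linorder}) \<Rightarrow> real)"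
  unfolding symmetric_fun_def
proof (intro allI impI)
  fix l :: "(real,'n) vec" and p :: "'n \<Rightarrow> 'n" assume p: "p permutes UNIV"
  have "(\<forall>i. 0 < (\<chi> i. l $ p i) $ i) \<longleftrightarrow> (\<forall>i. 0 < l $ i)"
    by simp (metis permutes_inverses(1)[OF p])
  then have "indicator {l::(real,'n) vec. \<forall>i. 0 < l $ i} (\<chi> i. l $ p i) = (indicator {l. \<forall>i. 0 < l $ i} l :: real)"
    unfolding indicator_def mem_Collect_eq by presburger
  moreover have "(\<Prod>i\<in>UNIV. (\<chi> i. l $ p i) $ i powr \<alpha>) = (\<Prod>i\<in>UNIV. l $ i powr \<alpha>)"
    using prod.permute[OF p, of "\<lambda>i. l $ i powr \<alpha>"] by (simp add: o_def)
  moreover have "(\<Sum>i\<in>UNIV. (\<chi> i. l $ p i) $ i) = (\<Sum>i\<in>UNIV. l $ i)"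
    using sum.permute[OF p, of "\<lambda>i. l $ i"] by (simp add: o_def)
  ultimately show "wishart_weight \<alpha> s (\<chi> i. l $ p i) = wishart_weight \<alpha> s l"
    unfolding wishart_weight_def abs_vandermonde_permute[OF p] by simp
qed

lemma symmetric_fun_eigvals_scaleR_gram:
  fixes X :: "real^'m^'n"
  assumes f: "symmetric_fun f"
  shows "f (eigvals (r *\<^sub>R gram X)) = f (r *\<^sub>R eigvals (gram X))"
proof -
  obtain Q l where Q: "orthogonal_matrix Q" and A: "gram X = Q ** diag_mat l ** transpose Q"
    and "\<And>i. 0 \<le> l $ i" "\<And>k. ptr X k = psum l k"
    by (rule gram_diagonalization[of X]) blast
  have d: "diag_mat (r *\<^sub>R l) = r *\<^sub>R diag_mat l" by (simp add: diag_mat_def vec_eq_iff)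
  have rA: "r *\<^sub>R gram X = Q ** diag_mat (r *\<^sub>R l) ** transpose Q"
    unfolding A d by (simp add: bounded_bilinear.scaleR_left[OF bounded_bilinear_matrix_mult]
        bounded_bilinear.scaleR_right[OF bounded_bilinear_matrix_mult])
  have g: "symmetric_fun (\<lambda>l. f (r *\<^sub>R l))"
    unfolding symmetric_fun_def
  proof (intro allI impI)
    fix l :: "real^'n" and p :: "'n \<Rightarrow> 'n" assume p: "p permutes UNIV"
    have "r *\<^sub>R (\<chi> i. l $ p i) = (\<chi> i. (r *\<^sub>R l) $ p i)" by (simp add: vec_eq_iff)
    then show "f (r *\<^sub>R (\<chi> i. l $ p i)) = f (r *\<^sub>R l)" using f p by (simp only: symmetric_fun_def)
  qed
  have "f (eigvals (r *\<^sub>R gram X)) = f (r *\<^sub>R l)"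
    unfolding rA by (rule symmetric_fun_eigvals[OF f Q])
  also have "\<dots> = f (r *\<^sub>R eigvals (gram X))"
    unfolding A by (rule symmetric_fun_eigvals[OF g Q, symmetric])
  finally show ?thesis .
qed

text \<open>The squares (v . column j)^2 add up to |X^T v|^2 = v . (X X^T) v, so the spike enters
  only through a quadratic form of \<open>gram X\<close>.\<close>

lemma prod_spiked_density_columns:
  fixes X :: "real^'m^'n" and v :: "real^'n"
  assumes C: "C > 0"
  shows "(\<Prod>j\<in>UNIV. ennreal (C * exp (- ((norm (column j X))\<^sup>2 - \<kappa> * (v \<bullet> column j X)\<^sup>2) / 2))) =
    ennreal (C ^ CARD('m) * exp (- (norm X)\<^sup>2 / 2)) * ennreal (exp (\<kappa> / 2 * (v \<bullet> (gram X *v v))))"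
proof -
  have n: "(norm X)\<^sup>2 = (\<Sum>j\<in>UNIV. (norm (column j X))\<^sup>2)"
    by (simp add: norm_vec_def L2_set_def sum_nonneg column_def) (rule sum.swap)
  have "transpose X *v v = (\<chi> j. v \<bullet> column j X)"
    by (simp add: vec_eq_iff matrix_vector_mult_def transpose_def inner_vec_def column_def mult.commute del: transpose_matrix_vector)
  then have q: "v \<bullet> (gram X *v v) = (\<Sum>j\<in>UNIV. (v \<bullet> column j X)\<^sup>2)"
    unfolding quadratic_form_gram by (simp add: norm_vec_def L2_set_def sum_nonneg)
  have "(\<Prod>j\<in>UNIV. ennreal (C * exp (- ((norm (column j X))\<^sup>2 - \<kappa> * (v \<bullet> column j X)\<^sup>2) / 2)))
      = ennreal (\<Prod>j\<in>(UNIV::'m set). C * exp (- ((norm (column j X))\<^sup>2 - \<kappa> * (v \<bullet> column j X)\<^sup>2) / 2))"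
    using C by (intro prod_ennreal) simp
  also have "(\<Prod>j\<in>(UNIV::'m set). C * exp (- ((norm (column j X))\<^sup>2 - \<kappa> * (v \<bullet> column j X)\<^sup>2) / 2))
      = C ^ CARD('m) * exp (\<Sum>j\<in>UNIV. - ((norm (column j X))\<^sup>2 - \<kappa> * (v \<bullet> column j X)\<^sup>2) / 2)"
    by (simp add: prod.distrib exp_sum)
  also have "(\<Sum>j\<in>UNIV. - ((norm (column j X))\<^sup>2 - \<kappa> * (v \<bullet> column j X)\<^sup>2) / 2) = - (norm X)\<^sup>2 / 2 + \<kappa> / 2 * (v \<bullet> (gram X *v v))"
    unfolding n q by (simp add: sum_subtractf sum_distrib_left sum_divide_distrib[symmetric] diff_divide_distrib)
  also have "ennreal (C ^ CARD('m) * exp (- (norm X)\<^sup>2 / 2 + \<kappa> / 2 * (v \<bullet> (gram X *v v)))) =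
      ennreal (C ^ CARD('m) * exp (- (norm X)\<^sup>2 / 2)) * ennreal (exp (\<kappa> / 2 * (v \<bullet> (gram X *v v))))"
    unfolding exp_add mult.assoc[symmetric] by (rule ennreal_mult) (use C in auto)
  finally show ?thesis .
qed

text \<open>In the application r is M. The constant \<open>K\<close> collects the normalising
  factors of the columns, the ratio of the Gaussian to the eigenvalue mass, and the volume and
  homogeneity factors of the substitution of r l for l. The same substitution multiplies the
  parameter \<kappa> / 2 of the average by r.\<close>

theorem spiked_eigenvalue_law:
  fixes \<Omega> :: "'w measure" and X :: "'w \<Rightarrow> real^'m^('n::{finite,linorder})"
    and f :: "real^('n::{finite,linorder}) \<Rightarrow> ennreal" and g :: "real^('n::{finite,linorder}) \<Rightarrow> real"
  assumes MN: "CARD('m) > CARD('n)" and "prob_space \<Omega>" and X: "X \<in> borel_measurable \<Omega>"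
    and indep: "prob_space.indep_vars \<Omega> (\<lambda>_. borel) (\<lambda>j \<omega>. column j (X \<omega>)) UNIV"
    and dis: "\<And>j. distributed \<Omega> lborel (\<lambda>\<omega>. column j (X \<omega>)) (\<lambda>x. ennreal (g x))"
    and g: "\<And>x. g x = C * exp (- ((norm x)\<^sup>2 - \<kappa> * (v \<bullet> x)\<^sup>2) / 2)" and C: "C > 0" and v: "norm v = 1"
    and f: "f \<in> borel_measurable borel" "symmetric_fun f" and r: "r > 0"
  defines "\<alpha> \<equiv> (real CARD('m) - real CARD('n) - 1) / 2"
  defines "K \<equiv> C ^ CARD('m) * (\<integral>X. exp (- (norm X)\<^sup>2 / 2) \<partial>(lborel::(real^'m^('n::{finite,linorder})) measure))
      / (\<integral>l. wishart_weight \<alpha> 1 l \<partial>(lborel::(real^('n::{finite,linorder})) measure))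
      * (r ^ CARD('n) * (r ^ card {(a::'n, b). a < b} * (r powr \<alpha>) ^ CARD('n)))"
  shows "K > 0"
    and "(\<integral>\<^sup>+\<omega>. f (eigvals ((1 / r) *\<^sub>R gram (X \<omega>))) \<partial>\<Omega>) =
      (\<integral>\<^sup>+l. f l * ennreal (K * wishart_weight \<alpha> r l * sphere_average (\<kappa> / 2 * r) l) \<partial>lborel)"
proof -
  define ZA where "ZA = (\<integral>X. exp (- (norm X)\<^sup>2 / 2) \<partial>(lborel::(((real,'m) vec,'n) vec) measure))"
  define ZB where "ZB = (\<integral>l. wishart_weight \<alpha> 1 l \<partial>(lborel::((real,'n) vec) measure))"
  define D where "D = r ^ card {(a::'n, b). a < b} * (r powr \<alpha>) ^ CARD('n)"
  have \<alpha>: "\<alpha> \<ge> 0" using MN by (simp add: \<alpha>_def)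
  have ZA: "ZA > 0" using integral_gaussian_pos[OF zero_less_one] by (simp add: ZA_def)
  have ZB: "ZB > 0" unfolding ZB_def by (rule integral_wishart_weight_pos[OF zero_less_one \<alpha>])
  have D: "D > 0" using r by (simp add: D_def)
  have K: "K = C ^ CARD('m) * ZA / ZB * (r ^ CARD('n) * D)" by (simp add: K_def ZA_def ZB_def D_def)
  show "K > 0" unfolding K using C ZA ZB D r by simp
  note f(1)[measurable]
  define fr where "fr = (\<lambda>l. f ((1 / r) *\<^sub>R l))"
  have fr[measurable]: "fr \<in> borel_measurable borel" unfolding fr_def by measurable
  have fr_sym: "symmetric_fun fr"
    unfolding symmetric_fun_def
  proof (intro allI impI)
    fix l :: "(real,'n) vec" and p :: "'n \<Rightarrow> 'n" assume p: "p permutes UNIV"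
    have "(1 / r) *\<^sub>R (\<chi> i. l $ p i) = (\<chi> i. ((1 / r) *\<^sub>R l) $ p i)" by (simp add: vec_eq_iff)
    then show "fr (\<chi> i. l $ p i) = fr l" unfolding fr_def using f(2) p by (simp only: symmetric_fun_def)
  qed
  let ?F = "\<lambda>x::((real,'m) vec,'n) vec. fr (eigvals (gram x))"
  have F[measurable]: "?F \<in> borel_measurable borel" by (rule measurable_eigvals_gram[OF fr fr_sym])
  have gm: "(\<lambda>x. ennreal (g x)) \<in> borel_measurable borel" unfolding g by measurable
  define f2 where "f2 = (\<lambda>l. fr l * ennreal (sphere_average (\<kappa> / 2) l))"
  have f2[measurable]: "f2 \<in> borel_measurable borel" unfolding f2_def by measurable
  have f2_sym: "symmetric_fun f2"
    using fr_sym symmetric_fun_sphere_average[of "\<kappa> / 2", where 'n = 'n] unfolding symmetric_fun_def f2_def by simp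
  have F2[measurable]: "(\<lambda>x::((real,'m) vec,'n) vec. f2 (eigvals (gram x))) \<in> borel_measurable borel"
    by (rule measurable_eigvals_gram[OF f2 f2_sym])
  let ?H = "\<lambda>x::((real,'m) vec,'n) vec. ennreal (C ^ CARD('m) * exp (- (norm x)\<^sup>2 / 2)) * ?F x"
  have "(\<integral>\<^sup>+\<omega>. f (eigvals ((1 / r) *\<^sub>R gram (X \<omega>))) \<partial>\<Omega>) = (\<integral>\<^sup>+\<omega>. ?F (X \<omega>) \<partial>\<Omega>)"
    unfolding symmetric_fun_eigvals_scaleR_gram[OF f(2)] fr_def ..
  also have "\<dots> = (\<integral>\<^sup>+x. (\<Prod>j\<in>UNIV. ennreal (g (column j x))) * ?F x \<partial>lborel)"
    by (rule nn_integral_independent_columns[OF \<open>prob_space \<Omega>\<close> X indep dis gm F])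
  also have "\<dots> = (\<integral>\<^sup>+x. ?H x * ennreal (exp (\<kappa> / 2 * (v \<bullet> (gram x *v v)))) \<partial>lborel)"
    unfolding g prod_spiked_density_columns[OF C] by (simp only: mult_ac)
  also have "\<dots> = (\<integral>\<^sup>+x. ?H x * ennreal (sphere_average (\<kappa> / 2) (eigvals (gram x))) \<partial>lborel)"
  proof (rule nn_integral_spike_average[OF _ _ v])
    show "?H \<in> borel_measurable borel" by measurable
    show "?H (Q ** x) = ?H x" if "orthogonal_matrix Q" for Q x
      using symmetric_fun_eigvals_conjugate[OF fr_sym that, of x] norm_orthogonal_mult_matrix[OF that, of x] by simp
  qed
  also have "\<dots> = (\<integral>\<^sup>+x. ennreal (C ^ CARD('m) * ZA) * (ennreal (exp (- (norm x)\<^sup>2 / 2) / ZA) * f2 (eigvals (gram x))) \<partial>(lborel::(((real,'m) vec,'n) vec) measure))"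
  proof (rule nn_integral_cong)
    fix x :: "((real,'m) vec,'n) vec"
    have "ennreal (C ^ CARD('m) * exp (- (norm x)\<^sup>2 / 2)) = ennreal (C ^ CARD('m) * ZA * (exp (- (norm x)\<^sup>2 / 2) / ZA))" using ZA by simp
    also have "\<dots> = ennreal (C ^ CARD('m) * ZA) * ennreal (exp (- (norm x)\<^sup>2 / 2) / ZA)"
      by (rule ennreal_mult) (use C ZA in auto)
    finally show "?H x * ennreal (sphere_average (\<kappa> / 2) (eigvals (gram x))) =
       ennreal (C ^ CARD('m) * ZA) * (ennreal (exp (- (norm x)\<^sup>2 / 2) / ZA) * f2 (eigvals (gram x)))"
      unfolding f2_def by (simp only: mult_ac)
  qed
  also have "\<dots> = ennreal (C ^ CARD('m) * ZA) * (\<integral>\<^sup>+x. ennreal (exp (- (norm x)\<^sup>2 / 2) / ZA) * f2 (eigvals (gram x)) \<partial>(lborel::(((real,'m) vec,'n) vec) measure))"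
    by (rule nn_integral_cmult) measurable
  also have "(\<integral>\<^sup>+x. ennreal (exp (- (norm x)\<^sup>2 / 2) / ZA) * f2 (eigvals (gram x)) \<partial>(lborel::(((real,'m) vec,'n) vec) measure))
     = (\<integral>\<^sup>+l. ennreal (wishart_weight \<alpha> 1 l / ZB) * f2 l \<partial>lborel)"
    unfolding ZA_def ZB_def \<alpha>_def by (rule eigenvalue_law_gaussian[OF MN f2 f2_sym])
  also have "\<dots> = ennreal (r ^ CARD('n)) * (\<integral>\<^sup>+l. ennreal (wishart_weight \<alpha> 1 (r *\<^sub>R l) / ZB) * f2 (r *\<^sub>R l) \<partial>lborel)"
    by (subst nn_integral_lborel_scaleR[OF _ r]) auto
  also have "ennreal (C ^ CARD('m) * ZA) * (ennreal (r ^ CARD('n)) * (\<integral>\<^sup>+l. ennreal (wishart_weight \<alpha> 1 (r *\<^sub>R l) / ZB) * f2 (r *\<^sub>R l) \<partial>lborel))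
     = (\<integral>\<^sup>+l. ennreal (C ^ CARD('m) * ZA) * (ennreal (r ^ CARD('n)) * (ennreal (wishart_weight \<alpha> 1 (r *\<^sub>R l) / ZB) * f2 (r *\<^sub>R l))) \<partial>lborel)"
    by (subst nn_integral_cmult; (subst nn_integral_cmult)?) measurable
  also have "\<dots> = (\<integral>\<^sup>+l. f l * ennreal (K * wishart_weight \<alpha> r l * sphere_average (\<kappa> / 2 * r) l) \<partial>lborel)"
  proof (rule nn_integral_cong)
    fix l :: "(real,'n) vec"
    have f2r: "f2 (r *\<^sub>R l) = f l * ennreal (sphere_average (\<kappa> / 2 * r) l)"
      using r by (simp add: f2_def fr_def sphere_average_scaleR)
    have w: "wishart_weight \<alpha> 1 (r *\<^sub>R l) = D * wishart_weight \<alpha> r l"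
      using wishart_weight_scaleR[OF r, of \<alpha> 1 l] by (simp add: D_def)
    have nn: "0 \<le> wishart_weight \<alpha> r l" "0 \<le> sphere_average (\<kappa> / 2 * r) l"
      by (simp_all add: wishart_weight_nonneg sphere_average_nonneg)
    have "ennreal (K * wishart_weight \<alpha> r l * sphere_average (\<kappa> / 2 * r) l) =
        ennreal (C ^ CARD('m) * ZA) * ennreal (r ^ CARD('n)) * ennreal (D * wishart_weight \<alpha> r l / ZB) * ennreal (sphere_average (\<kappa> / 2 * r) l)"
    proof -
      have "K * wishart_weight \<alpha> r l * sphere_average (\<kappa> / 2 * r) l =
          C ^ CARD('m) * ZA * r ^ CARD('n) * (D * wishart_weight \<alpha> r l / ZB) * sphere_average (\<kappa> / 2 * r) l"
        by (simp add: K mult_ac)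
      then show ?thesis using nn C ZA ZB D r by (simp only: ennreal_mult mult_nonneg_nonneg divide_nonneg_nonneg less_imp_le zero_le_power)
    qed
    then show "ennreal (C ^ CARD('m) * ZA) * (ennreal (r ^ CARD('n)) * (ennreal (wishart_weight \<alpha> 1 (r *\<^sub>R l) / ZB) * f2 (r *\<^sub>R l)))
       = f l * ennreal (K * wishart_weight \<alpha> r l * sphere_average (\<kappa> / 2 * r) l)"
      unfolding f2r w by (simp only: mult_ac)
  qed
  finally show "(\<integral>\<^sup>+\<omega>. f (eigvals ((1 / r) *\<^sub>R gram (X \<omega>))) \<partial>\<Omega>) =
      (\<integral>\<^sup>+l. f l * ennreal (K * wishart_weight \<alpha> r l * sphere_average (\<kappa> / 2 * r) l) \<partial>lborel)" .
qed

text \<open>The factors that do not involve t combine to \<open>wishart_weight\<close>, which leaves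
  the integral of \<open>contour_integral_spike\<close>.\<close>

lemma contour_integral_spiked_integrand:
  fixes l :: "real^('n::{finite,linorder})" and M m :: nat and \<tau> :: real
  assumes l: "\<And>i. 0 < l $ i" and N: "CARD('n) = 2 * m"
    and g: "valid_path \<gamma>" "pathfinish \<gamma> = pathstart \<gamma>"
    and w: "\<And>x. (\<exists>i j. l $ i \<le> x \<and> x \<le> l $ j) \<Longrightarrow> of_real x \<notin> path_image \<gamma> \<and> winding_number \<gamma> (of_real x) = 1"
  defines "c \<equiv> real M * \<tau> / (2 * (1 + \<tau>))"
  shows "contour_integral \<gamma> (\<lambda>t. of_real (abs_vandermonde l) * spiked_integrand M \<tau> l t) =
    2 * of_real pi * \<i> * of_real (c ^ (m - 1) / fact (m - 1)
      * (wishart_weight ((real M - real CARD('n) - 1) / 2) (real M) l * sphere_average c l))"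
proof -
  let ?\<alpha> = "(real M - real CARD('n) - 1) / 2"
  define W where "W = (\<Prod>j\<in>UNIV. exp (- real M / 2 * l $ j) * l $ j powr ?\<alpha>)"
  have "W = exp (- real M * (\<Sum>j\<in>UNIV. l $ j) / 2) * (\<Prod>j\<in>UNIV. l $ j powr ?\<alpha>)"
    by (simp add: W_def prod.distrib exp_sum[symmetric] sum_distrib_left sum_negf sum_divide_distrib)
  then have ww: "abs_vandermonde l * W = wishart_weight ?\<alpha> (real M) l"
    using l by (simp add: wishart_weight_def)
  have eq: "(\<lambda>t. of_real (abs_vandermonde l) * spiked_integrand M \<tau> l t) =
     (\<lambda>t. of_real (wishart_weight ?\<alpha> (real M) l) * (exp (of_real c * t) * inv_sqrt_prod l t))"
    unfolding ww[symmetric] by (simp add: spiked_integrand_def inv_sqrt_prod_def W_def c_def prod.distrib fun_eq_iff mult_ac)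
  have "(\<lambda>t. exp (of_real c * t) * inv_sqrt_prod l t) contour_integrable_on \<gamma>"
    by (rule contour_integrable_spike) (use N g w in \<open>auto simp: real_hull_def\<close>)
  then have L: "contour_integral \<gamma> (\<lambda>t. of_real (wishart_weight ?\<alpha> (real M) l) * (exp (of_real c * t) * inv_sqrt_prod l t)) =
      of_real (wishart_weight ?\<alpha> (real M) l) * contour_integral \<gamma> (\<lambda>t. exp (of_real c * t) * inv_sqrt_prod l t)"
    by (rule contour_integral_lmul)
  have S: "contour_integral \<gamma> (\<lambda>t. exp (of_real c * t) * inv_sqrt_prod l t) =
      2 * of_real pi * \<i> * of_real (c ^ (m - 1) / fact (m - 1) * sphere_average c l)"
    by (rule contour_integral_spike) (use l N g w in auto)
  show ?thesis unfolding eq L S by (simp add: mult_ac)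
qed

theorem theorem3:
  fixes \<Omega> :: "'w measure"
    and X :: "'w \<Rightarrow> real^'m^('n::{finite,linorder})"
    and \<Sigma> :: "real^('n::{finite,linorder})^('n::{finite,linorder})"
    and \<tau> :: real
  defines "N \<equiv> card (UNIV :: 'n set)" and "M \<equiv> card (UNIV :: 'm set)"
  defines "Y \<equiv> (\<lambda>\<omega>. (1 / real M) *\<^sub>R (X \<omega> ** transpose (X \<omega>)))"
  assumes "M > N" and "even N"
    and "prob_space \<Omega>"
    and "X \<in> borel_measurable \<Omega>"
    and "prob_space.indep_vars \<Omega> (\<lambda>_. borel) (\<lambda>j \<omega>. column j (X \<omega>)) UNIV"
    and "\<And>j. distributed \<Omega> lborel (\<lambda>\<omega>. column j (X \<omega>)) (\<lambda>x. ennreal (mvn_density \<Sigma> x))"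
    and "transpose \<Sigma> = \<Sigma>"
    and "\<And>x. det (x *\<^sub>R mat 1 - \<Sigma>) = (x - 1) ^ (N - 1) * (x - (1 + \<tau>))"
    and "\<tau> > -1" and "\<tau> \<noteq> 0"
  shows "\<exists>P :: real^('n::{finite,linorder}) \<Rightarrow> real. \<exists>Z :: complex.
           P \<in> borel_measurable lborel \<and> (\<forall>l. P l \<ge> 0) \<and> symmetric_fun P \<and> Z \<noteq> 0 \<and>
           (\<forall>f :: real^('n::{finite,linorder}) \<Rightarrow> ennreal. f \<in> borel_measurable lborel \<longrightarrow> symmetric_fun f \<longrightarrow>
              (\<integral>\<^sup>+ \<omega>. f (eigvals (Y \<omega>)) \<partial>\<Omega>) =
              (\<integral>\<^sup>+ l. indicator {l. \<forall>i. l$i > 0} l * f l * ennreal (P l) \<partial>lborel)) \<and>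
           (\<forall>l. (\<forall>i. l$i > 0) \<longrightarrow> (\<forall>i j. i \<noteq> j \<longrightarrow> l$i \<noteq> l$j) \<longrightarrow>
              (\<forall>\<gamma>. valid_path \<gamma> \<longrightarrow> pathfinish \<gamma> = pathstart \<gamma> \<longrightarrow>
                 (\<forall>x::real. (\<exists>i j. l$i \<le> x \<and> x \<le> l$j) \<longrightarrow>
                     of_real x \<notin> path_image \<gamma> \<and> winding_number \<gamma> (of_real x) = 1) \<longrightarrow>
                 complex_of_real (P l) =
                   contour_integral \<gamma> (\<lambda>t. of_real (abs_vandermonde l) * spiked_integrand M \<tau> l t) / Z))"
proof -
  obtain m where m: "CARD('n) = 2 * m" using \<open>even N\<close> unfolding N_def by (elim evenE)
  have MN: "CARD('m) > CARD('n)" using \<open>M > N\<close> by (simp add: M_def N_def)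
  then have M: "real M > 0" by (simp add: M_def)
  obtain v C where v: "norm v = 1" and C: "C > 0"
    and dens: "\<And>x. mvn_density \<Sigma> x = C * exp (- ((norm x)\<^sup>2 - \<tau> / (1 + \<tau>) * (v \<bullet> x)\<^sup>2) / 2)"
    using spiked_mvn_density[OF \<open>transpose \<Sigma> = \<Sigma>\<close> assms(11)[unfolded N_def] \<open>\<tau> > -1\<close>] by blast
  define \<alpha> where "\<alpha> = (real CARD('m) - real CARD('n) - 1) / 2"
  \<comment> \<open>Half the spike coefficient \<tau> / (1 + \<tau>) of the column density, times M
    from rescaling the eigenvalues; this is the exponent in the contour integral.\<close>
  define c where "c = real M * \<tau> / (2 * (1 + \<tau>))"
  have c0: "c \<noteq> 0" using M \<open>\<tau> > -1\<close> \<open>\<tau> \<noteq> 0\<close> by (simp add: c_def)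
  have c: "\<tau> / (1 + \<tau>) / 2 * real M = c" by (simp add: c_def mult.commute distrib_left)
  note law = spiked_eigenvalue_law[OF MN \<open>prob_space \<Omega>\<close> assms(7-9) dens C v _ _ M]
  define K where "K = C ^ CARD('m) * (\<integral>X. exp (- (norm X)\<^sup>2 / 2) \<partial>(lborel::(((real,'m) vec,'n) vec) measure))
      / (\<integral>l. wishart_weight \<alpha> 1 l \<partial>(lborel::((real,'n) vec) measure))
      * (real M ^ CARD('n) * (real M ^ card {(a::'n, b). a < b} * (real M powr \<alpha>) ^ CARD('n)))"
  have K: "K > 0"
    using law(1)[of "\<lambda>_. 0"] unfolding K_def \<alpha>_def by (simp add: symmetric_fun_def)
  have Kl: "(\<integral>\<^sup>+\<omega>. f (eigvals ((1 / real M) *\<^sub>R gram (X \<omega>))) \<partial>\<Omega>) =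
      (\<integral>\<^sup>+l. f l * ennreal (K * wishart_weight \<alpha> (real M) l * sphere_average c l) \<partial>lborel)"
    if "f \<in> borel_measurable borel" "symmetric_fun f" for f :: "(real,'n) vec \<Rightarrow> ennreal"
    using law(2)[OF that] unfolding c K_def \<alpha>_def .
  define P where "P = (\<lambda>l :: (real,'n) vec. K * wishart_weight \<alpha> (real M) l * sphere_average c l)"
  \<comment> \<open>\<open>Z\<close> undoes the factor 2 pi i c ^ (m - 1) / (m - 1)! that separates
    the contour integral from the average, and supplies \<open>K\<close>; it is nonzero because c
    \<noteq> 0, which rests on \<tau> \<noteq> 0.\<close>
  define Z where "Z = 2 * of_real pi * \<i> * of_real (c ^ (m - 1) / fact (m - 1) / K)"
  have "P \<in> borel_measurable lborel" unfolding P_def by simp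
  moreover have "\<forall>l. P l \<ge> 0"
    unfolding P_def using K by (auto intro!: mult_nonneg_nonneg wishart_weight_nonneg sphere_average_nonneg)
  moreover have "symmetric_fun P"
    using symmetric_fun_wishart_weight[of \<alpha> "real M", where 'n = 'n] symmetric_fun_sphere_average[of c, where 'n = 'n]
    unfolding symmetric_fun_def P_def by simp
  moreover have "Z \<noteq> 0" using c0 K by (simp add: Z_def)
  moreover have "(\<integral>\<^sup>+ \<omega>. f (eigvals (Y \<omega>)) \<partial>\<Omega>) = (\<integral>\<^sup>+ l. indicator {l. \<forall>i. l$i > 0} l * f l * ennreal (P l) \<partial>lborel)"
    if "f \<in> borel_measurable lborel" "symmetric_fun f" for f :: "(real,'n) vec \<Rightarrow> ennreal"
  proof -
    have "(\<integral>\<^sup>+ \<omega>. f (eigvals (Y \<omega>)) \<partial>\<Omega>) = (\<integral>\<^sup>+l. f l * ennreal (P l) \<partial>lborel)"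
      using Kl[of f] that by (simp add: Y_def gram_def P_def)
    also have "\<dots> = (\<integral>\<^sup>+ l. indicator {l. \<forall>i. l$i > 0} l * f l * ennreal (P l) \<partial>lborel)"
      by (rule nn_integral_cong) (auto simp: P_def wishart_weight_def indicator_def)
    finally show ?thesis .
  qed
  moreover have "complex_of_real (P l) =
       contour_integral \<gamma> (\<lambda>t. of_real (abs_vandermonde l) * spiked_integrand M \<tau> l t) / Z"
    if l: "\<forall>i. l$i > 0" and g: "valid_path \<gamma>" "pathfinish \<gamma> = pathstart \<gamma>"
      and w: "\<forall>x::real. (\<exists>i j. l$i \<le> x \<and> x \<le> l$j) \<longrightarrow> of_real x \<notin> path_image \<gamma> \<and> winding_number \<gamma> (of_real x) = 1"
    for l :: "(real,'n) vec" and \<gamma>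
  proof -
    have "contour_integral \<gamma> (\<lambda>t. of_real (abs_vandermonde l) * spiked_integrand M \<tau> l t) =
      2 * of_real pi * \<i> * of_real (c ^ (m - 1) / fact (m - 1) * (wishart_weight \<alpha> (real M) l * sphere_average c l))"
      using contour_integral_spiked_integrand[OF _ m g, of l M \<tau>] l w by (simp add: c_def \<alpha>_def M_def)
    also have "\<dots> = Z * of_real (P l)" using K by (simp add: Z_def P_def)
    finally show ?thesis using \<open>Z \<noteq> 0\<close> by simp
  qed
  ultimately show ?thesis by blast
qed

end
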